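(* Let $G$ be of type $C_n$, let $\mathbf{i}_0=(1\,2\cdots n)^n$, and let $c=(c^{(m)}_i)_{1\le i,m\le n}\in(\mathbb{C}^\times)^{n^2}$. Put $c^{(m)}_0=1$. (i) For $k\in\{1,2,\dots,n-1\}$, $$\Delta_{w_0s_k\Lambda_k,\Lambda_k}(\Theta^-_{\mathbf{i}_0}(c))=\frac{1}{c^{(k)}_1}+\sum_{j=1}^{k-1}\frac{c^{(j)}_{k-j}}{c^{(j)}_{k-j+1}}.$$ (ii) Set $C^{(j)}_i=\dfrac{c^{(n-j)}_i}{c^{(n-j+1)}_{i-1}}$ and $\overline{C}^{(j)}_i=\dfrac{c^{(n-j)}_{i-1}}{c^{(n-j)}_i}$. Then $$\Delta_{w_0s_n\Lambda_n,\Lambda_n}(\Theta^-_{\mathbf{i}_0}(c))=\sum_{( * )}C^{(1)}_{u_1}C^{(2)}_{u_2}\cdots C^{(m)}_{u_m}\cdot\overline{C}^{(l_1-1)}_{l_1}\overline{C}^{(l_2-2)}_{l_2}\cdots\overline{C}^{(l_k-k)}_{l_k},$$ where the sum $( * )$ runs over all integers $k,m$ with $k+m=n$, $0\le m<n$, and all integers $1\le l_1<l_2<\cdots<l_k\le n$ and $1\le u_1<u_2<\cdots<u_m\le n$.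
   Context: $G$ is the simply connected simple algebraic group over $\mathbb{C}$ of type $C_n$ ($n\ge2$), $I=\{1,\dots,n\}$, with Chevalley generators $e_i,f_i,h_i$ of its Lie algebra, simple roots $\alpha_i$, fundamental weights $\Lambda_i$ ($\Lambda_i(h_j)=\delta_{ij}$), and Cartan matrix $a_{ij}=\alpha_j(h_i)$ given by $a_{ii}=2$, $a_{n-1,n}=-2$, $a_{ij}=-1$ for other $|i-j|=1$, and $0$ otherwise ($\alpha_n$ is the long root). $T$ is the maximal torus, $U^{\pm}$ the unipotent subgroups generated by $x_i(t)=\exp(te_i)$, resp. $y_i(t)=\exp(tf_i)$; $\alpha_i^\vee:\mathbb{C}^\times\to T$ is the coroot one-parameter subgroup. $W$ is the Weyl group, $s_i$ the simple reflections, $w_0$ the longest element. Set $\overline{s}_i=x_i(-1)y_i(1)x_i(-1)$ and $\overline{w}=\overline{s}_{i_1}\cdots\overline{s}_{i_l}$ for any reduced expression $w=s_{i_1}\cdots s_{i_l}$. Generalized minors: $\Delta_{\Lambda_i}$ is the regular function on $G$ with $\Delta_{\Lambda_i}(u^-tu^+)=\Lambda_i(t)$ for $u^\pm\in U^\pm$, $t\in T$; for $u,v\in W$, $\Delta_{u\Lambda_i,v\Lambda_i}(g)=\Delta_{\Lambda_i}(\overline{u}^{-1}g\,\overline{v})$ (so $\Delta_{w_0s_k\Lambda_k,\Lambda_k}(g)=\Delta_{\Lambda_k}(\overline{w_0s_k}^{\,-1}g)$). Set $\mathbf{y}_i(c)=y_i(c)\alpha_i^\vee(c^{-1})$. The word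 $\mathbf{i}_0=(12\cdots n)^n$ is a reduced word of $w_0$ and $$\Theta^-_{\mathbf{i}_0}(c)=\prod_{m=1}^{n}\mathbf{y}_1(c^{(m)}_1)\mathbf{y}_2(c^{(m)}_2)\cdots\mathbf{y}_n(c^{(m)}_n),$$ the factors for $m=1,2,\dots,n$ being multiplied from left to right. *)

theory Defs
  imports Complex_Main "HOL-Algebra.Generated_Groups" "Jordan_Normal_Form.Matrix"
begin

text \<open>
  The simply connected group of type \<open>C\<^sub>n\<close> is realised as \<open>Sp\<^sub>2\<^sub>n\<close>, acting on the vector
  representation with ordered basis \<open>v\<^sub>1, \<dots>, v\<^sub>n, v\<^sub>n', \<dots>, v\<^sub>1'\<close>, where \<open>v\<^sub>i'\<close> has weight opposite to
  \<open>v\<^sub>i\<close>.  Matrix positions are counted from 0, so \<open>v\<^sub>i\<close> sits at \<open>i - 1\<close> and \<open>v\<^sub>i'\<close> at \<open>2n - i\<close>.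
  The indices in \<open>I = {1..n}\<close>, of words and of the parameters \<open>c\<close> are counted from 1.
\<close>

definition mprod :: "nat \<Rightarrow> complex mat list \<Rightarrow> complex mat" where
  "mprod n gs = foldr (*) gs (1\<^sub>m (2 * n))"

text \<open>The signs of the form alternate so that all \<open>f\<^sub>i\<close> below have nonnegative entries.\<close>

definition sympl_form :: "nat \<Rightarrow> complex mat" where
  "sympl_form n = mat (2 * n) (2 * n) (\<lambda>(a, b). if a + b + 1 = 2 * n then (- 1) ^ a else 0)"

definition Sp :: "nat \<Rightarrow> complex mat monoid" where
  "Sp n = \<lparr>carrier = {g \<in> carrier_mat (2 * n) (2 * n).
                       transpose_mat g * sympl_form n * g = sympl_form n},
           monoid.mult = (*), one = 1\<^sub>m (2 * n)\<rparr>"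

text \<open>
  \<open>f\<^sub>i v\<^sub>i = v\<^sub>i\<^sub>+\<^sub>1\<close> and \<open>f\<^sub>i v\<^sub>i\<^sub>+\<^sub>1' = v\<^sub>i'\<close> for \<open>i < n\<close>, \<open>f\<^sub>n v\<^sub>n = v\<^sub>n'\<close>, all other basis vectors being
  killed; \<open>e\<^sub>i\<close> is the transpose of \<open>f\<^sub>i\<close>.  For \<open>i = n\<close> the two nonzero positions coincide.
\<close>

definition chev_e :: "nat \<Rightarrow> nat \<Rightarrow> complex mat" where
  "chev_e n i = mat (2 * n) (2 * n)
     (\<lambda>(a, b). if b = a + 1 \<and> (b = i \<or> b = 2 * n - i) then 1 else 0)"

definition chev_f :: "nat \<Rightarrow> nat \<Rightarrow> complex mat" where
  "chev_f n i = transpose_mat (chev_e n i)"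

definition mat_exp :: "complex mat \<Rightarrow> complex mat" where
  "mat_exp A = mat (dim_row A) (dim_row A) (\<lambda>(a, b). \<Sum>k. (A ^\<^sub>m k) $$ (a, b) / fact k)"

definition x_sub :: "nat \<Rightarrow> nat \<Rightarrow> complex \<Rightarrow> complex mat" where
  "x_sub n i t = mat_exp (t \<cdot>\<^sub>m chev_e n i)"

definition y_sub :: "nat \<Rightarrow> nat \<Rightarrow> complex \<Rightarrow> complex mat" where
  "y_sub n i t = mat_exp (t \<cdot>\<^sub>m chev_f n i)"

text \<open>
  The one-parameter subgroup \<open>\<alpha>\<^sub>i\<^sup>\<or>\<close> with derivative \<open>h\<^sub>i = e\<^sub>i f\<^sub>i - f\<^sub>i e\<^sub>i\<close>, which is diagonal with
  eigenvalue 1 on \<open>v\<^sub>i, v\<^sub>i\<^sub>+\<^sub>1'\<close> and -1 on \<open>v\<^sub>i\<^sub>+\<^sub>1, v\<^sub>i'\<close> (for \<open>i = n\<close>: 1 on \<open>v\<^sub>n\<close> and -1 on \<open>v\<^sub>n'\<close>).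
\<close>

definition coroot :: "nat \<Rightarrow> nat \<Rightarrow> complex \<Rightarrow> complex mat" where
  "coroot n i c = mat (2 * n) (2 * n)
     (\<lambda>(a, b). if a \<noteq> b then 0
               else if a = i - 1 \<or> a = 2 * n - i - 1 then c
               else if a = i \<or> a = 2 * n - i then inverse c
               else 1)"

definition U_plus :: "nat \<Rightarrow> complex mat set" where
  "U_plus n = generate (Sp n) {x_sub n i t | i t. i \<in> {1..n}}"

definition U_minus :: "nat \<Rightarrow> complex mat set" where
  "U_minus n = generate (Sp n) {y_sub n i t | i t. i \<in> {1..n}}"

text \<open>
  Since the group is simply connected, \<open>(c\<^sub>1, \<dots>, c\<^sub>n) \<mapsto> \<alpha>\<^sub>1\<^sup>\<or>(c\<^sub>1) \<dots> \<alpha>\<^sub>n\<^sup>\<or>(c\<^sub>n)\<close> is an isomorphism of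
  \<open>(\<complex>\<^sup>\<times>)\<^sup>n\<close> with \<open>T\<close>, and \<open>\<Lambda>\<^sub>i(h\<^sub>j) = \<delta>\<^sub>i\<^sub>j\<close> says that the character \<open>\<Lambda>\<^sub>i\<close> maps this element to \<open>c\<^sub>i\<close>.
\<close>

definition torus_elt :: "nat \<Rightarrow> (nat \<Rightarrow> complex) \<Rightarrow> complex mat" where
  "torus_elt n c = mprod n (map (\<lambda>j. coroot n j (c j)) [1..<n + 1])"

definition max_torus :: "nat \<Rightarrow> complex mat set" where
  "max_torus n = {torus_elt n c | c. \<forall>j\<in>{1..n}. c j \<noteq> 0}"

definition fund_weight :: "nat \<Rightarrow> nat \<Rightarrow> complex mat \<Rightarrow> complex" where
  "fund_weight n i t =
     (THE z. \<exists>c. (\<forall>j\<in>{1..n}. c j \<noteq> 0) \<and> t = torus_elt n c \<and> z = c i)"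

definition cartan :: "nat \<Rightarrow> nat \<Rightarrow> nat \<Rightarrow> int" where
  "cartan n i j =
     (if i = j then 2
      else if i = n - 1 \<and> j = n then - 2
      else if i = j + 1 \<or> j = i + 1 then - 1
      else 0)"

text \<open>
  The Weyl group acts on integral weights \<open>\<lambda>\<close>, given by their coordinates \<open>\<lambda>(h\<^sub>j)\<close>, \<open>j \<in> {1..n}\<close>
  (values at other indices are left alone), through \<open>s\<^sub>i \<lambda> = \<lambda> - \<lambda>(h\<^sub>i) \<alpha>\<^sub>i\<close> and \<open>\<alpha>\<^sub>i(h\<^sub>j) = a\<^sub>j\<^sub>i\<close>.
  As this action is faithful, its elements are identified with the maps they induce.
\<close>

type_synonym weyl = "(nat \<Rightarrow> int) \<Rightarrow> (nat \<Rightarrow> int)"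

definition simple_refl :: "nat \<Rightarrow> nat \<Rightarrow> weyl" where
  "simple_refl n i wt = (\<lambda>j. if j \<in> {1..n} then wt j - wt i * cartan n j i else wt j)"

definition weyl_word :: "nat \<Rightarrow> nat list \<Rightarrow> weyl" where
  "weyl_word n is = foldr (\<lambda>i w. simple_refl n i \<circ> w) is id"

definition weyl_group :: "nat \<Rightarrow> weyl set" where
  "weyl_group n = weyl_word n ` lists {1..n}"

definition weyl_length :: "nat \<Rightarrow> weyl \<Rightarrow> nat" where
  "weyl_length n w = (LEAST l. \<exists>is \<in> lists {1..n}. weyl_word n is = w \<and> length is = l)"

definition reduced_word :: "nat \<Rightarrow> weyl \<Rightarrow> nat list \<Rightarrow> bool" where
  "reduced_word n w is \<longleftrightarrow>
     is \<in> lists {1..n} \<and> weyl_word n is = w \<and> length is = weyl_length n w"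

definition longest_elt :: "nat \<Rightarrow> weyl" where
  "longest_elt n =
     (THE w. w \<in> weyl_group n \<and> (\<forall>v \<in> weyl_group n. weyl_length n v \<le> weyl_length n w))"

definition s_bar :: "nat \<Rightarrow> nat \<Rightarrow> complex mat" where
  "s_bar n i = x_sub n i (- 1) * y_sub n i 1 * x_sub n i (- 1)"

text \<open>The lift does not depend on the reduced word chosen, by the braid relations for the \<open>s_bar\<close>.\<close>

definition weyl_lift :: "nat \<Rightarrow> weyl \<Rightarrow> complex mat" where
  "weyl_lift n w = mprod n (map (s_bar n) (SOME is. reduced_word n w is))"

text \<open>
  Polynomials in the entries of a matrix of size \<open>N\<close>.  Since \<open>Sp\<^sub>2\<^sub>n\<close> is closed in the affine space of
  matrices, its regular functions are the restrictions of these.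
\<close>

inductive_set entry_polys :: "nat \<Rightarrow> (complex mat \<Rightarrow> complex) set" for N where
  const: "(\<lambda>_. z) \<in> entry_polys N"
| entry: "a < N \<Longrightarrow> b < N \<Longrightarrow> (\<lambda>g. g $$ (a, b)) \<in> entry_polys N"
| add: "p \<in> entry_polys N \<Longrightarrow> q \<in> entry_polys N \<Longrightarrow> (\<lambda>g. p g + q g) \<in> entry_polys N"
| mult: "p \<in> entry_polys N \<Longrightarrow> q \<in> entry_polys N \<Longrightarrow> (\<lambda>g. p g * q g) \<in> entry_polys N"

definition regular_on_Sp :: "nat \<Rightarrow> (complex mat \<Rightarrow> complex) \<Rightarrow> bool" where
  "regular_on_Sp n f \<longleftrightarrow> (\<exists>p \<in> entry_polys (2 * n). \<forall>g \<in> carrier (Sp n). f g = p g)"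

text \<open>
  The condition determines the function on all of \<open>Sp\<^sub>2\<^sub>n\<close>, because \<open>U\<^sup>- T U\<^sup>+\<close> is dense; only its
  irrelevant values off the group are left open, hence \<open>SOME\<close> rather than \<open>THE\<close>.
\<close>

definition principal_minor :: "nat \<Rightarrow> nat \<Rightarrow> complex mat \<Rightarrow> complex" where
  "principal_minor n i =
     (SOME f. regular_on_Sp n f \<and>
        (\<forall>u \<in> U_minus n. \<forall>t \<in> max_torus n. \<forall>v \<in> U_plus n. f (u * t * v) = fund_weight n i t))"

text \<open>\<open>gen_minor n i u v\<close> is \<open>\<Delta>\<close> with indices \<open>u \<Lambda>\<^sub>i, v \<Lambda>\<^sub>i\<close>.\<close>

definition gen_minor :: "nat \<Rightarrow> nat \<Rightarrow> weyl \<Rightarrow> weyl \<Rightarrow> complex mat \<Rightarrow> complex" where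
  "gen_minor n i u v g =
     principal_minor n i (inv\<^bsub>Sp n\<^esub> (weyl_lift n u) * g * weyl_lift n v)"

definition bold_y :: "nat \<Rightarrow> nat \<Rightarrow> complex \<Rightarrow> complex mat" where
  "bold_y n i c = y_sub n i c * coroot n i (inverse c)"

text \<open>Here and below, \<open>c m i\<close> stands for \<open>c\<close> with upper index \<open>m\<close> and lower index \<open>i\<close>.\<close>

definition Theta_minus :: "nat \<Rightarrow> (nat \<Rightarrow> nat \<Rightarrow> complex) \<Rightarrow> complex mat" where
  "Theta_minus n c =
     mprod n (concat (map (\<lambda>m. map (\<lambda>i. bold_y n i (c m i)) [1..<n + 1]) [1..<n + 1]))"

definition C_frac :: "nat \<Rightarrow> (nat \<Rightarrow> nat \<Rightarrow> complex) \<Rightarrow> nat \<Rightarrow> nat \<Rightarrow> complex" where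
  "C_frac n c j i = c (n - j) i / c (n - j + 1) (i - 1)"

definition C_bar :: "nat \<Rightarrow> (nat \<Rightarrow> nat \<Rightarrow> complex) \<Rightarrow> nat \<Rightarrow> nat \<Rightarrow> complex" where
  "C_bar n c j i = c (n - j) (i - 1) / c (n - j) i"

text \<open>
  Increasing sequences \<open>1 \<le> l\<^sub>1 < \<dots> < l\<^sub>k \<le> n\<close>, with \<open>l\<^sub>i\<close> stored at list position \<open>i - 1\<close>.
  They satisfy \<open>l\<^sub>i \<ge> i\<close>, so a difference \<open>l\<^sub>i - i\<close> of natural numbers is not truncated.
\<close>

definition incr_seqs :: "nat \<Rightarrow> nat \<Rightarrow> nat list set" where
  "incr_seqs n k = {l. length l = k \<and> sorted_wrt (<) l \<and> set l \<subseteq> {1..n}}"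

end

theory Submission
  imports Defs "Jordan_Normal_Form.Determinant"
begin

text \<open>
  Generalised minors are leading minors of matrices. Write \<open>g = inv (lift (w\<^sub>0 s\<^sub>k)) \<Theta>\<close> as \<open>s_bar k\<close>
  times the signed row reversal \<open>h\<close> of \<open>\<Theta>\<close>. In a suitable unitriangular basis of row vectors the first
  rows of \<open>h\<close> are unitriangular too, and the wanted minor is minus the coefficient of the
  \<open>k\<close>-th basis vector in row \<open>k\<close> of \<open>h\<close> (rows counted from 0).
  Each factor of \<open>\<Theta>\<close> acts on rows by a two-term recursion, so these coefficients are sums over
  lattice paths. For \<open>k < n\<close> only one path step is free, which gives (i). For \<open>k = n\<close> the result is
  \<open>\<Sum>\<^sub>k c\<^sub>n\<^sup>(\<^sup>k\<^sup>) Q\<^sub>k\<^sup>2\<close> with \<open>Q\<^sub>k\<close> the sum over \<open>l\<close> in (ii); exchanging a sequence with its complement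
  telescopes and turns one factor \<open>c\<^sub>n\<^sup>(\<^sup>k\<^sup>) Q\<^sub>k\<close> into the sum over \<open>u\<close>.

  The abstractly defined minor agrees with the leading minor at \<open>g\<close> because \<open>x_sub k z * g\<close> has a
  Gauss decomposition for all small \<open>z \<noteq> 0\<close>. The decomposition exists since the group generated by
  the \<open>y_sub i\<close> with \<open>i > r\<close> is transitive on vectors with leading entry 1 at position \<open>r\<close>. The lift of
  any reduced word is computed from the exchange property, which makes every letter an ascent.
\<close>

section \<open>Weyl group words as permutations\<close>

text \<open>The basis of row vectors consists of the \<open>v_1'\<close> rows of the partial
  products of the blocks q, ..., n of Theta, restricted to the first n columns (\<open>w q 1\<close>
  below); they are unitriangular because of the convention c_0 = 1. Multiplying by a block puts
  running sums into the lower rows. Eliminating these sums leaves the relation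
  \<open>w m (Suc j) = d m j * w m j - w (Suc m) j\<close> with
  \<open>d m j = c m (j - 1) / c m j\<close>, and this is why the expansions are path sums. For k =
  n the row in question lies in the upper half of Theta, and the factor \<open>Q k\<close> arises
  twice for different reasons: an alternating identity rewrites the row of v_n through later partial
  products, and each of these, viewed as a fictitious lower row n+1, is then expanded in the basis.
  The Weyl group is given as maps on weights, with elements chosen by \<open>THE\<close>,
  \<open>SOME\<close> and \<open>LEAST\<close>. Replacing words by permutations of the 2n basis
  positions makes lengths, the longest element and the lifts accessible.\<close>

definition sigma :: "nat \<Rightarrow> nat \<Rightarrow> nat \<Rightarrow> nat" where
  "sigma n i a =
     (if a = i - 1 then i else if a = i then i - 1
      else if a = 2 * n - i - 1 then 2 * n - i else if a = 2 * n - i then 2 * n - i - 1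
      else a)"

definition opp :: "nat \<Rightarrow> nat \<Rightarrow> nat" where
  "opp n a = (if a < 2 * n then 2 * n - 1 - a else a)"

definition word_perm :: "nat \<Rightarrow> nat list \<Rightarrow> nat \<Rightarrow> nat" where
  "word_perm n is = foldr (\<lambda>i p. sigma n i \<circ> p) is id"

lemma word_perm_Nil [simp]: "word_perm n [] = id"
  and word_perm_Cons [simp]: "word_perm n (i # is) = sigma n i \<circ> word_perm n is"
  by (simp_all add: word_perm_def)

lemma word_perm_append: "word_perm n (is @ js) = word_perm n is \<circ> word_perm n js"
  by (induction "is") (simp_all add: comp_assoc)

lemma weyl_word_Nil [simp]: "weyl_word n [] = id"
  and weyl_word_Cons [simp]: "weyl_word n (i # is) = simple_refl n i \<circ> weyl_word n is"
  by (simp_all add: weyl_word_def)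

lemma weyl_word_append: "weyl_word n (is @ js) = weyl_word n is \<circ> weyl_word n js"
  by (induction "is") (simp_all add: comp_assoc)

text \<open>\<open>sigma\<close> permutes basis positions as s_i does: it swaps i-1, i and the
  mirrored pair 2n-i-1, 2n-i, which is the same pair for i = n. The substitution i = j+1, n = j+k+1
  removes truncated subtraction, so that case distinctions become linear arithmetic.\<close>

lemma sigma_Suc:
  "sigma (Suc (j + k)) (Suc j) a =
    (if a = j then j + 1 else if a = j + 1 then j else if a = j + 2 * k then j + 2 * k + 1
     else if a = j + 2 * k + 1 then j + 2 * k else a)"
  by (simp add: sigma_def)

lemma rank_cases:
  assumes "i \<in> {1..n}"
  obtains j k where "i = Suc j" "n = Suc (j + k)"
  using assms by (metis Suc_le_D add_Suc atLeastAtMost_iff le_iff_add One_nat_def)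

lemma sigma_involution: "i \<in> {1..n} \<Longrightarrow> sigma n i (sigma n i a) = a"
  by (erule rank_cases) (simp add: sigma_Suc)

lemma sigma_less_iff: "i \<in> {1..n} \<Longrightarrow> sigma n i a < 2 * n \<longleftrightarrow> a < 2 * n"
  by (erule rank_cases) (simp add: sigma_Suc)

lemma sigma_opp:
  assumes "i \<in> {1..n}"
  shows "sigma n i (opp n a) = opp n (sigma n i a)"
proof -
  obtain j k where jk: "i = Suc j" "n = Suc (j + k)" using assms by (rule rank_cases)
  consider "a = j" | "a = j + 1" | "a = j + 2 * k" | "a = j + 2 * k + 1"
    | "a \<notin> {j, j + 1, j + 2 * k, j + 2 * k + 1}" by blast
  then have "sigma (Suc (j + k)) (Suc j) (opp (Suc (j + k)) a) =
    opp (Suc (j + k)) (sigma (Suc (j + k)) (Suc j) a)"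
  proof cases
    case 5
    then have "opp (Suc (j + k)) a \<notin> {j, j + 1, j + 2 * k, j + 2 * k + 1}"
      unfolding opp_def by (cases "a < 2 * Suc (j + k)") auto
    then show ?thesis using 5 unfolding sigma_Suc by simp
  qed (simp_all add: sigma_Suc opp_def)
  then show ?thesis unfolding jk .
qed

lemma sigma_up:
  assumes "i \<in> {1..n}" "Suc a = i \<or> Suc a = 2 * n - i"
  shows "sigma n i a = Suc a"
proof -
  obtain j k where jk: "i = Suc j" "n = Suc (j + k)" using assms(1) by (rule rank_cases)
  have "2 * Suc (j + k) - Suc j = Suc (j + 2 * k)" by simp
  then show ?thesis using assms(2) unfolding jk sigma_Suc by auto
qed

lemma sigma_down:
  assumes "i \<in> {1..n}" "a = i \<or> a = 2 * n - i"
  shows "sigma n i a = a - 1"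
proof -
  obtain j k where jk: "i = Suc j" "n = Suc (j + k)" using assms(1) by (rule rank_cases)
  have "2 * Suc (j + k) - Suc j = Suc (j + 2 * k)" by simp
  then show ?thesis using assms(2) unfolding jk sigma_Suc by auto
qed

lemma opp_opp [simp]: "opp n (opp n a) = a"
  by (auto simp: opp_def)

lemma bij_sigma: "i \<in> {1..n} \<Longrightarrow> bij (sigma n i)"
  by (rule o_bij[where g = "sigma n i"]) (auto simp: sigma_involution)

lemma bij_word_perm: "is \<in> lists {1..n} \<Longrightarrow> bij (word_perm n is)"
  by (induction "is") (auto intro!: bij_comp bij_sigma)

lemma word_perm_less_iff: "is \<in> lists {1..n} \<Longrightarrow> word_perm n is a < 2 * n \<longleftrightarrow> a < 2 * n"
  by (induction "is") (auto simp: sigma_less_iff)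

lemma word_perm_opp: "is \<in> lists {1..n} \<Longrightarrow> word_perm n is (opp n a) = opp n (word_perm n is a)"
  by (induction "is") (auto simp: sigma_opp)

lemma word_perm_outside: "is \<in> lists {1..n} \<Longrightarrow> a \<ge> 2 * n \<Longrightarrow> word_perm n is a = a"
  by (induction "is") (auto simp: sigma_def)

text \<open>The weight in the coordinates \<open>\<epsilon>\<^sub>1, \<dots>, \<epsilon>\<^sub>n, -\<epsilon>\<^sub>n, \<dots>, -\<epsilon>\<^sub>1\<close>.\<close>

definition eps_coord :: "nat \<Rightarrow> (nat \<Rightarrow> int) \<Rightarrow> nat \<Rightarrow> int" where
  "eps_coord n wt a = (if a < n then \<Sum>j\<in>{a<..n}. wt j else - (\<Sum>j\<in>{2 * n - 1 - a<..n}. wt j))"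

text \<open>The right-hand side lists the coordinates of the simple root: it is eps_i - eps_(i+1)
  for i < n and 2 eps_n for the long root, with coordinate a+1 stored at position a.\<close>

lemma sum_cartan:
  assumes "i \<in> {1..n}" "a \<le> n"
  shows "(\<Sum>j\<in>{a<..n}. cartan n j i) =
    (if a + 1 = i then (if i = n then 2 else 1) else if a = i \<and> i < n then - 1 else 0)"
  using assms(2)
proof (induction rule: inc_induct)
  case base
  show ?case using assms(1) by auto
next
  case (step a)
  have "{a<..n} = insert (Suc a) {Suc a<..n}" using step by auto
  then have "(\<Sum>j\<in>{a<..n}. cartan n j i) = cartan n (Suc a) i + (\<Sum>j\<in>{Suc a<..n}. cartan n j i)"
    by simp
  then show ?case unfolding step.IH using step assms(1) by (auto simp: cartan_def)
qed

lemma sum_simple_refl: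
  assumes "i \<in> {1..n}" "a \<le> n"
  shows "(\<Sum>j\<in>{a<..n}. simple_refl n i wt j) = (\<Sum>j\<in>{a<..n}. wt j) -
    wt i * (if a + 1 = i then (if i = n then 2 else 1) else if a = i \<and> i < n then - 1 else 0)"
proof -
  have "(\<Sum>j\<in>{a<..n}. simple_refl n i wt j) = (\<Sum>j\<in>{a<..n}. wt j - wt i * cartan n j i)"
    by (rule sum.cong) (auto simp: simple_refl_def)
  then show ?thesis using sum_cartan[OF assms]
    by (simp add: sum_subtractf sum_distrib_left[symmetric])
qed

lemma sum_greaterThanAtMost_Suc:
  "a < n \<Longrightarrow> (\<Sum>j\<in>{a<..n}. (wt :: nat \<Rightarrow> int) j) = wt (Suc a) + (\<Sum>j\<in>{Suc a<..n}. wt j)"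
proof -
  assume "a < n"
  then have "{a<..n} = insert (Suc a) {Suc a<..n}" by auto
  then show ?thesis by simp
qed

lemma eps_coord_simple_refl_low:
  assumes i: "i \<in> {1..n}" and a: "a < n"
  shows "eps_coord n (simple_refl n i wt) a = eps_coord n wt (sigma n i a)"
proof -
  consider "a + 1 = i" "i < n" | "a + 1 = i" "i = n" | "a = i" | "a + 1 \<noteq> i" "a \<noteq> i"
    using i by (cases "i < n"; cases "a = i"; cases "a + 1 = i") auto
  then show ?thesis
  proof cases
    case 1
    then show ?thesis
      using a sum_simple_refl[OF i, of a wt] sum_greaterThanAtMost_Suc[of a n wt]
      by (auto simp: eps_coord_def sigma_def)
  next
    case 2
    have "2 * n - Suc n = n - 1" by simp
    then show ?thesis
      using 2 a sum_simple_refl[OF i, of a wt] sum_greaterThanAtMost_Suc[of a n wt]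
      by (auto simp: eps_coord_def sigma_def)
  next
    case 3
    then show ?thesis
      using i a sum_simple_refl[OF i, of a wt] sum_greaterThanAtMost_Suc[of "a - 1" n wt]
      by (auto simp: eps_coord_def sigma_def)
  next
    case 4
    then have "sigma n i a = a" using a i by (auto simp: sigma_def)
    then show ?thesis using 4 a sum_simple_refl[OF i, of a wt] by (simp add: eps_coord_def)
  qed
qed

lemma eps_coord_opp: "a < 2 * n \<Longrightarrow> eps_coord n wt (opp n a) = - eps_coord n wt a"
proof -
  assume a: "a < 2 * n"
  have "a < n \<Longrightarrow> 2 * n - Suc (2 * n - Suc a) = a" by simp
  with a show ?thesis by (auto simp: eps_coord_def opp_def)
qed

lemma eps_coord_simple_refl:
  assumes i: "i \<in> {1..n}" and a: "a < 2 * n"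
  shows "eps_coord n (simple_refl n i wt) a = eps_coord n wt (sigma n i a)"
proof (cases "a < n")
  case True
  then show ?thesis using i by (simp add: eps_coord_simple_refl_low)
next
  case False
  then have b: "opp n a < n" using a by (auto simp: opp_def)
  have "eps_coord n (simple_refl n i wt) a = - eps_coord n (simple_refl n i wt) (opp n a)"
    using eps_coord_opp[OF a] by simp
  also have "\<dots> = - eps_coord n wt (opp n (sigma n i a))"
    using eps_coord_simple_refl_low[OF i b] i by (simp add: sigma_opp)
  also have "\<dots> = eps_coord n wt (sigma n i a)"
    using eps_coord_opp[of "sigma n i a" n wt] a i by (simp add: sigma_less_iff)
  finally show ?thesis .
qed

text \<open>The direction matters: the coordinate at a moves to \<open>word_perm n is a\<close>. As
  \<open>sigma\<close> is an involution, each reflection can be read as moving values, and both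
  sides compose in the same order.\<close>

lemma eps_coord_weyl_word:
  assumes "is \<in> lists {1..n}" "a < 2 * n"
  shows "eps_coord n (weyl_word n is wt) (word_perm n is a) = eps_coord n wt a"
  using assms
proof (induction "is")
  case (Cons i "is")
  then show ?case
    by (simp add: eps_coord_simple_refl sigma_less_iff word_perm_less_iff sigma_involution)
qed simp

lemma weyl_word_outside: "is \<in> lists {1..n} \<Longrightarrow> j \<notin> {1..n} \<Longrightarrow> weyl_word n is wt j = wt j"
  by (induction "is") (auto simp: simple_refl_def)

lemma weight_eq_if_eps_coord_eq:
  assumes "\<And>a. a < 2 * n \<Longrightarrow> eps_coord n wt a = eps_coord n wt' a" "j \<in> {1..n}"
  shows "wt j = wt' j"
proof -
  have *: "v j = eps_coord n v (j - 1) - (if j < n then eps_coord n v j else 0)" for v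
    using assms(2) sum_greaterThanAtMost_Suc[of "j - 1" n v] by (auto simp: eps_coord_def)
  show ?thesis using *[of wt] *[of wt'] assms by auto
qed

text \<open>The weight with all values 1 is the sum of the fundamental weights. Its coordinates n,
  ..., 1, -1, ..., -n are distinct, so it separates permutations.\<close>

lemma inj_on_eps_coord_rho: "inj_on (eps_coord n (\<lambda>_. 1)) {..<2 * n}"
  by (auto simp: inj_on_def eps_coord_def of_nat_diff split: if_splits)

text \<open>This moves all questions about lengths and reduced words to permutations. From weights
  to permutations, testing on the regular weight with all values 1 suffices; conversely, coordinates
  determine a weight at the indices 1..n, and words change nothing elsewhere.\<close>

lemma weyl_word_eq_iff:
  assumes "is \<in> lists {1..n}" "js \<in> lists {1..n}"
  shows "weyl_word n is = weyl_word n js \<longleftrightarrow> word_perm n is = word_perm n js"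
proof
  assume eq: "weyl_word n is = weyl_word n js"
  let ?r = "\<lambda>_. 1 :: int"
  let ?p = "word_perm n is" and ?q = "word_perm n js"
  show "?p = ?q"
  proof
    fix a
    show "?p a = ?q a"
    proof (cases "a < 2 * n")
      case True
      obtain b where b: "?q a = ?p b"
        using bij_word_perm[OF assms(1)] by (metis bij_pointE)
      have b2: "b < 2 * n" using True b assms by (metis word_perm_less_iff)
      have "eps_coord n ?r a = eps_coord n (weyl_word n js ?r) (?q a)"
        using assms True by (simp add: eps_coord_weyl_word)
      also have "\<dots> = eps_coord n ?r b"
        unfolding b eq[symmetric] using assms b2 by (simp add: eps_coord_weyl_word)
      finally have "a = b" using inj_on_eps_coord_rho[of n] True b2 by (auto dest: inj_onD)
      then show ?thesis using b by simp
    qed (use word_perm_outside[OF assms(1)] word_perm_outside[OF assms(2)] in simp)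
  qed
next
  assume eq: "word_perm n is = word_perm n js"
  show "weyl_word n is = weyl_word n js"
  proof (intro ext)
    fix wt j
    show "weyl_word n is wt j = weyl_word n js wt j"
    proof (cases "j \<in> {1..n}")
      case True
      show ?thesis
      proof (rule weight_eq_if_eps_coord_eq[OF _ True])
        fix a assume a: "a < 2 * n"
        obtain b where b: "a = word_perm n is b"
          using bij_word_perm[OF assms(1)] by (metis bij_pointE)
        have "b < 2 * n" using a b assms by (metis word_perm_less_iff)
        then show "eps_coord n (weyl_word n is wt) a = eps_coord n (weyl_word n js wt) a"
          using eps_coord_weyl_word[of "is" n b wt] eps_coord_weyl_word[of js n b wt] assms eq b by simp
      qed
    qed (use weyl_word_outside[OF assms(1)] weyl_word_outside[OF assms(2)] in simp)
  qed
qed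

section \<open>Reflections, the exchange property and reduced words\<close>

definition refl_perm :: "nat \<Rightarrow> nat \<Rightarrow> nat \<Rightarrow> nat \<Rightarrow> nat" where
  "refl_perm n u v a =
     (if a = u then v else if a = v then u
      else if a = opp n u then opp n v else if a = opp n v then opp n u else a)"

lemma refl_perm_conj:
  assumes "i \<in> {1..n}"
  shows "sigma n i \<circ> refl_perm n (sigma n i u) (sigma n i v) = refl_perm n u v \<circ> sigma n i"
proof
  fix a
  have s: "sigma n i x = y \<longleftrightarrow> x = sigma n i y" for x y
    using sigma_involution[OF assms] by metis
  show "(sigma n i \<circ> refl_perm n (sigma n i u) (sigma n i v)) a = (refl_perm n u v \<circ> sigma n i) a"
    by (simp add: refl_perm_def sigma_opp[OF assms, symmetric] s sigma_involution[OF assms])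
qed

text \<open>\<open>sigma\<close> inverts only the adjacent pairs that it swaps, and these are mirror
  images of each other, so either of them gives the same reflection.\<close>

lemma sigma_eq_refl_perm:
  assumes "i \<in> {1..n}" "u < v" "v < 2 * n" "sigma n i v < sigma n i u"
  shows "sigma n i = refl_perm n u v"
proof -
  obtain j k where jk: "i = Suc j" "n = Suc (j + k)" using assms(1) by (rule rank_cases)
  have "(u = j \<and> v = Suc j) \<or> (u = j + 2 * k \<and> v = Suc (j + 2 * k))"
    using assms(2-) unfolding jk by (simp add: sigma_Suc split: if_splits)
  then show ?thesis
    unfolding jk by (elim disjE conjE) (simp_all add: fun_eq_iff sigma_Suc refl_perm_def opp_def)
qed

text \<open>Strong exchange property; \<open>refl_perm n u v\<close> is the reflection swapping u
  with v and their mirror images. If the first letter keeps the order of u and v, the reflection is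
  conjugated past it and a letter is deleted in the tail; if not, the reflection is that letter
  itself, which is dropped.\<close>

lemma exchange:
  assumes "is \<in> lists {1..n}" "u < v" "v < 2 * n"
    and "inv_into UNIV (word_perm n is) v < inv_into UNIV (word_perm n is) u"
  shows "\<exists>js \<in> lists {1..n}. length js + 1 = length is \<and>
           word_perm n js = refl_perm n u v \<circ> word_perm n is"
  using assms
proof (induction "is" arbitrary: u v)
  case (Cons i "is")
  let ?s = "sigma n i"
  have i: "i \<in> {1..n}" and is': "is \<in> lists {1..n}" using Cons.hyps by auto
  have inv: "inv_into UNIV (word_perm n (i # is)) x = inv_into UNIV (word_perm n is) (?s x)" for x
    using bij_word_perm[OF is'] bij_sigma[OF i]
    by (simp add: o_inv_distrib inv_unique_comp[of ?s ?s] sigma_involution[OF i] fun_eq_iff)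
  have ne: "?s u \<noteq> ?s v" using Cons.prems sigma_involution[OF i] by (metis less_irrefl)
  show ?case
  proof (cases "?s u < ?s v")
    case True
    have "?s v < 2 * n" using Cons.prems i by (simp add: sigma_less_iff)
    with Cons.IH[OF True] Cons.prems obtain js where
      js: "js \<in> lists {1..n}" "length js + 1 = length is"
        "word_perm n js = refl_perm n (?s u) (?s v) \<circ> word_perm n is"
      unfolding inv by blast
    then have "word_perm n (i # js) = refl_perm n u v \<circ> word_perm n (i # is)"
      using refl_perm_conj[OF i, of u v] by (simp add: comp_assoc[symmetric])
    then show ?thesis using js i by (intro bexI[of _ "i # js"]) auto
  next
    case False
    then have "?s = refl_perm n u v" using ne Cons.prems i by (intro sigma_eq_refl_perm) auto
    moreover have "?s \<circ> (?s \<circ> word_perm n is) = word_perm n is"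
      using sigma_involution[OF i] by (auto simp: fun_eq_iff)
    ultimately show ?thesis using is' by (intro bexI[of _ "is"]) (auto simp: fun_eq_iff)
  qed
qed simp

lemma reduced_word_exists:
  assumes "js \<in> lists {1..n}"
  shows "\<exists>is. reduced_word n (weyl_word n js) is"
proof -
  let ?P = "\<lambda>l. \<exists>is\<in>lists {1..n}. weyl_word n is = weyl_word n js \<and> length is = l"
  have "?P (length js)" using assms by blast
  from LeastI[of ?P, OF this] show ?thesis unfolding reduced_word_def weyl_length_def by blast
qed

lemma weyl_length_le:
  "js \<in> lists {1..n} \<Longrightarrow> weyl_length n (weyl_word n js) \<le> length js"
  unfolding weyl_length_def by (rule Least_le) blast

text \<open>The first letter must create an inversion: otherwise exchange, applied to the tail and
  the reflection s_i, writes the whole element with fewer letters. This ascent later fixes the signs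
  of the lift.\<close>

lemma reduced_word_Cons:
  assumes "reduced_word n w (i # is)"
  shows "i \<in> {1..n}" "reduced_word n (weyl_word n is) is"
    "inv_into UNIV (word_perm n is) (i - 1) < inv_into UNIV (word_perm n is) i"
proof -
  show i: "i \<in> {1..n}" using assms by (auto simp: reduced_word_def)
  have is': "is \<in> lists {1..n}" using assms by (auto simp: reduced_word_def)
  have w: "w = weyl_word n (i # is)" "weyl_length n w = Suc (length is)"
    using assms by (auto simp: reduced_word_def)
  obtain js where js: "js \<in> lists {1..n}" "weyl_word n js = weyl_word n is"
    "length js = weyl_length n (weyl_word n is)"
    using reduced_word_exists[OF is'] unfolding reduced_word_def by blast
  have "w = weyl_word n (i # js)" using w js by simp
  then have "Suc (length is) \<le> Suc (length js)"
    using weyl_length_le[of "i # js" n] w js i by auto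
  then show "reduced_word n (weyl_word n is) is"
    using js is' weyl_length_le[OF is'] by (auto simp: reduced_word_def)
  show "inv_into UNIV (word_perm n is) (i - 1) < inv_into UNIV (word_perm n is) i"
  proof (rule ccontr)
    assume *: "\<not> ?thesis"
    have "inv_into UNIV (word_perm n is) (i - 1) \<noteq> inv_into UNIV (word_perm n is) i"
      using bij_word_perm[OF is'] i by (metis Suc_n_not_n Suc_pred' atLeastAtMost_iff bij_inv_eq_iff
        less_eq_Suc_le One_nat_def)
    with * obtain ks where ks: "ks \<in> lists {1..n}" "length ks + 1 = length is"
       "word_perm n ks = refl_perm n (i - 1) i \<circ> word_perm n is"
      using exchange[OF is', of "i - 1" i] i by auto
    have "sigma n i = refl_perm n (i - 1) i"
      by (rule sigma_eq_refl_perm) (use i in \<open>auto simp: sigma_def\<close>)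
    then have "word_perm n ks = word_perm n (i # is)" using ks by simp
    then have "weyl_word n ks = w"
      unfolding w using ks i is' by (subst weyl_word_eq_iff) auto
    then show False using weyl_length_le[OF ks(1)] w ks by simp
  qed
qed

section \<open>The longest element\<close>

lemma not_longest_if_ascent:
  assumes "is \<in> lists {1..n}" "i \<in> {1..n}" "inv_into UNIV (word_perm n is) (i - 1) < inv_into UNIV (word_perm n is) i"
  shows "weyl_length n (weyl_word n is) < weyl_length n (weyl_word n (i # is))"
proof -
  have "i # is \<in> lists {1..n}" using assms by simp
  from reduced_word_exists[OF this] obtain js where
    js: "js \<in> lists {1..n}" "weyl_word n js = weyl_word n (i # is)"
      "length js = weyl_length n (weyl_word n (i # is))"
    unfolding reduced_word_def by blast
  have pjs: "word_perm n js = word_perm n (i # is)"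
    using js assms by (subst weyl_word_eq_iff[symmetric]) auto
  have s: "sigma n i = refl_perm n (i - 1) i"
    by (rule sigma_eq_refl_perm) (use assms in \<open>auto simp: sigma_def\<close>)
  have inv: "inv_into UNIV (word_perm n js) x = inv_into UNIV (word_perm n is) (sigma n i x)" for x
    unfolding pjs using bij_word_perm[OF assms(1)] bij_sigma[OF assms(2)]
    by (simp add: o_inv_distrib inv_unique_comp[of "sigma n i" "sigma n i"] sigma_involution[OF assms(2)] fun_eq_iff)
  \<comment> \<open>A reduced word of s_i w inverts i-1 and i, so exchange deletes one of its
    letters and leaves a word for w.\<close>
  have "sigma n i (i - 1) = i" "sigma n i i = i - 1" using assms(2) by (auto simp: sigma_def)
  then obtain ks where ks: "ks \<in> lists {1..n}" "length ks + 1 = length js"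
      "word_perm n ks = refl_perm n (i - 1) i \<circ> word_perm n js"
    using exchange[OF js(1), of "i - 1" i] assms unfolding inv by auto
  have "word_perm n ks = word_perm n is"
    unfolding ks(3) pjs s[symmetric] using sigma_involution[OF assms(2)] by (auto simp: fun_eq_iff)
  then have "weyl_word n ks = weyl_word n is" using ks assms by (subst weyl_word_eq_iff) auto
  then show ?thesis using weyl_length_le[OF ks(1)] ks js by simp
qed

text \<open>By the symmetry \<open>opp\<close>, descents at i = 1..n become descents at all adjacent
  positions; a strictly decreasing self-map of {0..2n-1} is the order reversal.\<close>

lemma word_perm_eq_opp_if_no_ascent:
  assumes is': "is \<in> lists {1..n}"
    and desc: "\<And>i. i \<in> {1..n} \<Longrightarrow> inv_into UNIV (word_perm n is) i < inv_into UNIV (word_perm n is) (i - 1)"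
  shows "word_perm n is = opp n"
proof -
  let ?q = "inv_into UNIV (word_perm n is)"
  note bij = bij_word_perm[OF is']
  have q_less: "?q a < 2 * n \<longleftrightarrow> a < 2 * n" for a
    using word_perm_less_iff[OF is', of "?q a"] bij by (simp add: bij_is_surj surj_f_inv_f)
  have q_opp: "?q (opp n a) = opp n (?q a)" for a
    using word_perm_opp[OF is', of "?q a"] bij by (metis bij_inv_eq_iff)
  have step: "?q (Suc a) < ?q a" if "Suc a < 2 * n" for a
  proof (cases "Suc a \<le> n")
    case True
    then show ?thesis using desc[of "Suc a"] by simp
  next
    case False
    then have "?q (Suc (opp n (Suc a))) < ?q (opp n (Suc a))"
      using that desc[of "Suc (opp n (Suc a))"] by (auto simp: opp_def)
    moreover have "Suc (opp n (Suc a)) = opp n a" using that by (auto simp: opp_def)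
    ultimately have "opp n (?q a) < opp n (?q (Suc a))" by (simp add: q_opp)
    then show ?thesis using q_less[of a] q_less[of "Suc a"] that by (auto simp: opp_def)
  qed
  have upper: "?q a \<le> 2 * n - 1 - a" if "a < 2 * n" for a
    using that
  proof (induction a)
    case 0
    then show ?case using q_less[of 0] by auto
  next
    case (Suc a)
    then show ?case using step[of a] by auto
  qed
  have "?q a = opp n a" for a
  proof (cases "a < 2 * n")
    case True
    have "2 * n - 1 - ?q a \<le> a"
      using upper[of "opp n a"] True q_less[of a] unfolding q_opp by (auto simp: opp_def)
    then show ?thesis using upper[OF True] True by (auto simp: opp_def)
  next
    case False
    then show ?thesis
      using word_perm_outside[OF is', of a] bij by (simp add: opp_def) (metis bij_inv_eq_iff)
  qed
  then show ?thesis using bij by (metis bij_inv_eq_iff ext opp_opp)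
qed

text \<open>Weyl group elements are functions on an infinite type, but each is recovered from its
  permutation restricted to the 2n positions. Finiteness provides an element of maximal
  length.\<close>

lemma finite_weyl_group: "finite (weyl_group n)"
proof -
  let ?R = "\<lambda>p. restrict p {..<2 * n}"
  have "finite ({..<2 * n} \<rightarrow>\<^sub>E {..<2 * n})" by (intro finite_PiE) auto
  moreover have "(\<lambda>is. ?R (word_perm n is)) ` lists {1..n} \<subseteq> {..<2 * n} \<rightarrow>\<^sub>E {..<2 * n}"
  proof (rule image_subsetI)
    fix "is" assume "is \<in> lists {1..n}"
    then show "?R (word_perm n is) \<in> {..<2 * n} \<rightarrow>\<^sub>E {..<2 * n}"
      using word_perm_less_iff[of "is" n] by (simp add: PiE_iff)
  qed
  ultimately have fin: "finite ((\<lambda>is. ?R (word_perm n is)) ` lists {1..n})"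
    by (rule finite_subset[rotated])
  define F where "F r = weyl_word n (SOME is. is \<in> lists {1..n} \<and> ?R (word_perm n is) = r)" for r
  have "weyl_word n is = F (?R (word_perm n is))" if "is \<in> lists {1..n}" for "is"
  proof -
    let ?P = "\<lambda>js. js \<in> lists {1..n} \<and> ?R (word_perm n js) = ?R (word_perm n is)"
    define js where "js = Eps ?P"
    have "?P js" unfolding js_def by (rule someI[of ?P "is"]) (use that in simp)
    then have js: "js \<in> lists {1..n}" and eq: "?R (word_perm n js) = ?R (word_perm n is)" by blast+
    have "word_perm n js a = word_perm n is a" for a
    proof (cases "a < 2 * n")
      case True
      then show ?thesis using fun_cong[OF eq, of a] by simp
    next
      case False
      then show ?thesis
        using word_perm_outside[OF js] word_perm_outside[OF that] by simp
    qed
    then have "weyl_word n js = weyl_word n is"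
      using weyl_word_eq_iff[OF js that] by blast
    then show ?thesis unfolding F_def js_def by simp
  qed
  then have "weyl_group n \<subseteq> F ` (\<lambda>is. ?R (word_perm n is)) ` lists {1..n}"
    unfolding weyl_group_def by blast
  then show ?thesis using fin finite_subset by blast
qed

text \<open>An element of maximal length has no ascent and therefore has the permutation
  \<open>opp n\<close>. This yields both the uniqueness required by \<open>THE\<close> and the
  value.\<close>

lemma longest_elt_word:
  "\<exists>is \<in> lists {1..n}. longest_elt n = weyl_word n is \<and> word_perm n is = opp n"
proof -
  let ?L = "weyl_length n"
  let ?max = "\<lambda>w. w \<in> weyl_group n \<and> (\<forall>v \<in> weyl_group n. ?L v \<le> ?L w)"
  have max: "\<exists>is \<in> lists {1..n}. w = weyl_word n is \<and> word_perm n is = opp n" if w: "?max w" for w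
  proof -
    obtain "is" where is': "is \<in> lists {1..n}" "w = weyl_word n is"
      using w by (auto simp: weyl_group_def)
    have "word_perm n is = opp n"
    proof (rule word_perm_eq_opp_if_no_ascent[OF is'(1)])
      fix i assume i: "i \<in> {1..n}"
      have "weyl_word n (i # is) \<in> weyl_group n"
        unfolding weyl_group_def by (rule imageI) (use i is' in auto)
      then have "\<not> inv_into UNIV (word_perm n is) (i - 1) < inv_into UNIV (word_perm n is) i"
        using not_longest_if_ascent[OF is'(1) i] w is' by (metis not_le)
      moreover have "inv_into UNIV (word_perm n is) (i - 1) \<noteq> inv_into UNIV (word_perm n is) i"
        using bij_word_perm[OF is'(1)] i by (metis Suc_n_not_n Suc_pred' atLeastAtMost_iff
          bij_inv_eq_iff less_eq_Suc_le One_nat_def)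
      ultimately show "inv_into UNIV (word_perm n is) i < inv_into UNIV (word_perm n is) (i - 1)" by simp
    qed
    then show ?thesis using is' by blast
  qed
  have "id \<in> weyl_group n" by (auto simp: weyl_group_def intro!: image_eqI[of _ _ "[]"])
  then obtain w where w: "?max w"
    using finite_weyl_group[of n] Max_in[of "?L ` weyl_group n"] Max_ge[of "?L ` weyl_group n"]
    by (smt (verit, del_insts) empty_iff finite_imageI imageE imageI image_is_empty)
  have "longest_elt n = w"
    unfolding longest_elt_def
  proof (rule the_equality, rule w)
    fix v assume "?max v"
    then show "v = w" using max[of v] max[OF w] by (metis weyl_word_eq_iff)
  qed
  then show ?thesis using max[OF w] by simp
qed

text \<open>The second claim covers every reduced word, in particular the one that
  \<open>SOME\<close> picks in the lift.\<close>

lemma longest_simple_refl_word: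
  assumes "k \<in> {1..n}"
  shows "\<exists>is. reduced_word n (longest_elt n \<circ> simple_refl n k) is"
    and "reduced_word n (longest_elt n \<circ> simple_refl n k) is \<Longrightarrow> word_perm n is = opp n \<circ> sigma n k"
proof -
  obtain js where js: "js \<in> lists {1..n}" "longest_elt n = weyl_word n js" "word_perm n js = opp n"
    using longest_elt_word by blast
  let ?w = "js @ [k]"
  have w: "?w \<in> lists {1..n}" "longest_elt n \<circ> simple_refl n k = weyl_word n ?w"
    "word_perm n ?w = opp n \<circ> sigma n k"
    using js assms by (auto simp: weyl_word_append word_perm_append)
  show "\<exists>is. reduced_word n (longest_elt n \<circ> simple_refl n k) is"
    unfolding w(2) by (rule reduced_word_exists[OF w(1)])
  assume "reduced_word n (longest_elt n \<circ> simple_refl n k) is"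
  then have "weyl_word n is = weyl_word n ?w" "is \<in> lists {1..n}"
    using w by (auto simp: reduced_word_def)
  then show "word_perm n is = opp n \<circ> sigma n k"
    using w by (metis weyl_word_eq_iff)
qed

section \<open>Leading minors and lattice path sums\<close>

definition lminor :: "nat \<Rightarrow> complex mat \<Rightarrow> complex" where
  "lminor k g = det (mat k k (\<lambda>ij. g $$ ij))"

text \<open>If every product through an index l \<ge> k vanishes, leading k-blocks multiply like the
  matrices themselves. This unites the two block triangular cases below.\<close>

lemma lminor_mult_aux:
  assumes "u \<in> carrier_mat N N" "g \<in> carrier_mat N N" "k \<le> N"
    and zero: "\<And>a b l. a < k \<Longrightarrow> b < k \<Longrightarrow> k \<le> l \<Longrightarrow> l < N \<Longrightarrow> u $$ (a, l) * g $$ (l, b) = 0"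
  shows "lminor k (u * g) = lminor k u * lminor k g"
proof -
  let ?r = "\<lambda>g :: complex mat. mat k k (\<lambda>ij. g $$ ij)"
  have "?r (u * g) = ?r u * ?r g"
  proof (rule eq_matI)
    fix a b assume ab: "a < dim_row (?r u * ?r g)" "b < dim_col (?r u * ?r g)"
    have "?r (u * g) $$ (a, b) = (\<Sum>l\<in>{0..<N}. u $$ (a, l) * g $$ (l, b))"
      using ab assms by (simp add: scalar_prod_def)
    also have "\<dots> = (\<Sum>l\<in>{0..<k}. u $$ (a, l) * g $$ (l, b))"
      by (rule sum.mono_neutral_right) (use assms ab in auto)
    finally show "?r (u * g) $$ (a, b) = (?r u * ?r g) $$ (a, b)"
      using ab by (simp add: scalar_prod_def)
  qed auto
  then show ?thesis unfolding lminor_def by (simp add: det_mult[of _ k])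
qed

lemma lminor_mult_left:
  assumes "u \<in> carrier_mat N N" "g \<in> carrier_mat N N" "k \<le> N"
    and "\<And>a b. a < k \<Longrightarrow> k \<le> b \<Longrightarrow> b < N \<Longrightarrow> u $$ (a, b) = 0"
  shows "lminor k (u * g) = lminor k u * lminor k g"
  by (rule lminor_mult_aux) (use assms in auto)

lemma lminor_mult_right:
  assumes "g \<in> carrier_mat N N" "v \<in> carrier_mat N N" "k \<le> N"
    and "\<And>a b. k \<le> a \<Longrightarrow> a < N \<Longrightarrow> b < k \<Longrightarrow> v $$ (a, b) = 0"
  shows "lminor k (g * v) = lminor k g * lminor k v"
  by (rule lminor_mult_aux) (use assms in auto)

lemma lminor_transpose:
  "g \<in> carrier_mat N N \<Longrightarrow> k \<le> N \<Longrightarrow> lminor k (transpose_mat g) = lminor k g"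
proof -
  assume "g \<in> carrier_mat N N" "k \<le> N"
  then have "mat k k (\<lambda>ij. transpose_mat g $$ ij) = transpose_mat (mat k k (\<lambda>ij. g $$ ij))"
    by (intro eq_matI) auto
  then show ?thesis unfolding lminor_def using det_transpose[of "mat k k (\<lambda>ij. g $$ ij)" k] by simp
qed

lemma lminor_lower_triangular:
  assumes "\<And>a b. a < b \<Longrightarrow> b < k \<Longrightarrow> g $$ (a, b) = 0"
  shows "lminor k g = (\<Prod>a<k. g $$ (a, a))"
proof -
  have "lminor k g = prod_list (diag_mat (mat k k (\<lambda>ij. g $$ ij)))"
    unfolding lminor_def by (rule det_lower_triangular[of k]) (use assms in auto)
  also have "\<dots> = (\<Prod>a<k. g $$ (a, a))"
    by (auto simp: diag_mat_def atLeast0LessThan interv_sum_list_conv_sum_set_nat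
        prod.list_conv_set_nth intro!: prod.cong)
  finally show ?thesis .
qed

text \<open>The leading rows factor into a lower triangular coefficient matrix and an upper
  unitriangular matrix, so only the diagonal coefficients survive.\<close>

lemma lminor_eq_prod_coeffs:
  assumes g: "\<And>a b. a < k \<Longrightarrow> b < k \<Longrightarrow> g $$ (a, b) = (\<Sum>p<n. t a p * B p b)" and "k \<le> n"
    and t: "\<And>a p. a < k \<Longrightarrow> a < p \<Longrightarrow> p < n \<Longrightarrow> t a p = 0"
    and B: "\<And>p b. p < n \<Longrightarrow> b < p \<Longrightarrow> B p b = 0" "\<And>p. p < n \<Longrightarrow> B p p = 1"
  shows "lminor k g = (\<Prod>a<k. t a a)"
proof -
  let ?T = "mat n n (\<lambda>(a, p). t a p)" and ?B = "mat n n (\<lambda>(p, b). B p b)"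
  have "mat k k (\<lambda>ij. g $$ ij) = mat k k (\<lambda>ij. (?T * ?B) $$ ij)"
    using g \<open>k \<le> n\<close> by (intro eq_matI) (auto simp: scalar_prod_def atLeast0LessThan)
  then have "lminor k g = lminor k (?T * ?B)" by (simp add: lminor_def)
  also have "\<dots> = lminor k ?T * lminor k (transpose_mat ?B)"
    using t \<open>k \<le> n\<close> by (subst lminor_mult_left[of _ n]) (auto simp: lminor_transpose[of _ n])
  also have "lminor k ?T = (\<Prod>a<k. t a a)"
    using t \<open>k \<le> n\<close> by (subst lminor_lower_triangular) (auto intro!: prod.cong)
  also have "lminor k (transpose_mat ?B) = (\<Prod>a<k. 1)"
    using B \<open>k \<le> n\<close> by (subst lminor_lower_triangular) (auto intro!: prod.cong)
  finally show ?thesis by simp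
qed

section \<open>Sums over increasing sequences and lattice paths\<close>

definition seq_sum :: "(nat \<Rightarrow> nat \<Rightarrow> complex) \<Rightarrow> nat \<Rightarrow> nat \<Rightarrow> complex" where
  "seq_sum G N k = (\<Sum>l\<in>incr_seqs N k. \<Prod>i = 1..k. G i (l ! (i - 1)))"

lemma incr_seqs_0 [simp]: "incr_seqs N 0 = {[]}"
  by (auto simp: incr_seqs_def)

lemma incr_seqs_0_Suc [simp]: "incr_seqs 0 (Suc k) = {}"
  by (auto simp: incr_seqs_def)

lemma finite_incr_seqs: "finite (incr_seqs N k)"
  by (rule finite_subset[OF _ finite_lists_length_eq[of "{1..N}" k]]) (auto simp: incr_seqs_def)

lemma incr_seqs_Suc_Suc:
  "incr_seqs (Suc N) (Suc k) = incr_seqs N (Suc k) \<union> (\<lambda>l. l @ [Suc N]) ` incr_seqs N k"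
proof (intro equalityI subsetI)
  fix l assume l: "l \<in> incr_seqs (Suc N) (Suc k)"
  then obtain l' x where lx: "l = l' @ [x]" by (cases l rule: rev_cases) (auto simp: incr_seqs_def)
  show "l \<in> incr_seqs N (Suc k) \<union> (\<lambda>l. l @ [Suc N]) ` incr_seqs N k"
  proof (cases "x = Suc N")
    case True
    have "y \<in> {1..N}" if "y \<in> set l'" for y
      using l lx that True by (fastforce simp: incr_seqs_def sorted_wrt_append)
    then have "l' \<in> incr_seqs N k" using l lx by (auto simp: incr_seqs_def sorted_wrt_append)
    then show ?thesis using lx True by blast
  next
    case False
    then have "x \<le> N" using l lx by (auto simp: incr_seqs_def)
    then have "y \<in> {1..N}" if "y \<in> set l" for y
      using l lx that by (fastforce simp: incr_seqs_def sorted_wrt_append)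
    then show ?thesis using l by (auto simp: incr_seqs_def)
  qed
next
  fix l assume "l \<in> incr_seqs N (Suc k) \<union> (\<lambda>l. l @ [Suc N]) ` incr_seqs N k"
  then show "l \<in> incr_seqs (Suc N) (Suc k)"
    by (fastforce simp: incr_seqs_def sorted_wrt_append)
qed

lemma seq_sum_0 [simp]: "seq_sum G N 0 = 1"
  by (simp add: seq_sum_def)

lemma seq_sum_0_Suc [simp]: "seq_sum G 0 (Suc k) = 0"
  by (simp add: seq_sum_def)

text \<open>Pascal-type recursion: \<open>Suc N\<close> is either absent or the last entry, and then
  has rank \<open>Suc k\<close>. Weights depending on both rank and value are what the two kinds of
  sequences in (ii) require.\<close>

lemma seq_sum_Suc_Suc:
  "seq_sum G (Suc N) (Suc k) = seq_sum G N (Suc k) + G (Suc k) (Suc N) * seq_sum G N k"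
proof -
  let ?f = "\<lambda>l :: nat list. l @ [Suc N]"
  have disj: "incr_seqs N (Suc k) \<inter> ?f ` incr_seqs N k = {}"
    by (auto simp: incr_seqs_def)
  have inj: "inj_on ?f (incr_seqs N k)" by (auto simp: inj_on_def)
  have "(\<Sum>l\<in>?f ` incr_seqs N k. \<Prod>i = 1..Suc k. G i (l ! (i - 1))) =
      (\<Sum>l\<in>incr_seqs N k. G (Suc k) (Suc N) * (\<Prod>i = 1..k. G i (l ! (i - 1))))"
    unfolding sum.reindex[OF inj]
  proof (rule sum.cong[OF refl])
    fix l assume l: "l \<in> incr_seqs N k"
    then have len: "length l = k" by (simp add: incr_seqs_def)
    have "(\<Prod>i = 1..k. G i (?f l ! (i - 1))) = (\<Prod>i = 1..k. G i (l ! (i - 1)))"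
      by (rule prod.cong) (auto simp: nth_append len)
    then show "((\<lambda>l. \<Prod>i = 1..Suc k. G i (l ! (i - 1))) \<circ> ?f) l =
        G (Suc k) (Suc N) * (\<Prod>i = 1..k. G i (l ! (i - 1)))"
      by (simp add: nth_append len mult.commute)
  qed
  then show ?thesis
    unfolding seq_sum_def incr_seqs_Suc_Suc
    by (subst sum.union_disjoint) (use disj finite_incr_seqs in \<open>auto simp: sum_distrib_left\<close>)
qed

lemma seq_sum_eq_0: "N < k \<Longrightarrow> seq_sum G N k = 0"
proof (induction N arbitrary: k)
  case 0
  then show ?case by (cases k) auto
next
  case (Suc N)
  then obtain k' where "k = Suc k'" by (cases k) auto
  then show ?case using Suc by (simp add: seq_sum_Suc_Suc)
qed

text \<open>Lattice paths of i steps: step l is either skipped, which raises j, or taken with weight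
  \<open>d (n - j) l\<close>, where j counts the skips so far.\<close>

fun skip_sum :: "(nat \<Rightarrow> nat \<Rightarrow> complex) \<Rightarrow> nat \<Rightarrow> nat \<Rightarrow> nat \<Rightarrow> complex" where
  "skip_sum d n 0 j = (if j = 0 then 1 else 0)"
| "skip_sum d n (Suc i) j =
     (if j = 0 then 0 else skip_sum d n i (j - 1)) + d (n - j) (Suc i) * skip_sum d n i j"

lemma skip_sum_eq_0: "i < j \<Longrightarrow> skip_sum d n i j = 0"
  by (induction i arbitrary: j) auto

text \<open>Record the taken steps l_1 < l_2 < ...: before l_i exactly l_i - i steps were skipped.
  This is the origin of the upper index l_i - i in (ii).\<close>

lemma skip_sum_eq_seq_sum:
  "j \<le> i \<Longrightarrow> skip_sum d n i j = seq_sum (\<lambda>i l. d (n - (l - i)) l) i (i - j)"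
proof (induction i arbitrary: j)
  case (Suc i)
  let ?G = "\<lambda>i l. d (n - (l - i)) l"
  show ?case
  proof (cases "j = Suc i")
    case True
    then show ?thesis using Suc.IH[of i] by (simp add: skip_sum_eq_0)
  next
    case False
    then have j: "j \<le> i" "Suc i - j = Suc (i - j)" using Suc.prems by auto
    have *: "seq_sum ?G (Suc i) (Suc (i - j)) = seq_sum ?G i (Suc (i - j)) +
        d (n - j) (Suc i) * skip_sum d n i j"
      using j Suc.IH[OF j(1)] by (simp add: seq_sum_Suc_Suc)
    show ?thesis
    proof (cases j)
      case 0
      then show ?thesis using * by (simp add: seq_sum_eq_0)
    next
      case (Suc j')
      then have "skip_sum d n i j' = seq_sum ?G i (Suc (i - j))"
        using Suc.IH[of j'] j by (simp add: Suc_diff_Suc)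
      then show ?thesis using * Suc j(2) by simp
    qed
  qed
qed simp

text \<open>The coefficient of the basis row \<open>w p 1\<close> in \<open>w m (Suc j)\<close> when
  the relation \<open>w m (Suc j) = d m j * w m j - w (Suc m) j\<close> is iterated j times; note
  the shift from j to \<open>Suc j\<close>.\<close>

fun elim_coeff :: "(nat \<Rightarrow> nat \<Rightarrow> complex) \<Rightarrow> nat \<Rightarrow> nat \<Rightarrow> nat \<Rightarrow> complex" where
  "elim_coeff d m 0 p = (if p = m then 1 else 0)"
| "elim_coeff d m (Suc j) p = d m (Suc j) * elim_coeff d m j p - elim_coeff d (Suc m) j p"

lemma elim_coeff_below: "p < m \<Longrightarrow> elim_coeff d m j p = 0"
  by (induction j arbitrary: m) auto

lemma elim_coeff_above: "m + j < p \<Longrightarrow> elim_coeff d m j p = 0"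
  by (induction j arbitrary: m) auto

lemma elim_coeff_top: "elim_coeff d m j (m + j) = (- 1) ^ j"
proof (induction j arbitrary: m)
  case (Suc j)
  then show ?case using Suc[of "Suc m"] by (simp add: elim_coeff_above)
qed simp

text \<open>Going from row m to row m+k in k+1 steps, exactly one step stays in its row; after i
  moves its weight is \<open>d (m + i) (Suc k - i)\<close>. For m = 1 this becomes the sum in
  (i).\<close>

lemma elim_coeff_subtop:
  "elim_coeff d m (Suc k) (m + k) = (- 1) ^ k * (\<Sum>i\<le>k. d (m + i) (Suc k - i))"
proof (induction k arbitrary: m)
  case 0
  then show ?case by simp
next
  case (Suc k)
  have "elim_coeff d m (Suc (Suc k)) (m + Suc k) =
      d m (Suc (Suc k)) * (- 1) ^ Suc k - elim_coeff d (Suc m) (Suc k) (Suc m + k)"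
    using elim_coeff_top[of d m "Suc k"] by simp
  also have "elim_coeff d (Suc m) (Suc k) (Suc m + k) =
      (- 1) ^ k * (\<Sum>i\<le>k. d (m + Suc i) (Suc (Suc k) - Suc i))"
    using Suc.IH[of "Suc m"] by simp
  also have "d m (Suc (Suc k)) * (- 1) ^ Suc k -
      (- 1) ^ k * (\<Sum>i\<le>k. d (m + Suc i) (Suc (Suc k) - Suc i)) =
      (- 1) ^ Suc k * (\<Sum>i\<le>Suc k. d (m + i) (Suc (Suc k) - i))"
    unfolding sum.atMost_Suc_shift by (simp add: algebra_simps del: sum.atMost_Suc)
  finally show ?case .
qed

text \<open>Reaching n from m takes n-m moves, each with sign -1. Apart from the signs the recursion
  is that of \<open>skip_sum\<close> with moves as skips, since \<open>n - (n - m)\<close> is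
  m.\<close>

lemma elim_coeff_skip_sum:
  "m \<le> n \<Longrightarrow> elim_coeff d m j n = (- 1) ^ (n - m) * skip_sum d n j (n - m)"
proof (induction j arbitrary: m)
  case (Suc j)
  show ?case
  proof (cases "m = n")
    case True
    then show ?thesis using Suc.IH[of m] by (simp add: elim_coeff_below)
  next
    case False
    then have "n - m = Suc (n - Suc m)" "Suc m \<le> n" "n - Suc (n - Suc m) = m" using Suc.prems by auto
    then show ?thesis using Suc.IH[of m] Suc.IH[of "Suc m"] Suc.prems by (simp add: algebra_simps)
  qed
qed auto

section \<open>Row recursions of the product and the resulting path sums\<close>

text \<open>For the product of the blocks m, ..., n of Theta, \<open>p m i\<close> is the row of v_i
  and \<open>w m j\<close> the row of v_j', in the columns b < n. The index j = n+1 belongs to no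
  row: \<open>w_p\<close> fixes it so that \<open>w_rec\<close> also holds for j = n, which links
  upper and lower rows. For m = n+1 the product is the identity, whence \<open>w_end\<close> and
  \<open>p_end\<close>.\<close>

locale theta_rows =
  fixes n :: nat and c :: "nat \<Rightarrow> nat \<Rightarrow> complex" and p w :: "nat \<Rightarrow> nat \<Rightarrow> nat \<Rightarrow> complex"
  assumes n_pos: "n \<ge> 1"
    and c_nz: "\<And>m i. m \<in> {1..n} \<Longrightarrow> i \<in> {1..n} \<Longrightarrow> c m i \<noteq> 0"
    and c_0: "\<And>m. m \<in> {1..n} \<Longrightarrow> c m 0 = 1"
    and w_rec: "\<And>m j b. m \<in> {1..n} \<Longrightarrow> j \<in> {1..n} \<Longrightarrow> b < n \<Longrightarrow>
          w m (Suc j) b = c m (j - 1) / c m j * w m j b - w (Suc m) j b"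
    and w_end: "\<And>j b. j \<in> {1..n} \<Longrightarrow> b < n \<Longrightarrow> w (Suc n) j b = 0"
    and w_p: "\<And>m b. m \<in> {1..n} \<Longrightarrow> b < n \<Longrightarrow> w m (Suc n) b = p (Suc m) n b / c m n"
    and p_0: "\<And>m b. p m 0 b = 0"
    and p_rec: "\<And>m i b. m \<in> {1..n} \<Longrightarrow> i \<in> {1..n} \<Longrightarrow> b < n \<Longrightarrow>
          p m i b = p (Suc m) (i - 1) b + c m (i - 1) / c m i * p (Suc m) i b"
    and p_end: "\<And>i b. i \<in> {1..n} \<Longrightarrow> b < n \<Longrightarrow> p (Suc n) i b = (if b = i - 1 then 1 else 0)"
begin

definition d :: "nat \<Rightarrow> nat \<Rightarrow> complex" where "d m i = c m (i - 1) / c m i"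

lemma c_nz': "m \<in> {1..n} \<Longrightarrow> i \<le> n \<Longrightarrow> c m i \<noteq> 0"
  using c_nz[of m i] c_0[of m] by (cases "i = 0") auto

text \<open>For m = n+1 both sides vanish; j = n is excluded there because the fictitious
  \<open>w (Suc n) (Suc n)\<close> is left unspecified.\<close>

lemma w_expand:
  assumes "b < n" "m \<in> {1..Suc n}" "j \<le> n" "m = Suc n \<longrightarrow> j < n"
  shows "w m (Suc j) b = (\<Sum>q = 1..n. elim_coeff d m j q * w q 1 b)"
  using assms(2-)
proof (induction j arbitrary: m)
  case 0
  show ?case
  proof (cases "m = Suc n")
    case True
    then show ?thesis using assms(1) n_pos by (simp add: w_end)
  next
    case False
    have "(\<Sum>q = 1..n. elim_coeff d m 0 q * w q 1 b) = (\<Sum>q = 1..n. if q = m then w q 1 b else 0)"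
      by (rule sum.cong) auto
    then show ?thesis using False 0 by simp
  qed
next
  case (Suc j)
  show ?case
  proof (cases "m = Suc n")
    case True
    then show ?thesis using assms(1) Suc.prems by (simp add: w_end elim_coeff_below)
  next
    case False
    have "w m (Suc (Suc j)) b = d m (Suc j) * w m (Suc j) b - w (Suc m) (Suc j) b"
      using False Suc.prems assms(1) by (subst w_rec) (auto simp: d_def)
    also have "\<dots> = d m (Suc j) * (\<Sum>q = 1..n. elim_coeff d m j q * w q 1 b)
        - (\<Sum>q = 1..n. elim_coeff d (Suc m) j q * w q 1 b)"
      using False Suc.prems by (simp add: Suc.IH)
    also have "\<dots> = (\<Sum>q = 1..n. elim_coeff d m (Suc j) q * w q 1 b)"
      by (simp add: sum_distrib_left sum_subtractf algebra_simps)
    finally show ?thesis .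
  qed
qed

text \<open>A block combines row i with row i-1 only and takes the latter with coefficient 1. With r
  blocks, row i reaches back at most r columns, and the extreme entry is 1.\<close>

lemma p_support:
  assumes "b < n" "r \<le> n" "i \<le> n"
  shows "b + 1 + r < i \<Longrightarrow> p (Suc n - r) i b = 0"
    and "b + 1 + r = i \<Longrightarrow> p (Suc n - r) i b = 1"
proof -
  have "(b + 1 + r < i \<longrightarrow> p (Suc n - r) i b = 0) \<and> (b + 1 + r = i \<longrightarrow> p (Suc n - r) i b = 1)"
    using assms(2,3)
  proof (induction r arbitrary: i)
    case 0
    then show ?case using assms(1) by (auto simp: p_end)
  next
    case (Suc r)
    then have "p (Suc n - Suc r) i b = p (Suc n - r) (i - 1) b + d (n - r) i * p (Suc n - r) i b" if "i \<ge> 1"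
      using assms(1) that p_rec[of "n - r" i b] by (simp add: d_def Suc_diff_le)
    then show ?case using Suc.IH[of "i - 1"] Suc.IH[of i] Suc.prems by auto
  qed
  then show "b + 1 + r < i \<Longrightarrow> p (Suc n - r) i b = 0" "b + 1 + r = i \<Longrightarrow> p (Suc n - r) i b = 1"
    by auto
qed

text \<open>Outer induction on the number r of blocks, inner induction downwards in j: the
  fictitious row n+1 is known from \<open>p_support\<close>, and \<open>w_rec\<close> is solved for
  \<open>w m j\<close>. At j = 1 the diagonal entry is 1 / c m 0 = 1, so the rows
  \<open>w q 1\<close> are unitriangular.\<close>

lemma w_support:
  assumes "b < n" "r \<le> n" "j \<in> {1..Suc n}" "r = 0 \<longrightarrow> j \<le> n"
  shows "(b + 1 < Suc n - r \<longrightarrow> w (Suc n - r) j b = 0) \<and>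
    (b + 1 = Suc n - r \<longrightarrow> w (Suc n - r) j b = 1 / c (Suc n - r) (j - 1))"
  using assms(2-)
proof (induction r arbitrary: j)
  case 0
  then show ?case using assms(1) by (auto simp: w_end)
next
  case (Suc r)
  let ?m = "n - r"
  have m: "?m \<in> {1..n}" "Suc n - Suc r = ?m" "Suc ?m = Suc n - r" using Suc.prems by auto
  have "(b + 1 < ?m \<longrightarrow> w ?m j b = 0) \<and> (b + 1 = ?m \<longrightarrow> w ?m j b = 1 / c ?m (j - 1))"
    if "j \<le> Suc n" "1 \<le> j" for j
    using that
  proof (induction j rule: inc_induct)
    case base
    then show ?case
      using p_support[of b r n, folded m(3)] assms(1) m(1) Suc.prems by (auto simp: w_p)
  next
    case (step j)
    have nz: "c ?m (j - 1) \<noteq> 0" "c ?m j \<noteq> 0" using c_nz'[OF m(1)] step by auto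
    have rec: "w ?m (Suc j) b = c ?m (j - 1) / c ?m j * w ?m j b - w (Suc n - r) j b"
      using w_rec[of ?m j b] m(1) step assms(1) unfolding m(3)[symmetric] by simp
    have z: "b + 1 \<le> ?m \<Longrightarrow> w (Suc n - r) j b = 0"
      using Suc.IH[of j] step Suc.prems by auto
    show ?case using step rec z nz by (auto simp: field_simps)
  qed
  then show ?case using Suc.prems m by auto
qed

lemma w1_below: "q \<in> {1..n} \<Longrightarrow> b + 1 < q \<Longrightarrow> w q 1 b = 0"
  and w1_diag: "q \<in> {1..n} \<Longrightarrow> w q 1 (q - 1) = 1"
  using w_support[of b "Suc n - q" 1] w_support[of "q - 1" "Suc n - q" 1] c_0[of q] by auto

text \<open>Inserting \<open>p_rec\<close> and the recursion of \<open>skip_sum\<close>, the terms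
  containing d cancel and minus the sum for the preceding i is left; at i = 0 it vanishes by
  \<open>p_0\<close>.\<close>

lemma p_telescope:
  assumes "b < n" "i \<le> n"
  shows "(\<Sum>j\<le>i. (- 1) ^ j * skip_sum d n i j * p (Suc n - j) i b) = 0"
  using assms(2)
proof (induction i)
  case (Suc i)
  let ?t = "\<lambda>j. (- 1) ^ j * skip_sum d n i j"
  have "(\<Sum>j\<le>Suc i. (- 1) ^ j * skip_sum d n (Suc i) j * p (Suc n - j) (Suc i) b) =
    (\<Sum>j\<le>Suc i. (- 1) ^ j * (if j = 0 then 0 else skip_sum d n i (j - 1)) * p (Suc n - j) (Suc i) b)
    + (\<Sum>j\<le>Suc i. ?t j * (d (n - j) (Suc i) * p (Suc n - j) (Suc i) b))"
    unfolding sum.distrib[symmetric] by (rule sum.cong) (auto simp: algebra_simps)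
  also have "(\<Sum>j\<le>Suc i. ?t j * (d (n - j) (Suc i) * p (Suc n - j) (Suc i) b)) =
     (\<Sum>j\<le>i. ?t j * (d (n - j) (Suc i) * p (Suc n - j) (Suc i) b))"
    by (simp add: skip_sum_eq_0)
  also have "(\<Sum>j\<le>Suc i. (- 1) ^ j * (if j = 0 then 0 else skip_sum d n i (j - 1)) * p (Suc n - j) (Suc i) b)
     = - (\<Sum>j\<le>i. ?t j * p (n - j) (Suc i) b)"
    unfolding sum.atMost_Suc_shift by (simp add: sum_negf)
  also have "(\<Sum>j\<le>i. ?t j * p (n - j) (Suc i) b) = (\<Sum>j\<le>i. ?t j * p (Suc n - j) i b) +
     (\<Sum>j\<le>i. ?t j * (d (n - j) (Suc i) * p (Suc n - j) (Suc i) b))"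
    unfolding sum.distrib[symmetric]
  proof (rule sum.cong[OF refl])
    fix j assume "j \<in> {..i}"
    then have "n - j \<in> {1..n}" "Suc (n - j) = Suc n - j" using Suc.prems by auto
    then have "p (n - j) (Suc i) b = p (Suc n - j) i b + d (n - j) (Suc i) * p (Suc n - j) (Suc i) b"
      using p_rec[of "n - j" "Suc i" b] Suc.prems assms(1) by (simp add: d_def)
    then show "?t j * p (n - j) (Suc i) b =
        ?t j * p (Suc n - j) i b + ?t j * (d (n - j) (Suc i) * p (Suc n - j) (Suc i) b)"
      by (simp add: algebra_simps)
  qed
  finally show ?case using Suc by simp
qed (simp add: p_0)

definition Q :: "nat \<Rightarrow> complex" where "Q k = seq_sum (\<lambda>i l. d (n - (l - i)) l) n k"

text \<open>At i = n the telescoping identity, reindexed by k = n - j, expresses the row of v_n by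
  the rows \<open>p (Suc k) n\<close> with k \<ge> 1, because \<open>Q 0\<close> is 1. These rows
  are \<open>c k n * w k (Suc n)\<close>, to which \<open>w_expand\<close> applies.\<close>

lemma p_1_n_expand:
  assumes b: "b < n"
  shows "p 1 n b = (\<Sum>q = 1..n. (\<Sum>k = 1..n. (- 1) ^ (k - 1) * Q k * c k n * elim_coeff d k n q) * w q 1 b)"
proof -
  have "(\<Sum>j\<le>n. (- 1) ^ j * skip_sum d n n j * p (Suc n - j) n b) =
      (\<Sum>k\<le>n. (- 1) ^ (n - k) * Q k * p (Suc k) n b)"
    by (rule sum.reindex_bij_witness[of _ "\<lambda>k. n - k" "\<lambda>k. n - k"])
       (auto simp: skip_sum_eq_seq_sum Q_def Suc_diff_le)
  also have "\<dots> = (- 1) ^ n * (\<Sum>k\<le>n. (- 1) ^ k * Q k * p (Suc k) n b)"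
    unfolding sum_distrib_left
    by (rule sum.cong) (auto simp: minus_one_power_iff)
  finally have "(\<Sum>k\<le>n. (- 1) ^ k * Q k * p (Suc k) n b) = 0"
    using p_telescope[OF b order_refl] by simp
  moreover have "{..n} = insert 0 {1..n}" by auto
  ultimately have "p 1 n b + (\<Sum>k = 1..n. (- 1) ^ k * Q k * p (Suc k) n b) = 0"
    by (simp add: Q_def)
  moreover have "(\<Sum>k = 1..n. (- 1) ^ k * Q k * p (Suc k) n b) =
     - (\<Sum>k = 1..n. (- 1) ^ (k - 1) * Q k * p (Suc k) n b)"
    unfolding sum_negf[symmetric] by (rule sum.cong) (auto simp: minus_one_power_iff)
  ultimately have "p 1 n b = (\<Sum>k = 1..n. (- 1) ^ (k - 1) * Q k * p (Suc k) n b)" by simp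
  also have "\<dots> = (\<Sum>k = 1..n. (- 1) ^ (k - 1) * Q k * (c k n * w k (Suc n) b))"
    using b n_pos by (intro sum.cong) (auto simp: w_p c_nz)
  also have "\<dots> = (\<Sum>k = 1..n. (- 1) ^ (k - 1) * Q k * (c k n * (\<Sum>q = 1..n. elim_coeff d k n q * w q 1 b)))"
    using b by (intro sum.cong) (auto simp: w_expand)
  also have "\<dots> = (\<Sum>k = 1..n. \<Sum>q = 1..n. (- 1) ^ (k - 1) * Q k * c k n * elim_coeff d k n q * w q 1 b)"
    by (simp add: sum_distrib_left mult.assoc)
  also have "\<dots> = (\<Sum>q = 1..n. (\<Sum>k = 1..n. (- 1) ^ (k - 1) * Q k * c k n * elim_coeff d k n q) * w q 1 b)"
    by (subst sum.swap) (simp add: sum_distrib_right)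
  finally show ?thesis .
qed

text \<open>The second factor \<open>Q k\<close> counts the paths that expand
  \<open>w k (Suc n)\<close> down to the last basis vector; the signs of the two path sums combine
  to one independent of k.\<close>

lemma p_1_n_coeff:
  "(\<Sum>k = 1..n. (- 1) ^ (k - 1) * Q k * c k n * elim_coeff d k n n) =
   (- 1) ^ (n - 1) * (\<Sum>k = 1..n. c k n * Q k ^ 2)"
proof -
  have "(- 1) ^ (k - 1) * Q k * c k n * elim_coeff d k n n = (- 1) ^ (n - 1) * (c k n * Q k ^ 2)"
    if "k \<in> {1..n}" for k
  proof -
    have "elim_coeff d k n n = (- 1) ^ (n - k) * Q k"
      using that by (simp add: elim_coeff_skip_sum skip_sum_eq_seq_sum Q_def)
    moreover have "(- 1) ^ (k - 1) * (- 1) ^ (n - k) = ((- 1) ^ (n - 1) :: complex)"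
      using that by (simp add: power_add[symmetric])
    ultimately show ?thesis by (simp add: power2_eq_square mult_ac)
  qed
  then show ?thesis unfolding sum_distrib_left by (intro sum.cong refl)
qed

text \<open>Complementation: each value belongs either to u or to the complementary sequence. Both
  sides obey the same recursion, because \<open>c (n - m) (Suc i) * d (n - m) (Suc i)\<close> is
  \<open>c (n - m) i\<close>, and \<open>C_frac n c m (Suc i)\<close> times
  \<open>c (n - m + 1) i\<close> is \<open>c (n - m) (Suc i)\<close>. A general i serves the
  induction; (ii) uses i = n.\<close>

lemma seq_sum_C_frac:
  "i \<le> n \<Longrightarrow> m \<le> i \<Longrightarrow> m < n \<Longrightarrow>
   seq_sum (C_frac n c) i m = c (n - m) i * seq_sum (\<lambda>i l. d (n - (l - i)) l) i (i - m)"
proof (induction i arbitrary: m)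
  case 0
  then show ?case using n_pos by (simp add: c_0)
next
  case (Suc i)
  let ?G = "\<lambda>i l. d (n - (l - i)) l"
  show ?case
  proof (cases m)
    case 0
    have "1 = c n i * seq_sum ?G i i" using Suc.IH[of 0] Suc.prems by simp
    then show ?thesis
      using 0 Suc.prems n_pos c_nz'[of n "Suc i"]
      by (simp add: seq_sum_Suc_Suc seq_sum_eq_0 d_def field_simps)
  next
    case (Suc m')
    have nz: "c (n - m) (Suc i) \<noteq> 0" "c (n - m') i \<noteq> 0"
      using Suc Suc.prems c_nz'[of "n - m" "Suc i"] c_nz'[of "n - m'" i] by auto
    have nm: "n - m + 1 = n - m'" using Suc Suc.prems by simp
    have cf: "C_frac n c m (Suc i) = c (n - m) (Suc i) / c (n - m') i"
      using nm by (simp add: C_frac_def)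
    have dd: "c (n - m) (Suc i) * d (n - m) (Suc i) = c (n - m) i"
      using nz by (simp add: d_def)
    have IH': "seq_sum (C_frac n c) i m' = c (n - m') i * seq_sum ?G i (i - m')"
      using Suc.IH[of m'] Suc Suc.prems by simp
    show ?thesis
    proof (cases "m = Suc i")
      case True
      then show ?thesis using Suc IH' nz cf by (simp add: seq_sum_Suc_Suc seq_sum_eq_0)
    next
      case False
      then have le: "m \<le> i" "Suc i - m = Suc (i - m)" "i - m' = Suc (i - m)" "i - (i - m) = m"
        using Suc Suc.prems by auto
      have "seq_sum (C_frac n c) i m = c (n - m) i * seq_sum ?G i (i - m)"
        using Suc.IH[OF _ le(1)] Suc.prems by simp
      then show ?thesis
        using dd IH' nz cf le Suc by (simp add: seq_sum_Suc_Suc distrib_left)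
    qed
  qed
qed

text \<open>The sum over l is \<open>Q k\<close>, the sum over u is \<open>c k n * Q k\<close> by
  complementation, and m < n means k \<ge> 1.\<close>

lemma minor_sum:
  "(\<Sum>(k, m) \<in> {(k, m). k + m = n \<and> m < n}.
      \<Sum>l \<in> incr_seqs n k. \<Sum>u \<in> incr_seqs n m.
        (\<Prod>j = 1..m. C_frac n c j (u ! (j - 1))) *
        (\<Prod>i = 1..k. C_bar n c (l ! (i - 1) - i) (l ! (i - 1)))) =
   (\<Sum>k = 1..n. c k n * Q k ^ 2)"
proof -
  have "(\<Sum>l \<in> incr_seqs n k. \<Sum>u \<in> incr_seqs n (n - k).
        (\<Prod>j = 1..n - k. C_frac n c j (u ! (j - 1))) *
        (\<Prod>i = 1..k. C_bar n c (l ! (i - 1) - i) (l ! (i - 1)))) = c k n * Q k ^ 2"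
    if "k \<in> {1..n}" for k
  proof -
    have "(\<Sum>l \<in> incr_seqs n k. \<Sum>u \<in> incr_seqs n (n - k).
        (\<Prod>j = 1..n - k. C_frac n c j (u ! (j - 1))) *
        (\<Prod>i = 1..k. C_bar n c (l ! (i - 1) - i) (l ! (i - 1)))) =
        Q k * seq_sum (C_frac n c) n (n - k)"
      unfolding Q_def seq_sum_def sum_product
      by (intro sum.cong refl) (simp add: C_bar_def d_def mult.commute)
    also have "seq_sum (C_frac n c) n (n - k) = c k n * Q k"
      using that seq_sum_C_frac[of n "n - k"] by (simp add: Q_def)
    finally show ?thesis by (simp add: power2_eq_square)
  qed
  then have "(\<Sum>k = 1..n. c k n * Q k ^ 2) = (\<Sum>k = 1..n. \<Sum>l \<in> incr_seqs n k. \<Sum>u \<in> incr_seqs n (n - k).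
        (\<Prod>j = 1..n - k. C_frac n c j (u ! (j - 1))) *
        (\<Prod>i = 1..k. C_bar n c (l ! (i - 1) - i) (l ! (i - 1))))"
    by (intro sum.cong) auto
  also have "\<dots> = (\<Sum>(k, m) \<in> {(k, m). k + m = n \<and> m < n}.
      \<Sum>l \<in> incr_seqs n k. \<Sum>u \<in> incr_seqs n m.
        (\<Prod>j = 1..m. C_frac n c j (u ! (j - 1))) *
        (\<Prod>i = 1..k. C_bar n c (l ! (i - 1) - i) (l ! (i - 1))))"
    by (rule sum.reindex_bij_witness[of _ "fst" "\<lambda>k. (k, n - k)"]) auto
  finally show ?thesis by simp
qed

end

section \<open>The symplectic group\<close>

lemma mult_index:
  "u \<in> carrier_mat N N \<Longrightarrow> g \<in> carrier_mat N N \<Longrightarrow> a < N \<Longrightarrow> b < N \<Longrightarrow>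
   (u * g) $$ (a, b) = (\<Sum>l<N. u $$ (a, l) * g $$ (l, b))"
  for u g :: "complex mat"
  by (simp add: scalar_prod_def atLeast0LessThan)

text \<open>The rows i and 2n - i in which \<open>chev_f n i\<close> is nonzero differ by an even
  number, so they are never adjacent. Hence f_i squares to zero and its exponential is
  linear.\<close>

lemma not_consecutive:
  "i \<in> {1..n} \<Longrightarrow> \<not> ((Suc b = i \<or> Suc b = 2 * n - i) \<and> (Suc (Suc b) = i \<or> Suc (Suc b) = 2 * n - i))"
  by (simp only: atLeastAtMost_iff) presburger

lemma mat_exp_nilpotent:
  assumes A: "A \<in> carrier_mat N N" and sq: "A * A = 0\<^sub>m N N"
  shows "mat_exp A = 1\<^sub>m N + A"
proof (rule eq_matI)
  fix a b assume ab: "a < dim_row (1\<^sub>m N + A)" "b < dim_col (1\<^sub>m N + A)"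
  have pow: "A ^\<^sub>m (Suc (Suc k)) = 0\<^sub>m N N" for k
  proof (induction k)
    case 0
    then show ?case using A sq by simp
  next
    case (Suc k)
    then show ?case using A by simp
  qed
  have "(\<Sum>k. (A ^\<^sub>m k) $$ (a, b) / fact k) = (\<Sum>k\<in>{0, 1}. (A ^\<^sub>m k) $$ (a, b) / fact k)"
  proof (rule suminf_finite)
    fix k :: nat assume "k \<notin> {0, 1}"
    then obtain k' where "k = Suc (Suc k')" by (metis One_nat_def insertCI not0_implies_Suc)
    then show "(A ^\<^sub>m k) $$ (a, b) / fact k = 0" using pow[of k'] A ab by simp
  qed simp
  then show "mat_exp A $$ (a, b) = (1\<^sub>m N + A) $$ (a, b)"
    using A ab by (simp add: mat_exp_def)
qed (use A in \<open>auto simp: mat_exp_def\<close>)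

lemma chev_carrier [simp]:
  "chev_e n i \<in> carrier_mat (2 * n) (2 * n)" "chev_f n i \<in> carrier_mat (2 * n) (2 * n)"
  by (auto simp: chev_e_def chev_f_def)

lemma chev_dim [simp]:
  "dim_row (chev_e n i) = 2 * n" "dim_col (chev_e n i) = 2 * n"
  "dim_row (chev_f n i) = 2 * n" "dim_col (chev_f n i) = 2 * n"
  by (auto simp: chev_e_def chev_f_def)

lemma chev_f_index:
  "a < 2 * n \<Longrightarrow> b < 2 * n \<Longrightarrow>
   chev_f n i $$ (a, b) = (if a = b + 1 \<and> (a = i \<or> a = 2 * n - i) then 1 else 0)"
  by (simp add: chev_f_def chev_e_def)

lemma chev_f_sq:
  assumes "i \<in> {1..n}"
  shows "chev_f n i * chev_f n i = 0\<^sub>m (2 * n) (2 * n)"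
proof (rule eq_matI)
  fix a b assume "a < dim_row (0\<^sub>m (2 * n) (2 * n) :: complex mat)" "b < dim_col (0\<^sub>m (2 * n) (2 * n) :: complex mat)"
  then have ab: "a < 2 * n" "b < 2 * n" by auto
  have "(chev_f n i * chev_f n i) $$ (a, b) = (\<Sum>l<2 * n. chev_f n i $$ (a, l) * chev_f n i $$ (l, b))"
    using ab by (intro mult_index) auto
  also have "\<dots> = 0"
  proof (rule sum.neutral, rule ballI)
    fix l assume "l \<in> {..<2 * n}"
    then show "chev_f n i $$ (a, l) * chev_f n i $$ (l, b) = 0"
      using ab not_consecutive[OF assms, of b] by (auto simp: chev_f_index)
  qed
  finally show "(chev_f n i * chev_f n i) $$ (a, b) = 0\<^sub>m (2 * n) (2 * n) $$ (a, b)" using ab by simp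
qed (auto simp: chev_f_def chev_e_def)

lemma y_sub_eq: "i \<in> {1..n} \<Longrightarrow> y_sub n i t = 1\<^sub>m (2 * n) + t \<cdot>\<^sub>m chev_f n i"
  unfolding y_sub_def
  by (rule mat_exp_nilpotent)
     (auto simp: mult_smult_assoc_mat[of _ "2 * n" "2 * n" _ "2 * n"]
        mult_smult_distrib[of _ "2 * n" "2 * n" _ "2 * n"] chev_f_sq)

lemma x_sub_eq: "i \<in> {1..n} \<Longrightarrow> x_sub n i t = transpose_mat (y_sub n i t)"
proof -
  assume i: "i \<in> {1..n}"
  have ef: "chev_e n i = transpose_mat (chev_f n i)" by (simp add: chev_f_def)
  have "chev_e n i * chev_e n i = 0\<^sub>m (2 * n) (2 * n)"
    unfolding ef transpose_mult[OF chev_carrier(2) chev_carrier(2), symmetric] chev_f_sq[OF i] by simp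
  then have "x_sub n i t = 1\<^sub>m (2 * n) + t \<cdot>\<^sub>m chev_e n i"
    unfolding x_sub_def
    by (intro mat_exp_nilpotent)
       (auto simp: mult_smult_assoc_mat[of _ "2 * n" "2 * n" _ "2 * n"]
        mult_smult_distrib[of _ "2 * n" "2 * n" _ "2 * n"])
  then show ?thesis unfolding y_sub_eq[OF i] by (auto simp: mat_eq_iff chev_f_def)
qed

lemma y_sub_index:
  assumes "i \<in> {1..n}" "a < 2 * n" "b < 2 * n"
  shows "y_sub n i t $$ (a, b) =
    (if a = b then 1 else if a = b + 1 \<and> (a = i \<or> a = 2 * n - i) then t else 0)"
  using assms by (auto simp: y_sub_eq chev_f_index)

lemma y_sub_dim [simp]:
  "i \<in> {1..n} \<Longrightarrow> dim_row (y_sub n i t) = 2 * n" "i \<in> {1..n} \<Longrightarrow> dim_col (y_sub n i t) = 2 * n"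
  by (simp_all add: y_sub_eq)

lemma y_sub_carrier [simp]: "i \<in> {1..n} \<Longrightarrow> y_sub n i t \<in> carrier_mat (2 * n) (2 * n)"
  by (simp add: y_sub_eq)

lemma x_sub_carrier [simp]: "i \<in> {1..n} \<Longrightarrow> x_sub n i t \<in> carrier_mat (2 * n) (2 * n)"
  by (simp add: x_sub_eq)

lemma y_sub_mult_index:
  assumes "i \<in> {1..n}" "g \<in> carrier_mat (2 * n) (2 * n)" "a < 2 * n" "b < 2 * n"
  shows "(y_sub n i t * g) $$ (a, b) =
    g $$ (a, b) + (if a = i \<or> a = 2 * n - i then t * g $$ (a - 1, b) else 0)"
proof -
  have *: "y_sub n i t $$ (a, l) * g $$ (l, b) = (if l = a then g $$ (a, b) else 0) +
      (if l = a - 1 then if a = i \<or> a = 2 * n - i then t * g $$ (a - 1, b) else 0 else 0)"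
    if "l < 2 * n" for l
    using assms that by (auto simp: y_sub_index)
  have "(y_sub n i t * g) $$ (a, b) = (\<Sum>l<2 * n. (if l = a then g $$ (a, b) else 0) +
      (if l = a - 1 then if a = i \<or> a = 2 * n - i then t * g $$ (a - 1, b) else 0 else 0))"
    using assms * by (subst mult_index[of _ "2 * n"]) auto
  moreover have "a - 1 < 2 * n" using assms by simp
  ultimately show ?thesis using assms by (simp add: sum.distrib)
qed

lemma x_sub_mult_index:
  assumes "i \<in> {1..n}" "g \<in> carrier_mat (2 * n) (2 * n)" "a < 2 * n" "b < 2 * n"
  shows "(x_sub n i t * g) $$ (a, b) =
    g $$ (a, b) + (if Suc a = i \<or> Suc a = 2 * n - i then t * g $$ (Suc a, b) else 0)"
proof -
  have *: "x_sub n i t $$ (a, l) * g $$ (l, b) = (if l = a then g $$ (a, b) else 0) +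
      (if l = Suc a then if Suc a = i \<or> Suc a = 2 * n - i then t * g $$ (Suc a, b) else 0 else 0)"
    if "l < 2 * n" for l
    using assms that y_sub_carrier[OF assms(1), of t] by (auto simp: x_sub_eq y_sub_index)
  have "(x_sub n i t * g) $$ (a, b) = (\<Sum>l<2 * n. (if l = a then g $$ (a, b) else 0) +
      (if l = Suc a then if Suc a = i \<or> Suc a = 2 * n - i then t * g $$ (Suc a, b) else 0 else 0))"
    using assms * by (subst mult_index[of _ "2 * n"]) auto
  then show ?thesis using assms by (auto simp: sum.distrib)
qed

section \<open>The symplectic form, inverses and transposes\<close>

lemma sympl_form_carrier [simp]: "sympl_form n \<in> carrier_mat (2 * n) (2 * n)"
  by (simp add: sympl_form_def)

lemma sympl_form_dim [simp]: "dim_row (sympl_form n) = 2 * n" "dim_col (sympl_form n) = 2 * n"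
  by (simp_all add: sympl_form_def)

lemma Sp_iff:
  "g \<in> carrier (Sp n) \<longleftrightarrow> g \<in> carrier_mat (2 * n) (2 * n) \<and>
     transpose_mat g * sympl_form n * g = sympl_form n"
  by (auto simp: Sp_def)

lemma Sp_carrier_mat: "g \<in> carrier (Sp n) \<Longrightarrow> g \<in> carrier_mat (2 * n) (2 * n)"
  by (simp add: Sp_iff)

lemma sympl_form_mult_index:
  assumes "h \<in> carrier_mat (2 * n) (2 * n)" "l < 2 * n" "b < 2 * n"
  shows "(sympl_form n * h) $$ (l, b) = (- 1) ^ l * h $$ (2 * n - 1 - l, b)"
proof -
  have "(sympl_form n * h) $$ (l, b) = (\<Sum>q<2 * n. sympl_form n $$ (l, q) * h $$ (q, b))"
    using assms by (intro mult_index) auto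
  also have "\<dots> = (\<Sum>q<2 * n. if q = 2 * n - 1 - l then (- 1) ^ l * h $$ (2 * n - 1 - l, b) else 0)"
    using assms by (intro sum.cong) (auto simp: sympl_form_def)
  finally show ?thesis using assms by simp
qed

lemma form_mult_index:
  assumes "g \<in> carrier_mat (2 * n) (2 * n)" "h \<in> carrier_mat (2 * n) (2 * n)" "a < 2 * n" "b < 2 * n"
  shows "(transpose_mat g * sympl_form n * h) $$ (a, b) =
    (\<Sum>l<2 * n. (- 1) ^ l * g $$ (l, a) * h $$ (2 * n - 1 - l, b))"
proof -
  have Jh: "(sympl_form n * h) $$ (l, b) = (- 1) ^ l * h $$ (2 * n - 1 - l, b)" if "l < 2 * n" for l
    using assms that by (intro sympl_form_mult_index)
  have "transpose_mat g * sympl_form n * h = transpose_mat g * (sympl_form n * h)"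
    using assms by (intro assoc_mult_mat[of _ "2 * n" "2 * n" _ "2 * n" _ "2 * n"]) auto
  also have "\<dots> $$ (a, b) = (\<Sum>l<2 * n. g $$ (l, a) * ((- 1) ^ l * h $$ (2 * n - 1 - l, b)))"
    using assms Jh by (subst mult_index[of _ "2 * n"]) (auto intro!: mult_carrier_mat[of _ _ "2 * n"])
  finally show ?thesis by (simp add: mult_ac)
qed

lemma Sp_iff_index:
  assumes "g \<in> carrier_mat (2 * n) (2 * n)"
  shows "g \<in> carrier (Sp n) \<longleftrightarrow> (\<forall>a<2 * n. \<forall>b<2 * n.
    (\<Sum>l<2 * n. (- 1) ^ l * g $$ (l, a) * g $$ (2 * n - 1 - l, b)) =
    (if a + b + 1 = 2 * n then (- 1) ^ a else 0))"
proof -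
  have "transpose_mat g * sympl_form n * g = sympl_form n \<longleftrightarrow> (\<forall>a<2 * n. \<forall>b<2 * n.
      (transpose_mat g * sympl_form n * g) $$ (a, b) = sympl_form n $$ (a, b))"
    using assms by (subst mat_eq_iff) (auto simp del: index_mult_mat(1))
  moreover have "sympl_form n $$ (a, b) = (if a + b + 1 = 2 * n then (- 1) ^ a else 0)"
    if "a < 2 * n" "b < 2 * n" for a b using that by (simp add: sympl_form_def)
  ultimately show ?thesis using assms by (simp add: Sp_iff form_mult_index del: index_mult_mat(1))
qed

lemma y_sub_Sp: 
  assumes "i \<in> {1..n}"
  shows "y_sub n i t \<in> carrier (Sp n)"
proof -
  let ?F = "chev_f n i" and ?J = "sympl_form n" and ?N = "2 * n"
  have "transpose_mat (y_sub n i t) * ?J * y_sub n i t = ?J"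
  proof (rule eq_matI)
    fix a b assume "a < dim_row ?J" "b < dim_col ?J"
    then have ab: "a < ?N" "b < ?N" by (auto simp: sympl_form_def)
    define s where "s a = (if Suc a = i \<or> Suc a = ?N - i then t else 0)" for a
    have col: "y_sub n i t $$ (l, a) = (if l = a then 1 else 0) + (if l = Suc a then s a else 0)"
      if "l < ?N" "a < ?N" for l a using that assms by (auto simp: y_sub_index s_def)
    have "(transpose_mat (y_sub n i t) * ?J * y_sub n i t) $$ (a, b) =
      (\<Sum>l<?N. (- 1) ^ l * y_sub n i t $$ (l, a) * y_sub n i t $$ (?N - 1 - l, b))"
      using assms ab by (intro form_mult_index) auto
    also have "\<dots> = (\<Sum>l<?N. (if l = a then (- 1) ^ a * y_sub n i t $$ (?N - 1 - a, b) else 0) +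
        (if l = Suc a then - ((- 1) ^ a * s a * y_sub n i t $$ (?N - 1 - Suc a, b)) else 0))"
      using ab by (intro sum.cong) (auto simp: col)
    also have "\<dots> = (- 1) ^ a * y_sub n i t $$ (?N - 1 - a, b) -
        (if Suc a < ?N then (- 1) ^ a * s a * y_sub n i t $$ (?N - 1 - Suc a, b) else 0)"
      using ab by (auto simp: sum.distrib)
    also have "\<dots> = (- 1) ^ a * (y_sub n i t $$ (?N - 1 - a, b) -
        (if Suc a < ?N then s a * y_sub n i t $$ (?N - 1 - Suc a, b) else 0))"
      by (simp add: algebra_simps)
    also have "y_sub n i t $$ (?N - 1 - a, b) -
        (if Suc a < ?N then s a * y_sub n i t $$ (?N - 1 - Suc a, b) else 0) =
        (if a + b + 1 = ?N then 1 else 0)"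
    proof -
      \<comment> \<open>The alternating signs of the form cancel the two linear terms by
        \<open>sym\<close>. A quadratic term would need \<open>Suc a\<close> and
        \<open>Suc b\<close> in {i, 2n - i} with the odd sum 2n - 1, which parity forbids.\<close>
      have sym: "a + b + 2 = ?N \<Longrightarrow> s a = s b" unfolding s_def using ab by auto
      have two: "s a * s b = 0" if "a + b + 3 = ?N"
        using that assms ab unfolding s_def by (auto, presburger+)
      have s_end: "s a = 0" if "\<not> Suc a < ?N" unfolding s_def using that ab assms by auto
      show ?thesis
        using ab sym two s_end by (auto simp: col split: if_splits)
    qed
    finally show "(transpose_mat (y_sub n i t) * ?J * y_sub n i t) $$ (a, b) = ?J $$ (a, b)"
      using ab by (simp add: sympl_form_def)
  qed (use assms in auto)
  then show ?thesis using assms by (simp add: Sp_iff)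
qed

lemma sympl_form_sq: "sympl_form n * sympl_form n = - 1\<^sub>m (2 * n)"
proof (rule eq_matI)
  fix a b assume "a < dim_row (- 1\<^sub>m (2 * n) :: complex mat)" "b < dim_col (- 1\<^sub>m (2 * n) :: complex mat)"
  then have ab: "a < 2 * n" "b < 2 * n" by auto
  have "(sympl_form n * sympl_form n) $$ (a, b) =
     (\<Sum>l<2 * n. sympl_form n $$ (a, l) * sympl_form n $$ (l, b))"
    using ab by (intro mult_index) auto
  also have "\<dots> = (\<Sum>l<2 * n. if l = 2 * n - 1 - a then (- 1) ^ a * sympl_form n $$ (2 * n - 1 - a, b) else 0)"
    using ab by (intro sum.cong) (auto simp: sympl_form_def)
  also have "\<dots> = (- 1) ^ a * sympl_form n $$ (2 * n - 1 - a, b)" using ab by simp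
  also have "\<dots> = (if a = b then (- 1) ^ a * (- 1) ^ (2 * n - 1 - a) else 0)"
    using ab by (auto simp: sympl_form_def)
  also have "(- 1) ^ a * (- 1) ^ (2 * n - 1 - a) = (- 1 :: complex)"
  proof -
    have "odd (a + (2 * n - 1 - a))" using ab by auto
    then show ?thesis unfolding power_add[symmetric] by (subst power_minus_odd) auto
  qed
  also have "(if a = b then - 1 else 0 :: complex) = (- 1\<^sub>m (2 * n)) $$ (a, b)"
    using ab by auto
  finally show "(sympl_form n * sympl_form n) $$ (a, b) = (- 1\<^sub>m (2 * n)) $$ (a, b)" .
qed (auto simp: sympl_form_def)

text \<open>As J = \<open>sympl_form n\<close> squares to -1, the defining identity makes -J g^T J a
  left inverse of g. It is then also a right inverse, which gives the same identity for the
  transpose.\<close>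

lemma Sp_inverse_exists:
  assumes "g \<in> carrier (Sp n)"
  shows "\<exists>h \<in> carrier (Sp n). h * g = 1\<^sub>m (2 * n) \<and> g * h = 1\<^sub>m (2 * n)"
    and "g * sympl_form n * transpose_mat g = sympl_form n"
proof -
  let ?N = "2 * n" and ?J = "sympl_form n"
  note m = assoc_mult_mat[of _ ?N ?N _ ?N _ ?N] mult_carrier_mat[of _ ?N ?N _ ?N]
  have J: "?J \<in> carrier_mat ?N ?N" by simp
  have g: "g \<in> carrier_mat ?N ?N" "transpose_mat g * ?J * g = ?J" using assms by (auto simp: Sp_iff)
  have gT: "transpose_mat g \<in> carrier_mat ?N ?N" using g by simp
  define h where "h = - (?J * (transpose_mat g * ?J))"
  have h: "h \<in> carrier_mat ?N ?N" using g unfolding h_def by auto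
  have "h * g = - (?J * (transpose_mat g * ?J) * g)"
    unfolding h_def using g by (subst uminus_mult_left_mat) auto
  also have "?J * (transpose_mat g * ?J) * g = ?J * (transpose_mat g * ?J * g)"
    using g J gT by (intro assoc_mult_mat[of _ ?N ?N _ ?N _ ?N]) auto
  also have "\<dots> = - 1\<^sub>m ?N" unfolding g(2) by (rule sympl_form_sq)
  finally have hg: "h * g = 1\<^sub>m ?N" by simp
  have gh: "g * h = 1\<^sub>m ?N" by (rule mat_mult_left_right_inverse[OF h g(1) hg])
  have "transpose_mat h * ?J * h = transpose_mat h * (transpose_mat g * ?J * g) * h" using g by simp
  also have "\<dots> = (transpose_mat h * transpose_mat g) * ?J * (g * h)"
    using g(1) h J gT transpose_carrier_mat[THEN iffD2, OF h] by (simp add: m)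
  also have "transpose_mat h * transpose_mat g = 1\<^sub>m ?N"
    using gh transpose_mult[OF g(1) h] by simp
  finally have "transpose_mat h * ?J * h = ?J" using gh J by simp
  then have "h \<in> carrier (Sp n)" using h by (simp add: Sp_iff)
  then show "\<exists>h \<in> carrier (Sp n). h * g = 1\<^sub>m ?N \<and> g * h = 1\<^sub>m ?N" using hg gh by blast
  have hJ: "h * ?J = ?J * transpose_mat g"
  proof -
    have "h * ?J = - (?J * (transpose_mat g * ?J) * ?J)"
      unfolding h_def using g by (subst uminus_mult_left_mat) auto
    also have "?J * (transpose_mat g * ?J) * ?J = ?J * (transpose_mat g * (?J * ?J))"
      using g J gT by (simp add: m)
    also have "transpose_mat g * (?J * ?J) = - transpose_mat g"
      unfolding sympl_form_sq using gT by (subst uminus_mult_right_mat) auto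
    also have "?J * (- transpose_mat g) = - (?J * transpose_mat g)"
      using J gT by (subst uminus_mult_right_mat) auto
    finally show ?thesis using J gT by simp
  qed
  show "g * ?J * transpose_mat g = ?J"
  proof -
    have "g * ?J * transpose_mat g = g * (?J * transpose_mat g)"
      using g J gT by (intro assoc_mult_mat[of _ ?N ?N _ ?N _ ?N]) auto
    also have "\<dots> = g * (h * ?J)" unfolding hJ ..
    also have "\<dots> = g * h * ?J" using g h J by (simp add: m)
    finally show ?thesis using gh J by simp
  qed
qed

lemma Sp_transpose: "g \<in> carrier (Sp n) \<Longrightarrow> transpose_mat g \<in> carrier (Sp n)"
  using Sp_inverse_exists(2)[of g n] by (auto simp: Sp_iff)

lemma Sp_mult: 
  assumes "g \<in> carrier (Sp n)" "h \<in> carrier (Sp n)"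
  shows "g * h \<in> carrier (Sp n)"
proof -
  let ?N = "2 * n" and ?J = "sympl_form n"
  note m = assoc_mult_mat[of _ ?N ?N _ ?N _ ?N] mult_carrier_mat[of _ ?N ?N _ ?N]
  have c: "?J \<in> carrier_mat ?N ?N" "g \<in> carrier_mat ?N ?N" "h \<in> carrier_mat ?N ?N"
    "transpose_mat g \<in> carrier_mat ?N ?N" "transpose_mat h \<in> carrier_mat ?N ?N"
    using assms by (auto simp: Sp_iff)
  have "transpose_mat (g * h) * ?J * (g * h) = transpose_mat h * (transpose_mat g * ?J * g) * h"
    unfolding transpose_mult[OF c(2,3)] using c by (simp add: m)
  also have "\<dots> = ?J" using assms by (simp add: Sp_iff)
  finally show ?thesis using c by (simp add: Sp_iff)
qed

lemma Sp_mult_eq [simp]: "g \<otimes>\<^bsub>Sp n\<^esub> h = g * h" and Sp_one [simp]: "\<one>\<^bsub>Sp n\<^esub> = 1\<^sub>m (2 * n)"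
  by (simp_all add: Sp_def)

lemma Sp_one_closed: "1\<^sub>m (2 * n) \<in> carrier (Sp n)"
  by (simp add: Sp_iff)

lemma group_Sp: "group (Sp n)"
proof (rule groupI)
  fix x y z assume "x \<in> carrier (Sp n)" "y \<in> carrier (Sp n)" "z \<in> carrier (Sp n)"
  then show "x \<otimes>\<^bsub>Sp n\<^esub> y \<otimes>\<^bsub>Sp n\<^esub> z = x \<otimes>\<^bsub>Sp n\<^esub> (y \<otimes>\<^bsub>Sp n\<^esub> z)"
    by (auto simp: Sp_iff intro!: assoc_mult_mat)
next
  fix x assume "x \<in> carrier (Sp n)"
  then show "\<exists>y\<in>carrier (Sp n). y \<otimes>\<^bsub>Sp n\<^esub> x = \<one>\<^bsub>Sp n\<^esub>"
    using Sp_inverse_exists(1)[of x n] by auto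
  show "\<one>\<^bsub>Sp n\<^esub> \<otimes>\<^bsub>Sp n\<^esub> x = x" using \<open>x \<in> carrier (Sp n)\<close> by (auto simp: Sp_iff)
qed (simp_all add: Sp_mult Sp_one_closed)

lemma Sp_inv_eqI:
  "g \<in> carrier (Sp n) \<Longrightarrow> h \<in> carrier (Sp n) \<Longrightarrow> h * g = 1\<^sub>m (2 * n) \<Longrightarrow> inv\<^bsub>Sp n\<^esub> g = h"
  by (rule group.inv_equality[OF group_Sp]) simp_all

lemma x_sub_Sp: "i \<in> {1..n} \<Longrightarrow> x_sub n i t \<in> carrier (Sp n)"
  by (simp add: x_sub_eq Sp_transpose y_sub_Sp)

lemma y_sub_inverse:
  assumes "i \<in> {1..n}"
  shows "y_sub n i (- t) * y_sub n i t = 1\<^sub>m (2 * n)"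
proof (rule eq_matI)
  fix a b assume "a < dim_row (1\<^sub>m (2 * n) :: complex mat)" "b < dim_col (1\<^sub>m (2 * n) :: complex mat)"
  then have ab: "a < 2 * n" "b < 2 * n" by auto
  show "(y_sub n i (- t) * y_sub n i t) $$ (a, b) = 1\<^sub>m (2 * n) $$ (a, b)"
  proof (cases "a = i \<or> a = 2 * n - i")
    case True
    then obtain a' where a': "a = Suc a'" using assms ab by (cases a) auto
    have "y_sub n i t $$ (a', b) = (if a' = b then 1 else 0)"
      using ab a' True not_consecutive[OF assms, of b] assms by (auto simp: y_sub_index)
    moreover have "y_sub n i t $$ (a, b) = (if a = b then 1 else if a' = b then t else 0)"
      using ab a' True assms by (auto simp: y_sub_index)
    ultimately show ?thesis
      using ab a' True assms by (simp add: y_sub_mult_index del: index_mult_mat(1))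
  next
    case False
    then show ?thesis
      using ab assms by (simp add: y_sub_mult_index y_sub_index del: index_mult_mat(1))
  qed
qed (use assms in simp_all)

lemma y_sub_inv: "i \<in> {1..n} \<Longrightarrow> inv\<^bsub>Sp n\<^esub> (y_sub n i t) = y_sub n i (- t)"
  by (intro Sp_inv_eqI y_sub_Sp y_sub_inverse)

section \<open>Gauss decomposition\<close>

lemma y_subs_Sp: "{y_sub n i t | i t. i \<in> {Suc r..n}} \<subseteq> carrier (Sp n)"
  by (auto intro!: y_sub_Sp)

text \<open>The lower unipotent group of the smaller symplectic group on the positions r, ..., 2n -
  r - 1. It fixes the outer basis vectors, so stage r of the elimination keeps what is already
  cleared.\<close>

definition lower_from :: "nat \<Rightarrow> nat \<Rightarrow> complex mat set" where
  "lower_from n r = generate (Sp n) {y_sub n i t | i t. i \<in> {Suc r..n}}"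

lemma U_minus_eq: "U_minus n = lower_from n 0"
  by (simp add: U_minus_def lower_from_def)

lemma subgroup_lower_from: "subgroup (lower_from n r) (Sp n)"
  unfolding lower_from_def by (rule group.generate_is_subgroup[OF group_Sp y_subs_Sp])

lemma lower_from_Sp: "u \<in> lower_from n r \<Longrightarrow> u \<in> carrier (Sp n)"
  using subgroup.mem_carrier[OF subgroup_lower_from] .

lemma lower_from_carrier_mat: "u \<in> lower_from n r \<Longrightarrow> u \<in> carrier_mat (2 * n) (2 * n)"
  using lower_from_Sp Sp_carrier_mat by blast

lemma lower_from_mult: "u \<in> lower_from n r \<Longrightarrow> v \<in> lower_from n r \<Longrightarrow> u * v \<in> lower_from n r"
  using subgroup.m_closed[OF subgroup_lower_from] by simp

lemma lower_from_one: "1\<^sub>m (2 * n) \<in> lower_from n r"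
  using subgroup.one_closed[OF subgroup_lower_from[of n r]] by simp

lemma lower_from_inverse:
  "u \<in> lower_from n r \<Longrightarrow> \<exists>v \<in> lower_from n r. v * u = 1\<^sub>m (2 * n) \<and> u * v = 1\<^sub>m (2 * n)"
  using subgroup.m_inv_closed[OF subgroup_lower_from] group.l_inv[OF group_Sp, of u n]
    group.r_inv[OF group_Sp, of u n] lower_from_Sp[of u n r] by fastforce

lemma lower_from_mono: "r \<le> s \<Longrightarrow> lower_from n s \<subseteq> lower_from n r"
  unfolding lower_from_def by (rule group.mono_generate[OF group_Sp]) auto

lemma y_sub_lower_from: "i \<in> {Suc r..n} \<Longrightarrow> y_sub n i t \<in> lower_from n r"
  unfolding lower_from_def by (rule generate.incl) auto

lemma lower_from_induct [consumes 1, case_names one gen mult]: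
  assumes "u \<in> lower_from n r" and "P (1\<^sub>m (2 * n))"
    and gen: "\<And>i t. i \<in> {Suc r..n} \<Longrightarrow> P (y_sub n i t)"
    and "\<And>u v. u \<in> lower_from n r \<Longrightarrow> v \<in> lower_from n r \<Longrightarrow> P u \<Longrightarrow> P v \<Longrightarrow> P (u * v)"
  shows "P u"
  using assms(1) unfolding lower_from_def
proof (induction rule: generate.induct)
  case (inv h)
  then obtain i t where "h = y_sub n i t" "i \<in> {Suc r..n}" by auto
  then show ?case using y_sub_inv[of i n t] gen[of i "- t"] by simp
qed (use assms in \<open>auto simp: lower_from_def\<close>)

lemma lower_from_triangular:
  assumes "u \<in> lower_from n r"
  shows "a \<le> b \<Longrightarrow> b < 2 * n \<Longrightarrow> u $$ (a, b) = (if a = b then 1 else 0)"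
  using assms
proof (induction arbitrary: a b rule: lower_from_induct)
  case (gen i t)
  then show ?case by (simp add: y_sub_index)
next
  case (mult u v)
  have "(u * v) $$ (a, b) = (\<Sum>l<2 * n. u $$ (a, l) * v $$ (l, b))"
    using mult.prems mult.hyps by (intro mult_index) (auto intro: lower_from_carrier_mat)
  also have "\<dots> = (\<Sum>l<2 * n. if l = a then (if a = b then 1 else 0) else 0)"
  proof (rule sum.cong[OF refl])
    fix l assume "l \<in> {..<2 * n}"
    then show "u $$ (a, l) * v $$ (l, b) = (if l = a then (if a = b then 1 else 0) else 0)"
      using mult.IH(1)[of a l] mult.IH(2)[of l b] mult.prems by (cases "a \<le> l") auto
  qed
  finally show ?case using mult.prems by simp
qed simp

lemma lower_from_lminor: "u \<in> lower_from n r \<Longrightarrow> k \<le> 2 * n \<Longrightarrow> lminor k u = 1"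
  by (subst lminor_lower_triangular) (auto simp: lower_from_triangular)

lemma lower_from_outer:
  assumes "u \<in> lower_from n r" "a < 2 * n" "b < 2 * n"
    "a < r \<or> 2 * n - r \<le> a \<or> b < r \<or> 2 * n - r \<le> b"
  shows "u $$ (a, b) = (if a = b then 1 else 0)"
  using assms
proof (induction arbitrary: a b rule: lower_from_induct)
  case (gen i t)
  then show ?case by (auto simp: y_sub_index)
next
  case (mult u v)
  have "(u * v) $$ (a, b) = (\<Sum>l<2 * n. u $$ (a, l) * v $$ (l, b))"
    using mult.prems mult.hyps by (intro mult_index) (auto intro: lower_from_carrier_mat)
  also have "\<dots> = (\<Sum>l<2 * n. if l = a then (if a = b then 1 else 0) else 0)"
  proof (rule sum.cong[OF refl])
    fix l assume l: "l \<in> {..<2 * n}"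
    show "u $$ (a, l) * v $$ (l, b) = (if l = a then (if a = b then 1 else 0) else 0)"
    proof (cases "a < r \<or> 2 * n - r \<le> a")
      case True
      then show ?thesis using mult.IH(1)[of a l] mult.IH(2)[of a b] mult.prems l by auto
    next
      case False
      then show ?thesis using mult.IH(1)[of a b] mult.IH(2)[of l b] mult.prems l by auto
    qed
  qed
  finally show ?case using mult.prems by simp
qed simp

section \<open>Transitivity on vectors with leading entry 1\<close>

definition act :: "nat \<Rightarrow> complex mat \<Rightarrow> (nat \<Rightarrow> complex) \<Rightarrow> nat \<Rightarrow> complex" where
  "act n u v a = (if a < 2 * n then \<Sum>l<2 * n. u $$ (a, l) * v l else 0)"

lemma act_mult:
  assumes "u \<in> carrier_mat (2 * n) (2 * n)" "u' \<in> carrier_mat (2 * n) (2 * n)"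
  shows "act n u (act n u' v) = act n (u * u') v"
proof
  fix a
  have "(\<Sum>l<2 * n. u $$ (a, l) * (\<Sum>m<2 * n. u' $$ (l, m) * v m)) =
      (\<Sum>l<2 * n. (u * u') $$ (a, l) * v l)" if "a < 2 * n"
  proof -
    have "(\<Sum>l<2 * n. u $$ (a, l) * (\<Sum>m<2 * n. u' $$ (l, m) * v m)) =
        (\<Sum>l<2 * n. \<Sum>m<2 * n. u $$ (a, l) * u' $$ (l, m) * v m)"
      by (simp add: sum_distrib_left mult.assoc)
    also have "\<dots> = (\<Sum>m<2 * n. (\<Sum>l<2 * n. u $$ (a, l) * u' $$ (l, m)) * v m)"
      by (subst sum.swap) (simp add: sum_distrib_right)
    also have "\<dots> = (\<Sum>m<2 * n. (u * u') $$ (a, m) * v m)"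
      using assms that by (intro sum.cong refl) (subst mult_index[OF assms], auto)
    finally show ?thesis .
  qed
  then show "act n u (act n u' v) a = act n (u * u') v a" by (simp add: act_def)
qed

lemma act_one:
  assumes "\<And>a. 2 * n \<le> a \<Longrightarrow> v a = 0"
  shows "act n (1\<^sub>m (2 * n)) v = v"
proof
  fix a
  have "(\<Sum>l<2 * n. 1\<^sub>m (2 * n) $$ (a, l) * v l) = (\<Sum>l<2 * n. if l = a then v a else 0)" if "a < 2 * n"
    using that by (intro sum.cong) auto
  then show "act n (1\<^sub>m (2 * n)) v a = v a" using assms[of a] by (simp add: act_def)
qed

lemma act_y_sub:
  assumes "i \<in> {1..n}"
  shows "act n (y_sub n i t) v a =
    (if a < 2 * n then v a + (if a = i \<or> a = 2 * n - i then t * v (a - 1) else 0) else 0)"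
proof -
  have "(\<Sum>l<2 * n. y_sub n i t $$ (a, l) * v l) = (\<Sum>l<2 * n. (if l = a then v a else 0) +
      (if l = a - 1 then if a = i \<or> a = 2 * n - i then t * v (a - 1) else 0 else 0))" if "a < 2 * n"
    using assms that by (intro sum.cong) (auto simp: y_sub_index)
  moreover have "a < 2 * n \<Longrightarrow> a - 1 < 2 * n" by simp
  ultimately show ?thesis by (simp add: act_def sum.distrib)
qed

text \<open>The support condition makes the relation symmetric, since \<open>act\<close> sets all
  positions from 2n on to 0.\<close>

definition same_orbit :: "nat \<Rightarrow> nat \<Rightarrow> (nat \<Rightarrow> complex) \<Rightarrow> (nat \<Rightarrow> complex) \<Rightarrow> bool" where
  "same_orbit n r v v' \<longleftrightarrow> (\<forall>a\<ge>2 * n. v a = 0) \<and> (\<exists>u \<in> lower_from n r. act n u v = v')"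

lemma same_orbitI:
  "u \<in> lower_from n r \<Longrightarrow> act n u v = v' \<Longrightarrow> (\<And>a. 2 * n \<le> a \<Longrightarrow> v a = 0) \<Longrightarrow> same_orbit n r v v'"
  by (auto simp: same_orbit_def)

lemma same_orbit_trans:
  assumes "same_orbit n r u v" "same_orbit n r v w"
  shows "same_orbit n r u w"
proof -
  obtain g h where g: "g \<in> lower_from n r" "act n g u = v" and h: "h \<in> lower_from n r" "act n h v = w"
    using assms by (auto simp: same_orbit_def)
  have "act n (h * g) u = w"
    unfolding h(2)[symmetric] g(2)[symmetric]
    by (rule act_mult[symmetric]) (use g h in \<open>auto intro: lower_from_carrier_mat\<close>)
  then show ?thesis
    using lower_from_mult[OF h(1) g(1)] assms(1) by (auto simp: same_orbit_def)
qed

lemma same_orbit_sym: 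
  assumes "same_orbit n r v v'"
  shows "same_orbit n r v' v"
proof -
  obtain u where u: "u \<in> lower_from n r" "act n u v = v'" "\<And>a. 2 * n \<le> a \<Longrightarrow> v a = 0"
    using assms by (auto simp: same_orbit_def)
  obtain u' where u': "u' \<in> lower_from n r" "u' * u = 1\<^sub>m (2 * n)"
    using lower_from_inverse[OF u(1)] by auto
  show ?thesis
  proof (rule same_orbitI[OF u'(1)])
    show "act n u' v' = v"
      unfolding u(2)[symmetric]
      using lower_from_carrier_mat[OF u(1)] lower_from_carrier_mat[OF u'(1)] u(3) u'(2)
      by (simp add: act_mult act_one)
  qed (simp add: u(2)[symmetric] act_def)
qed

definition unit_at :: "nat \<Rightarrow> nat \<Rightarrow> complex" where
  "unit_at r a = (if a = r then 1 else 0)"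

text \<open>The inner coordinates of \<open>v\<close> are cleared by the smaller group, which moves \<open>e\<^sub>r\<^sub>+\<^sub>1\<close> to an
  arbitrary vector with the same leading coordinate and fixes the outer basis vectors.\<close>

lemma same_orbit_clear_inner:
  assumes IH: "\<And>v. v (Suc r) = 1 \<Longrightarrow> (\<And>a. a < Suc r \<or> 2 * n - Suc r \<le> a \<Longrightarrow> v a = 0) \<Longrightarrow>
      same_orbit n (Suc r) (unit_at (Suc r)) v"
    and r: "Suc r < n" and supp: "\<And>a. 2 * n \<le> a \<Longrightarrow> v a = 0" and nz: "v (Suc r) \<noteq> 0"
  shows "same_orbit n r v
    (\<lambda>a. if a = Suc r \<or> a < Suc r \<or> 2 * n - Suc r \<le> a then v a else 0)" (is "same_orbit n r v ?b")
proof -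
  define w where "w a = (if a < Suc r \<or> 2 * n - Suc r \<le> a then 0 else v a / v (Suc r))" for a
  have "w (Suc r) = 1" using r nz by (simp add: w_def)
  then obtain q where q: "q \<in> lower_from n (Suc r)" "act n q (unit_at (Suc r)) = w"
    using IH[of w] by (auto simp: w_def same_orbit_def)
  have "act n q ?b = v"
  proof
    fix a
    show "act n q ?b a = v a"
    proof (cases "a < 2 * n")
      case True
      have "act n q ?b a = (\<Sum>l<2 * n. v (Suc r) * (q $$ (a, l) * unit_at (Suc r) l) +
          (if l = a then if a < Suc r \<or> 2 * n - Suc r \<le> a then v a else 0 else 0))"
        unfolding act_def using True r
        by (auto intro!: sum.cong simp: unit_at_def lower_from_outer[OF q(1)])
      also have "\<dots> = v (Suc r) * act n q (unit_at (Suc r)) a +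
          (if a < Suc r \<or> 2 * n - Suc r \<le> a then v a else 0)"
        using True by (simp add: sum.distrib act_def sum_distrib_left)
      also have "\<dots> = v a" unfolding q(2) using nz by (simp add: w_def)
      finally show ?thesis .
    qed (simp add: supp act_def)
  qed
  then have "same_orbit n r ?b v"
    using q(1) lower_from_mono[of r "Suc r" n] supp r by (intro same_orbitI[of q]) auto
  then show ?thesis by (rule same_orbit_sym)
qed

lemma same_orbit_y_sub:
  "i \<in> {Suc r..n} \<Longrightarrow> (\<And>a. 2 * n \<le> a \<Longrightarrow> v a = 0) \<Longrightarrow> same_orbit n r v (act n (y_sub n i t) v)"
  by (rule same_orbitI[OF y_sub_lower_from]) auto

text \<open>Downward induction on r. Among the generators only \<open>y_sub n (Suc r)\<close>
  changes the last coordinate 2n - r - 1, by a multiple of its neighbour 2n - r - 2, and it changes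
  coordinate r + 1 as well. So the pivot at r + 1 is made 1, the inner coordinates are cleared, an
  auxiliary value is put at the neighbour, and the last coordinate is removed with its help. What
  remains is reached from e_r by a single \<open>y_sub n (Suc r)\<close>.\<close>

lemma orbit_unit_at:
  assumes "r < n" "v r = 1" "\<And>a. a < r \<or> 2 * n - r \<le> a \<Longrightarrow> v a = 0"
  shows "same_orbit n r (unit_at r) v"
proof -
  have "r \<le> n - 1" using assms by simp
  then show ?thesis
    using assms(2,3)
  proof (induction r arbitrary: v rule: inc_induct)
    case base
    have "act n (y_sub n n (v n)) (unit_at (n - 1)) = v"
    proof
      fix a
      have "v a = 0" if "a \<noteq> n - 1" "a \<noteq> n"
        by (rule base.prems(2)) (use that assms(1) in auto)
      then show "act n (y_sub n n (v n)) (unit_at (n - 1)) a = v a"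
        using assms(1) base.prems
        by (cases "a = n - 1"; cases "a = n") (auto simp: act_y_sub unit_at_def)
    qed
    show ?case
    proof (rule same_orbitI[OF y_sub_lower_from \<open>act n _ _ = v\<close>])
      show "n \<in> {Suc (n - 1)..n}" using assms(1) by simp
      show "unit_at (n - 1) a = 0" if "2 * n \<le> a" for a
        using that assms(1) by (simp add: unit_at_def)
    qed
  next
    case (step r)
    let ?i = "Suc r" and ?e = "2 * n - Suc r" and ?f = "2 * n - Suc (Suc r)"
    have r: "Suc r < n" using step.hyps by simp
    have i: "?i \<in> {1..n}" "?i \<in> {Suc r..n}" using r by auto
    have ef: "?f = ?e - 1" "?i < ?f" "?f < ?e" "?e < 2 * n" using r by auto
    have supp: "v a = 0" if "2 * n \<le> a" for a by (rule step.prems(2)) (use that in linarith)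
    have clear: "same_orbit n r w
        (\<lambda>a. if a = Suc r \<or> a < Suc r \<or> 2 * n - Suc r \<le> a then w a else 0)"
      if "\<And>a. 2 * n \<le> a \<Longrightarrow> w a = 0" "w (Suc r) \<noteq> 0" for w
      using same_orbit_clear_inner[of r n w] step.IH r that by blast
    define v1 where "v1 = act n (y_sub n ?i (1 - v ?i)) v"
    define \<nu> where "\<nu> = v1 ?e"
    \<comment> \<open>Removing the last coordinate \<nu> by means of its neighbour \<mu> requires s
      \<mu> = \<nu>. The same step turns the pivot 1 into 1 - s, which must not vanish if the inner
      coordinates are to be cleared again; hence the exception for \<nu> = 1.\<close>
    define \<mu> where "\<mu> = (if \<nu> = 1 then 2 else 1 :: complex)"
    define s where "s = \<nu> / \<mu>"
    have \<mu>: "\<mu> \<noteq> 0" "s \<noteq> 1" "s * \<mu> = \<nu>" by (auto simp: s_def \<mu>_def)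
    define v2 where "v2 a = (if a = r \<or> a = ?i then 1 else if a = ?e then \<nu> else if a = ?f then \<mu> else 0)" for a
    define v3 where "v3 = act n (y_sub n ?i (- s)) v2"
    have o1: "same_orbit n r v v1" unfolding v1_def by (rule same_orbit_y_sub[OF i(2) supp])
    have v1: "v1 r = 1" "v1 ?i = 1" "\<And>a. a < r \<or> 2 * n - r \<le> a \<Longrightarrow> v1 a = 0"
      unfolding v1_def using step.prems r by (auto simp: act_y_sub[OF i(1)])
    have "same_orbit n r v1 (\<lambda>a. if a = Suc r \<or> a < Suc r \<or> 2 * n - Suc r \<le> a then v1 a else 0)"
      by (rule clear) (use v1 in \<open>auto intro!: v1(3)\<close>)
    also have eq: "(\<lambda>a. if a = Suc r \<or> a < Suc r \<or> 2 * n - Suc r \<le> a then v1 a else 0) =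
        (\<lambda>a. if a = Suc r \<or> a < Suc r \<or> 2 * n - Suc r \<le> a then v2 a else 0)"
    proof -
      have "v1 a = v2 a" if "a = Suc r \<or> a < Suc r \<or> 2 * n - Suc r \<le> a" for a
      proof -
        have "a < r \<or> a = r \<or> a = Suc r \<or> a = ?e \<or> 2 * n - r \<le> a" using that r by linarith
        then consider "a < r" | "a = r" | "a = Suc r" | "a = ?e" | "2 * n - r \<le> a" by blast
        then show ?thesis
        proof cases
          case 1
          then have "v1 a = 0" by (intro v1(3)) simp
          moreover have "a \<noteq> ?e" "a \<noteq> ?f" using 1 r by linarith+
          ultimately show ?thesis using 1 by (simp add: v2_def)
        next
          case 4
          have "?e \<noteq> r" "?e \<noteq> Suc r" using r by linarith+
          then show ?thesis using 4 by (simp add: v2_def \<nu>_def)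
        next
          case 5
          then have "v1 a = 0" by (intro v1(3)) simp
          moreover have "a \<noteq> r" "a \<noteq> Suc r" "a \<noteq> ?e" "a \<noteq> ?f" using 5 r by linarith+
          ultimately show ?thesis by (simp add: v2_def)
        qed (use v1 in \<open>simp_all add: v2_def\<close>)
      qed
      then show ?thesis by auto
    qed
    finally have o2: "same_orbit n r v1 (\<lambda>a. if a = Suc r \<or> a < Suc r \<or> 2 * n - Suc r \<le> a then v2 a else 0)" .
    \<comment> \<open>\<open>v1\<close> and \<open>v2\<close> agree outside the inner block, so both
      clear to the same vector; in this way \<mu> is inserted.\<close>
    have o3: "same_orbit n r v2 (\<lambda>a. if a = Suc r \<or> a < Suc r \<or> 2 * n - Suc r \<le> a then v2 a else 0)"
      by (rule clear) (use r in \<open>auto simp: v2_def\<close>)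
    have o4: "same_orbit n r v2 v3" unfolding v3_def
      by (rule same_orbit_y_sub[OF i(2)]) (use r in \<open>auto simp: v2_def\<close>)
    have v3: "v3 a = (if a = r then 1 else if a = ?i then 1 - s else if a = ?f then \<mu> else 0)" for a
      unfolding v3_def act_y_sub[OF i(1)] v2_def using ef r \<mu>(3) by auto
    have "same_orbit n r v3 (\<lambda>a. if a = Suc r \<or> a < Suc r \<or> 2 * n - Suc r \<le> a then v3 a else 0)"
      by (rule clear) (use ef \<mu>(2) r in \<open>auto simp: v3\<close>)
    also have "(\<lambda>a. if a = Suc r \<or> a < Suc r \<or> 2 * n - Suc r \<le> a then v3 a else 0) =
        (\<lambda>a. if a = r then 1 else if a = ?i then 1 - s else 0)"
      using ef by (intro ext) (auto simp: v3)
    finally have o5: "same_orbit n r v3 (\<lambda>a. if a = r then 1 else if a = ?i then 1 - s else 0)" .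
    have "act n (y_sub n ?i (1 - s)) (unit_at r) = (\<lambda>a. if a = r then 1 else if a = ?i then 1 - s else 0)"
      using ef r by (intro ext) (auto simp: act_y_sub[OF i(1)] unit_at_def)
    then have o6: "same_orbit n r (unit_at r) (\<lambda>a. if a = r then 1 else if a = ?i then 1 - s else 0)"
      using same_orbit_y_sub[OF i(2), of "unit_at r" "1 - s"] r by (auto simp: unit_at_def)
    show ?case
      by (intro same_orbit_trans[OF o6] same_orbit_trans[OF same_orbit_sym[OF o5]]
          same_orbit_trans[OF same_orbit_sym[OF o4]] same_orbit_trans[OF o3]
          same_orbit_trans[OF same_orbit_sym[OF o2]] same_orbit_sym[OF o1])
  qed
qed

lemma lower_from_column:
  assumes "r < n" "v r = 1" "\<And>a. a < r \<or> 2 * n - r \<le> a \<Longrightarrow> v a = 0"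
  shows "\<exists>u \<in> lower_from n r. \<forall>a<2 * n. u $$ (a, r) = v a"
proof -
  obtain u where u: "u \<in> lower_from n r" "act n u (unit_at r) = v"
    using orbit_unit_at[of r n v] assms by (auto simp: same_orbit_def)
  have "u $$ (a, r) = v a" if "a < 2 * n" for a
  proof -
    have "(\<Sum>l<2 * n. u $$ (a, l) * unit_at r l) = (\<Sum>l<2 * n. if l = r then u $$ (a, r) else 0)"
      by (intro sum.cong) (auto simp: unit_at_def)
    then show ?thesis using assms(1) that unfolding u(2)[symmetric] by (simp add: act_def)
  qed
  then show ?thesis using u by blast
qed

section \<open>Elimination of columns and rows\<close>

definition outer_diag :: "nat \<Rightarrow> nat \<Rightarrow> complex mat \<Rightarrow> bool" where
  "outer_diag n r h \<longleftrightarrow> (\<forall>a<2 * n. \<forall>b<2 * n.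
     a \<noteq> b \<longrightarrow> a < r \<or> 2 * n - r \<le> a \<or> b < r \<or> 2 * n - r \<le> b \<longrightarrow> h $$ (a, b) = 0)"

lemma outer_diag_transpose:
  "h \<in> carrier_mat (2 * n) (2 * n) \<Longrightarrow> outer_diag n r h \<Longrightarrow> outer_diag n r (transpose_mat h)"
  by (auto simp: outer_diag_def)

text \<open>Take an element of the smaller group whose column r is that of h divided by the pivot,
  and apply its inverse. Row r survives because row r of every element of
  \<open>lower_from n r\<close> is a unit vector.\<close>

lemma column_elimination:
  assumes h: "h \<in> carrier_mat (2 * n) (2 * n)" "outer_diag n r h" and r: "r < n"
    and nz: "h $$ (r, r) \<noteq> 0"
  shows "\<exists>u \<in> lower_from n r. outer_diag n r (u * h) \<and>
    (\<forall>a<2 * n. a \<noteq> r \<longrightarrow> (u * h) $$ (a, r) = 0) \<and> (\<forall>b<2 * n. (u * h) $$ (r, b) = h $$ (r, b))"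
proof -
  define v where "v a = (if a < 2 * n then h $$ (a, r) / h $$ (r, r) else 0)" for a
  have "v r = 1" using r nz by (simp add: v_def)
  moreover have "v a = 0" if "a < r \<or> 2 * n - r \<le> a" for a
    using h(2) r that by (auto simp: v_def outer_diag_def)
  ultimately obtain u where u: "u \<in> lower_from n r" "\<And>a. a < 2 * n \<Longrightarrow> u $$ (a, r) = v a"
    using lower_from_column[OF r] by blast
  obtain u' where u': "u' \<in> lower_from n r" "u' * u = 1\<^sub>m (2 * n)"
    using lower_from_inverse[OF u(1)] by blast
  have r2: "r < 2 * n" using r by simp
  have idx: "(u' * h) $$ (a, b) = (\<Sum>l<2 * n. u' $$ (a, l) * h $$ (l, b))" if "a < 2 * n" "b < 2 * n" for a b
    using u' h that by (intro mult_index) (auto intro: lower_from_carrier_mat)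
  have "(u' * h) $$ (a, b) = 0"
    if ab: "a < 2 * n" "b < 2 * n" "a \<noteq> b" "a < r \<or> 2 * n - r \<le> a \<or> b < r \<or> 2 * n - r \<le> b" for a b
  proof -
    have "u' $$ (a, l) * h $$ (l, b) = 0" if l: "l < 2 * n" for l
    proof (cases "b < r \<or> 2 * n - r \<le> b")
      case True
      then have "l \<noteq> b \<Longrightarrow> h $$ (l, b) = 0" using h(2) ab l by (auto simp: outer_diag_def)
      then show ?thesis using lower_from_outer[OF u'(1), of a b] ab True by auto
    next
      case False
      then have out: "a < r \<or> 2 * n - r \<le> a" using ab by blast
      then have "h $$ (a, b) = 0" using h(2) ab by (auto simp: outer_diag_def)
      then show ?thesis using lower_from_outer[OF u'(1), of a l] ab l out by auto
    qed
    then show ?thesis unfolding idx[OF ab(1,2)] by (intro sum.neutral) simp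
  qed
  moreover have "(u' * h) $$ (a, r) = 0" if a: "a < 2 * n" "a \<noteq> r" for a
  proof -
    have "(u' * h) $$ (a, r) = (\<Sum>l<2 * n. h $$ (r, r) * (u' $$ (a, l) * u $$ (l, r)))"
      unfolding idx[OF a(1) r2] using nz u(2) by (intro sum.cong) (auto simp: v_def)
    also have "\<dots> = h $$ (r, r) * (u' * u) $$ (a, r)"
      using a r u u' by (subst mult_index[of _ "2 * n"]) (auto intro: lower_from_carrier_mat simp: sum_distrib_left)
    finally show ?thesis using a r unfolding u'(2) by simp
  qed
  moreover have "(u' * h) $$ (r, b) = h $$ (r, b)" if b: "b < 2 * n" for b
  proof -
    have "u' $$ (r, l) * h $$ (l, b) = (if l = r then h $$ (r, b) else 0)" if "l < 2 * n" for l
      using lower_from_outer[OF u'(1), of r l] lower_from_triangular[OF u'(1), of r l] r that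
      by (cases "r \<le> l") auto
    then have "(\<Sum>l<2 * n. u' $$ (r, l) * h $$ (l, b)) = (\<Sum>l<2 * n. if l = r then h $$ (r, b) else 0)"
      by (intro sum.cong) auto
    then show ?thesis using idx[of r b] b r by (simp del: index_mult_mat(1))
  qed
  ultimately show ?thesis using u'(1) unfolding outer_diag_def by blast
qed

lemma mat_assoc:
  "A \<in> carrier_mat N N \<Longrightarrow> B \<in> carrier_mat N N \<Longrightarrow> C \<in> carrier_mat N N \<Longrightarrow> A * B * C = A * (B * C)"
  for A B C :: "complex mat"
  by (rule assoc_mult_mat)

lemma transpose_mult_sq:
  "A \<in> carrier_mat N N \<Longrightarrow> B \<in> carrier_mat N N \<Longrightarrow> transpose_mat (A * B) = transpose_mat B * transpose_mat A"
  for A B :: "complex mat"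
  by (rule transpose_mult)

lemma transpose_lower_from_U_plus:
  assumes "u \<in> lower_from n 0"
  shows "transpose_mat u \<in> U_plus n"
  using assms
proof (induction rule: lower_from_induct)
  case one
  then show ?case using generate.one[of "Sp n"] by (simp add: U_plus_def)
next
  case (gen i t)
  then have "transpose_mat (y_sub n i t) = x_sub n i t" by (simp add: x_sub_eq)
  then show ?case unfolding U_plus_def using gen by (intro generate.incl) auto
next
  case (mult u v)
  have "transpose_mat (u * v) = transpose_mat v * transpose_mat u"
    using mult.hyps by (intro transpose_mult_sq) (auto intro: lower_from_carrier_mat)
  then show ?case using generate.eng[OF mult.IH(2,1)[unfolded U_plus_def]] by (simp add: U_plus_def)
qed

lemma U_plus_transpose_lower_from:
  assumes "v \<in> U_plus n"
  shows "transpose_mat v \<in> lower_from n 0 \<and> v \<in> carrier_mat (2 * n) (2 * n)"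
  using assms unfolding U_plus_def
proof (induction rule: generate.induct)
  case one
  then show ?case by (simp add: lower_from_one)
next
  case (incl h)
  then obtain i t where "h = x_sub n i t" "i \<in> {1..n}" by auto
  then show ?case by (simp add: x_sub_eq y_sub_lower_from)
next
  case (inv h)
  then obtain i t where h: "h = x_sub n i t" and i: "i \<in> {1..n}" by auto
  have "inv\<^bsub>Sp n\<^esub> h = x_sub n i (- t)"
  proof (rule Sp_inv_eqI)
    have "x_sub n i (- t) * x_sub n i t = transpose_mat (y_sub n i t * y_sub n i (- t))"
      unfolding x_sub_eq[OF i] using i by (intro transpose_mult_sq[symmetric]) auto
    then show "x_sub n i (- t) * h = 1\<^sub>m (2 * n)" unfolding h using y_sub_inverse[OF i, of "- t"] by simp
  qed (use i x_sub_Sp h in auto)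
  then show ?case using i by (auto simp: x_sub_eq intro: y_sub_lower_from)
next
  case (eng h1 h2)
  then have "transpose_mat (h1 * h2) = transpose_mat h2 * transpose_mat h1"
    by (intro transpose_mult_sq) auto
  then show ?case using eng.IH by (auto intro: lower_from_mult)
qed

text \<open>Unitriangular factors preserve leading minors, so the pivots stay nonzero. Column r is
  cleared directly and row r by the same lemma for the transpose; the partner row and column 2n - 1
  - r then become diagonal by the symplectic relations, so n stages suffice.\<close>

lemma gauss_stage:
  assumes g: "g \<in> carrier (Sp n)" and nz: "\<And>k. k \<in> {1..n} \<Longrightarrow> lminor k g \<noteq> 0" and "r \<le> n"
  shows "\<exists>u \<in> lower_from n 0. \<exists>v \<in> lower_from n 0. outer_diag n r (u * g * transpose_mat v)"
  using \<open>r \<le> n\<close>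
proof (induction r)
  case 0
  have "outer_diag n 0 (1\<^sub>m (2 * n) * g * transpose_mat (1\<^sub>m (2 * n)))"
    by (auto simp: outer_diag_def)
  then show ?case using lower_from_one by blast
next
  case (Suc r)
  let ?N = "2 * n"
  have r: "r < n" using Suc.prems by simp
  have gc: "g \<in> carrier_mat ?N ?N" using g by (rule Sp_carrier_mat)
  obtain u v where u: "u \<in> lower_from n 0" and v: "v \<in> lower_from n 0"
    and od: "outer_diag n r (u * g * transpose_mat v)"
    using Suc.IH r by auto
  have uc: "u \<in> carrier_mat ?N ?N" and vc: "v \<in> carrier_mat ?N ?N"
    and vT: "transpose_mat v \<in> carrier_mat ?N ?N"
    using u v lower_from_carrier_mat by auto
  define h where "h = u * g * transpose_mat v"
  have ugc: "u * g \<in> carrier_mat ?N ?N" using uc gc by simp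
  have hc: "h \<in> carrier_mat ?N ?N" unfolding h_def using ugc vT by simp
  have "lminor (Suc r) h = lminor (Suc r) u * lminor (Suc r) g * lminor (Suc r) (transpose_mat v)"
  proof -
    have "lminor (Suc r) h = lminor (Suc r) (u * g) * lminor (Suc r) (transpose_mat v)"
      unfolding h_def using v vc r by (intro lminor_mult_right[OF ugc vT]) (auto simp: lower_from_triangular)
    moreover have "lminor (Suc r) (u * g) = lminor (Suc r) u * lminor (Suc r) g"
      using u r by (intro lminor_mult_left[OF uc gc]) (auto simp: lower_from_triangular)
    ultimately show ?thesis by simp
  qed
  then have "lminor (Suc r) h \<noteq> 0"
    using nz[of "Suc r"] r u v vc by (simp add: lminor_transpose[of _ ?N] lower_from_lminor)
  moreover have "lminor (Suc r) h = (\<Prod>a<Suc r. h $$ (a, a))"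
    using od r by (intro lminor_lower_triangular) (auto simp: outer_diag_def h_def[symmetric])
  ultimately have hrr: "h $$ (r, r) \<noteq> 0" by simp
  obtain u1 where u1: "u1 \<in> lower_from n r" "outer_diag n r (u1 * h)"
    "\<And>a. a < ?N \<Longrightarrow> a \<noteq> r \<Longrightarrow> (u1 * h) $$ (a, r) = 0" "\<And>b. b < ?N \<Longrightarrow> (u1 * h) $$ (r, b) = h $$ (r, b)"
    using column_elimination[OF hc _ r hrr] od unfolding h_def[symmetric] by blast
  define h1 where "h1 = u1 * h"
  have u1c: "u1 \<in> carrier_mat ?N ?N" using u1 lower_from_carrier_mat by auto
  have h1c: "h1 \<in> carrier_mat ?N ?N" unfolding h1_def using u1c hc by simp
  have h1rr: "transpose_mat h1 $$ (r, r) \<noteq> 0" using u1(4)[of r, folded h1_def] hrr r h1c by simp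
  obtain u2 where u2: "u2 \<in> lower_from n r" "outer_diag n r (u2 * transpose_mat h1)"
    "\<And>a. a < ?N \<Longrightarrow> a \<noteq> r \<Longrightarrow> (u2 * transpose_mat h1) $$ (a, r) = 0"
    "\<And>b. b < ?N \<Longrightarrow> (u2 * transpose_mat h1) $$ (r, b) = transpose_mat h1 $$ (r, b)"
    using column_elimination[OF _ outer_diag_transpose[OF h1c] r h1rr] u1(2) h1c
    unfolding h1_def[symmetric] by auto
  have u2c: "u2 \<in> carrier_mat ?N ?N" using u2 lower_from_carrier_mat by auto
  define h2 where "h2 = h1 * transpose_mat u2"
  have h2T: "transpose_mat h2 = u2 * transpose_mat h1"
    unfolding h2_def using transpose_mult_sq[OF h1c, of "transpose_mat u2"] u2c by simp
  have h2c: "h2 \<in> carrier_mat ?N ?N" unfolding h2_def using h1c u2c by simp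
  have od2: "outer_diag n r h2"
    using outer_diag_transpose[of "transpose_mat h2" n r] u2(2)[folded h2T] h2c by simp
  have row: "h2 $$ (r, b) = 0" if "b < ?N" "b \<noteq> r" for b
    using u2(3)[OF that] that r h2c unfolding h2T[symmetric] by simp
  have col: "h2 $$ (a, r) = 0" if "a < ?N" "a \<noteq> r" for a
    using u2(4)[of a] u1(3)[OF that] that r h2c h1c unfolding h2T[symmetric] h1_def[symmetric] by simp
  have sub: "lower_from n r \<subseteq> lower_from n 0" by (rule lower_from_mono) simp
  have w: "u1 * u \<in> lower_from n 0" "u2 * v \<in> lower_from n 0"
    using u v u1(1) u2(1) sub lower_from_mult by auto
  have h2: "h2 = (u1 * u) * g * transpose_mat (u2 * v)"
  proof -
    have "h2 = u1 * ((u * g) * transpose_mat v) * transpose_mat u2"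
      by (simp add: h2_def h1_def h_def)
    also have "\<dots> = u1 * (u * g) * (transpose_mat v * transpose_mat u2)"
      using u1c ugc vT u2c by (simp add: mat_assoc[of _ ?N] mult_carrier_mat[of _ ?N ?N])
    also have "u1 * (u * g) = u1 * u * g" using u1c uc gc by (simp add: mat_assoc[of _ ?N])
    finally show ?thesis using transpose_mult_sq[OF u2c vc] by simp
  qed
  have h2Sp: "h2 \<in> carrier (Sp n)"
    unfolding h2
    by (intro Sp_mult Sp_transpose g lower_from_Sp[OF w(1)] lower_from_Sp[OF w(2)])
  have diag0: "h2 $$ (r, r) \<noteq> 0"
    using u2(4)[of r] h1rr r h2c unfolding h2T[symmetric] by simp
  \<comment> \<open>Column r has one nonzero entry, so its pairing with column b is a single
    product; being 0, it forces the partner entry to vanish.\<close>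
  have last: "k $$ (?N - 1 - r, b) = 0"
    if k: "k \<in> carrier (Sp n)" "k $$ (r, r) \<noteq> 0" "\<And>a. a < ?N \<Longrightarrow> a \<noteq> r \<Longrightarrow> k $$ (a, r) = 0"
      and b: "b < ?N" "b \<noteq> ?N - 1 - r" for k b
  proof -
    have "(\<Sum>l<?N. (- 1) ^ l * k $$ (l, r) * k $$ (?N - 1 - l, b)) = 0"
      using k(1) b r Sp_iff_index[OF Sp_carrier_mat[OF k(1)]] by auto
    moreover have "(\<Sum>l<?N. (- 1) ^ l * k $$ (l, r) * k $$ (?N - 1 - l, b)) =
        (\<Sum>l<?N. if l = r then (- 1) ^ r * k $$ (r, r) * k $$ (?N - 1 - r, b) else 0)"
      using k(3) by (intro sum.cong) auto
    ultimately show ?thesis using k(2) r by simp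
  qed
  have "h2 $$ (a, b) = 0"
    if ab: "a < ?N" "b < ?N" "a \<noteq> b" "a < Suc r \<or> ?N - Suc r \<le> a \<or> b < Suc r \<or> ?N - Suc r \<le> b" for a b
  proof -
    have "(a < r \<or> ?N - r \<le> a \<or> b < r \<or> ?N - r \<le> b) \<or> a = r \<or> b = r \<or> a = ?N - 1 - r \<or> b = ?N - 1 - r"
      using ab r by linarith
    then consider "a < r \<or> ?N - r \<le> a \<or> b < r \<or> ?N - r \<le> b" | "a = r" | "b = r"
      | "a = ?N - 1 - r" | "b = ?N - 1 - r" by blast
    then show ?thesis
    proof cases
      case 1
      then show ?thesis using od2 ab by (auto simp: outer_diag_def)
    next
      case 4
      then show ?thesis using last[OF h2Sp diag0 col] ab by auto
    next
      case 5
      have "transpose_mat h2 $$ (?N - 1 - r, a) = 0"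
      proof (rule last[OF Sp_transpose[OF h2Sp]])
        show "transpose_mat h2 $$ (r, r) \<noteq> 0" using diag0 h2c r by simp
        show "transpose_mat h2 $$ (a, r) = 0" if "a < ?N" "a \<noteq> r" for a
          using row[OF that] that h2c r by simp
      qed (use ab 5 in auto)
      then show ?thesis using 5 ab h2c by simp
    qed (use row col ab in auto)
  qed
  then have "outer_diag n (Suc r) h2" unfolding outer_diag_def by blast
  then show ?case using w h2 by blast
qed

section \<open>Diagonal elements, the torus and fundamental weights\<close>

definition diagonal :: "nat \<Rightarrow> complex mat \<Rightarrow> bool" where
  "diagonal n h \<longleftrightarrow> (\<forall>a<2 * n. \<forall>b<2 * n. a \<noteq> b \<longrightarrow> h $$ (a, b) = 0)"

lemma diagonal_lminor_Suc:
  "diagonal n h \<Longrightarrow> k < 2 * n \<Longrightarrow> lminor (Suc k) h = lminor k h * h $$ (k, k)"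
  by (simp add: lminor_lower_triangular diagonal_def)

lemma lminor_0 [simp]: "lminor 0 g = 1"
  by (simp add: lminor_def)

text \<open>Quotients of consecutive leading minors give the first n diagonal entries, and the form
  makes the remaining ones their inverses.\<close>

lemma diagonal_Sp_eqI:
  assumes g: "g \<in> carrier (Sp n)" "diagonal n g" and h: "h \<in> carrier (Sp n)" "diagonal n h"
    and eq: "\<And>k. k \<in> {1..n} \<Longrightarrow> lminor k g = lminor k h" and nz: "\<And>k. k \<in> {1..n} \<Longrightarrow> lminor k g \<noteq> 0"
  shows "g = h"
proof -
  have low: "g $$ (a, a) = h $$ (a, a)" if "a < n" for a
  proof -
    have eq': "lminor a g = lminor a h" "lminor a g \<noteq> 0" using eq[of a] nz[of a] that by (cases a; simp)+
    then show ?thesis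
      using diagonal_lminor_Suc[OF g(2), of a] diagonal_lminor_Suc[OF h(2), of a] eq[of "Suc a"] that by simp
  qed
  have opp: "k $$ (2 * n - 1 - a, 2 * n - 1 - a) = 1 / k $$ (a, a)"
    if k: "k \<in> carrier (Sp n)" "diagonal n k" and a: "a < n" for k a
  proof -
    let ?b = "2 * n - 1 - a"
    have "(\<Sum>l<2 * n. (- 1) ^ l * k $$ (l, a) * k $$ (2 * n - 1 - l, ?b)) = (- 1) ^ a"
      using k(1) a Sp_iff_index[OF Sp_carrier_mat[OF k(1)]] by auto
    moreover have "(\<Sum>l<2 * n. (- 1) ^ l * k $$ (l, a) * k $$ (2 * n - 1 - l, ?b)) =
        (\<Sum>l<2 * n. if l = a then (- 1) ^ a * k $$ (a, a) * k $$ (?b, ?b) else 0)"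
      using k(2) a by (intro sum.cong) (auto simp: diagonal_def)
    ultimately have "k $$ (a, a) * k $$ (?b, ?b) = 1" using a by (simp add: mult.assoc)
    then show ?thesis by (metis mult_zero_left nonzero_mult_div_cancel_left zero_neq_one)
  qed
  have "g $$ (a, a) = h $$ (a, a)" if "a < 2 * n" for a
  proof (cases "a < n")
    case False
    then have "a = 2 * n - 1 - (2 * n - 1 - a)" "2 * n - 1 - a < n" using that by auto
    then show ?thesis using opp[OF g] opp[OF h] low by metis
  qed (rule low)
  then have "g $$ (a, b) = h $$ (a, b)" if "a < 2 * n" "b < 2 * n" for a b
    using that g(2) h(2) by (cases "a = b") (auto simp: diagonal_def)
  then show ?thesis
    using Sp_carrier_mat[OF g(1)] Sp_carrier_mat[OF h(1)] by (intro eq_matI) auto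
qed

lemma coroot_carrier [simp]: "coroot n j x \<in> carrier_mat (2 * n) (2 * n)"
  by (simp add: coroot_def)

lemma coroot_diagonal: "diagonal n (coroot n j x)"
  by (simp add: coroot_def diagonal_def)

lemma coroot_index:
  "a < 2 * n \<Longrightarrow> b < 2 * n \<Longrightarrow> coroot n j x $$ (a, b) =
     (if a \<noteq> b then 0 else if a = j - 1 \<or> a = 2 * n - j - 1 then x
      else if a = j \<or> a = 2 * n - j then inverse x else 1)"
  by (simp add: coroot_def)

lemma coroot_Sp:
  assumes j: "j \<in> {1..n}" and x: "x \<noteq> 0"
  shows "coroot n j x \<in> carrier (Sp n)"
  unfolding Sp_iff_index[OF coroot_carrier]
proof (intro allI impI)
  fix a b assume ab: "a < 2 * n" "b < 2 * n"
  let ?c = "coroot n j x"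
  have pair: "?c $$ (a, a) * ?c $$ (2 * n - 1 - a, 2 * n - 1 - a) = 1"
  proof -
    obtain i k where ik: "j = Suc i" "n = Suc (i + k)" using j by (rule rank_cases)
    consider "a = i" | "a = i + 1" | "a = i + 2 * k" | "a = i + 2 * k + 1"
      | "a \<notin> {i, i + 1, i + 2 * k, i + 2 * k + 1}" by blast
    then show ?thesis
    proof cases
      case 5
      then have "2 * n - 1 - a \<notin> {i, i + 1, i + 2 * k, i + 2 * k + 1}" using ab ik by auto
      then show ?thesis using 5 ab ik by (simp add: coroot_index)
    qed (use ab ik x in \<open>simp_all add: coroot_index\<close>)
  qed
  have "(\<Sum>l<2 * n. (- 1) ^ l * ?c $$ (l, a) * ?c $$ (2 * n - 1 - l, b)) =
      (\<Sum>l<2 * n. if l = a then (- 1) ^ a * ?c $$ (a, a) * ?c $$ (2 * n - 1 - a, b) else 0)"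
    using ab coroot_diagonal[of n j x] by (intro sum.cong) (auto simp: diagonal_def)
  also have "\<dots> = (- 1) ^ a * (?c $$ (a, a) * ?c $$ (2 * n - 1 - a, b))" using ab by simp
  also have "?c $$ (a, a) * ?c $$ (2 * n - 1 - a, b) = (if a + b + 1 = 2 * n then 1 else 0)"
  proof (cases "a + b + 1 = 2 * n")
    case True
    then have "b = 2 * n - 1 - a" by simp
    then show ?thesis using pair True by simp
  next
    case False
    then have "2 * n - 1 - a \<noteq> b" using ab by auto
    then show ?thesis using False ab coroot_diagonal[of n j x] by (simp add: diagonal_def)
  qed
  finally show "(\<Sum>l<2 * n. (- 1) ^ l * ?c $$ (l, a) * ?c $$ (2 * n - 1 - l, b)) =
    (if a + b + 1 = 2 * n then (- 1) ^ a else 0)" by simp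
qed

text \<open>The entries x at j-1 and 1/x at j cancel when both lie in the block; only the block of
  size j contains the first without the second.\<close>

lemma lminor_coroot:
  assumes "j \<in> {1..n}" "k \<in> {1..n}" "x \<noteq> 0"
  shows "lminor k (coroot n j x) = (if j = k then x else 1)"
proof -
  have "lminor k (coroot n j x) = (\<Prod>a<k. coroot n j x $$ (a, a))"
    using assms by (intro lminor_lower_triangular) (auto simp: coroot_index)
  also have "\<dots> = (\<Prod>a<k. (if a = j - 1 then x else 1) * (if a = j then inverse x else 1))"
    using assms by (intro prod.cong) (auto simp: coroot_index)
  also have "\<dots> = (if j - 1 < k then x else 1) * (if j < k then inverse x else 1)"
    by (simp add: prod.distrib)
  also have "\<dots> = (if j = k then x else 1)" using assms by auto
  finally show ?thesis .
qed

lemma mprod_Nil [simp]: "mprod n [] = 1\<^sub>m (2 * n)" and mprod_Cons [simp]: "mprod n (g # gs) = g * mprod n gs"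
  by (simp_all add: mprod_def)

lemma mprod_Sp: "set gs \<subseteq> carrier (Sp n) \<Longrightarrow> mprod n gs \<in> carrier (Sp n)"
  by (induction gs) (auto simp: Sp_one_closed Sp_mult)

lemma mprod_append:
  "set gs \<subseteq> carrier (Sp n) \<Longrightarrow> set hs \<subseteq> carrier (Sp n) \<Longrightarrow> mprod n (gs @ hs) = mprod n gs * mprod n hs"
proof (induction gs)
  case Nil
  then show ?case using Sp_carrier_mat[OF mprod_Sp[of hs n]] by simp
next
  case (Cons g gs)
  then have "g \<in> carrier_mat (2 * n) (2 * n)" "mprod n gs \<in> carrier_mat (2 * n) (2 * n)"
    "mprod n hs \<in> carrier_mat (2 * n) (2 * n)"
    using mprod_Sp[of gs n] mprod_Sp[of hs n] by (auto intro: Sp_carrier_mat)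
  then show ?case using Cons by (simp add: mat_assoc[of _ "2 * n"])
qed

lemma mprod_diagonal:
  assumes "\<And>g. g \<in> set gs \<Longrightarrow> g \<in> carrier (Sp n) \<and> diagonal n g"
  shows "diagonal n (mprod n gs) \<and>
    (\<forall>k\<le>2 * n. lminor k (mprod n gs) = prod_list (map (lminor k) gs))"
  using assms
proof (induction gs)
  case Nil
  have "lminor k (1\<^sub>m (2 * n)) = 1" if "k \<le> 2 * n" for k
    using lower_from_lminor[OF lower_from_one that] .
  then show ?case by (simp add: diagonal_def)
next
  case (Cons g gs)
  have g: "g \<in> carrier_mat (2 * n) (2 * n)" "diagonal n g" using Cons.prems by (auto intro: Sp_carrier_mat)
  have gs: "mprod n gs \<in> carrier_mat (2 * n) (2 * n)" "diagonal n (mprod n gs)"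
    using Cons mprod_Sp[of gs n] by (auto intro: Sp_carrier_mat)
  have "diagonal n (g * mprod n gs)"
    unfolding diagonal_def
  proof (intro allI impI)
    fix a b assume ab: "a < 2 * n" "b < 2 * n" "a \<noteq> b"
    have "g $$ (a, l) * mprod n gs $$ (l, b) = 0" if "l < 2 * n" for l
      using g gs ab that by (cases "l = a") (auto simp: diagonal_def)
    then show "(g * mprod n gs) $$ (a, b) = 0"
      unfolding mult_index[OF g(1) gs(1) ab(1,2)] by (intro sum.neutral) simp
  qed
  moreover have "lminor k (g * mprod n gs) = lminor k g * lminor k (mprod n gs)" if "k \<le> 2 * n" for k
    using g gs that by (intro lminor_mult_left) (auto simp: diagonal_def)
  ultimately show ?case using Cons by simp
qed

lemma torus_elt_props:
  assumes "\<forall>j\<in>{1..n}. x j \<noteq> 0"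
  shows "torus_elt n x \<in> carrier (Sp n)" "diagonal n (torus_elt n x)"
    "k \<in> {1..n} \<Longrightarrow> lminor k (torus_elt n x) = x k"
proof -
  let ?gs = "map (\<lambda>j. coroot n j (x j)) [1..<n + 1]"
  have gs: "g \<in> carrier (Sp n) \<and> diagonal n g" if "g \<in> set ?gs" for g
    using that assms by (auto intro!: coroot_Sp coroot_diagonal)
  then show "torus_elt n x \<in> carrier (Sp n)" unfolding torus_elt_def by (intro mprod_Sp) blast
  show "diagonal n (torus_elt n x)" unfolding torus_elt_def using mprod_diagonal[OF gs] by blast
  assume k: "k \<in> {1..n}"
  have "k \<le> 2 * n" using k by simp
  then have "lminor k (torus_elt n x) = prod_list (map (lminor k) ?gs)"
    unfolding torus_elt_def using mprod_diagonal[OF gs] by blast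
  also have "map (lminor k) ?gs = map (\<lambda>j. if j = k then x k else 1) [1..<n + 1]"
    using assms k by (auto simp: lminor_coroot)
  also have "prod_list \<dots> = (\<Prod>j\<in>set [1..<n + 1]. if j = k then x k else 1)"
    by (subst prod.distinct_set_conv_list) auto
  also have "set [1..<n + 1] = {1..n}" by auto
  also have "(\<Prod>j\<in>{1..n}. if j = k then x k else 1) = x k" using k by simp
  finally show "lminor k (torus_elt n x) = x k" .
qed

text \<open>The leading minor recovers the parameter \<open>c k\<close> from the matrix, so the
  value described by \<open>THE\<close> is unique.\<close>

lemma fund_weight_eq_lminor:
  assumes "t \<in> max_torus n" "k \<in> {1..n}"
  shows "fund_weight n k t = lminor k t"
proof -
  obtain x where x: "t = torus_elt n x" "\<forall>j\<in>{1..n}. x j \<noteq> 0"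
    using assms(1) by (auto simp: max_torus_def)
  show ?thesis
    unfolding fund_weight_def
  proof (rule the_equality)
    show "\<exists>c. (\<forall>j\<in>{1..n}. c j \<noteq> 0) \<and> t = torus_elt n c \<and> lminor k t = c k"
      using x torus_elt_props(3)[OF x(2) assms(2)] by auto
    show "z = lminor k t" if "\<exists>c. (\<forall>j\<in>{1..n}. c j \<noteq> 0) \<and> t = torus_elt n c \<and> z = c k" for z
      using that torus_elt_props(3) assms(2) by auto
  qed
qed

lemma lminor_gauss:
  assumes "u \<in> U_minus n" "t \<in> max_torus n" "v \<in> U_plus n" "k \<in> {1..n}"
  shows "lminor k (u * t * v) = fund_weight n k t"
proof -
  let ?N = "2 * n"
  have u: "u \<in> lower_from n 0" using assms(1) by (simp add: U_minus_eq)
  have v: "transpose_mat v \<in> lower_from n 0" "v \<in> carrier_mat ?N ?N"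
    using U_plus_transpose_lower_from[OF assms(3)] by auto
  have uc: "u \<in> carrier_mat ?N ?N" using u by (rule lower_from_carrier_mat)
  obtain x where x: "t = torus_elt n x" "\<forall>j\<in>{1..n}. x j \<noteq> 0"
    using assms(2) by (auto simp: max_torus_def)
  have tc: "t \<in> carrier_mat ?N ?N" unfolding x(1) by (rule Sp_carrier_mat[OF torus_elt_props(1)[OF x(2)]])
  have k: "k \<le> ?N" using assms(4) by simp
  have utc: "u * t \<in> carrier_mat ?N ?N" using uc tc by simp
  have "lminor k (u * t * v) = lminor k (u * t) * lminor k v"
  proof (rule lminor_mult_right[OF utc v(2) k])
    fix a b assume "k \<le> a" "a < ?N" "b < k"
    then show "v $$ (a, b) = 0" using lower_from_triangular[OF v(1), of b a] v(2) by simp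
  qed
  also have "lminor k (u * t) = lminor k u * lminor k t"
    using u by (intro lminor_mult_left[OF uc tc k]) (auto simp: lower_from_triangular)
  also have "lminor k v = 1"
    using lower_from_lminor[OF v(1) k] v(2) k by (simp add: lminor_transpose[of _ ?N])
  finally show ?thesis
    using lower_from_lminor[OF u k] fund_weight_eq_lminor[OF assms(2,4)] by simp
qed

lemma gauss_decomposition:
  assumes g: "g \<in> carrier (Sp n)" and nz: "\<And>k. k \<in> {1..n} \<Longrightarrow> lminor k g \<noteq> 0"
  shows "\<exists>u \<in> U_minus n. \<exists>t \<in> max_torus n. \<exists>v \<in> U_plus n. g = u * t * v"
proof -
  let ?N = "2 * n"
  have gc: "g \<in> carrier_mat ?N ?N" using g by (rule Sp_carrier_mat)
  obtain u v where u: "u \<in> lower_from n 0" and v: "v \<in> lower_from n 0"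
    and od: "outer_diag n n (u * g * transpose_mat v)"
    using gauss_stage[OF g nz, of n] by blast
  define h where "h = u * g * transpose_mat v"
  have hSp: "h \<in> carrier (Sp n)"
    unfolding h_def
    by (intro Sp_mult Sp_transpose g lower_from_Sp[OF u] lower_from_Sp[OF v])
  have diag: "diagonal n h" unfolding diagonal_def
  proof (intro allI impI)
    fix a b assume "a < ?N" "b < ?N" "a \<noteq> b"
    then show "h $$ (a, b) = 0" using od unfolding h_def[symmetric] outer_diag_def by (cases "a < n") auto
  qed
  obtain u' v' where u': "u' \<in> lower_from n 0" "u' * u = 1\<^sub>m ?N" "u * u' = 1\<^sub>m ?N"
    and v': "v' \<in> lower_from n 0" "v' * v = 1\<^sub>m ?N"
    using lower_from_inverse[OF u] lower_from_inverse[OF v] by blast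
  note c = gc lower_from_carrier_mat[OF u] lower_from_carrier_mat[OF v]
    lower_from_carrier_mat[OF u'(1)] lower_from_carrier_mat[OF v'(1)]
  have hc: "h \<in> carrier_mat ?N ?N" using hSp by (rule Sp_carrier_mat)
  have ugc: "u * g \<in> carrier_mat ?N ?N" using c by simp
  have "lminor k h = lminor k g" if "k \<in> {1..n}" for k
  proof -
    have k: "k \<le> ?N" using that by simp
    have "lminor k h = lminor k (u * g) * lminor k (transpose_mat v)"
      unfolding h_def using v c by (intro lminor_mult_right[OF ugc _ k]) (auto simp: lower_from_triangular)
    also have "lminor k (u * g) = lminor k u * lminor k g"
      using u c by (intro lminor_mult_left[OF _ _ k]) (auto simp: lower_from_triangular)
    finally show ?thesis
      using lower_from_lminor[OF u k] lower_from_lminor[OF v k] c k by (simp add: lminor_transpose[of _ ?N])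
  qed
  then have nz': "lminor k h \<noteq> 0" if "k \<in> {1..n}" for k using nz[OF that] that by simp
  \<comment> \<open>The torus parameters of the diagonal factor are its own leading minors.\<close>
  have "h = torus_elt n (\<lambda>k. lminor k h)"
    using torus_elt_props[of n "\<lambda>k. lminor k h"] nz' hSp diag by (intro diagonal_Sp_eqI) auto
  then have t: "h \<in> max_torus n" using nz' unfolding max_torus_def by blast
  have vv: "transpose_mat v * transpose_mat v' = 1\<^sub>m ?N"
    using transpose_mult_sq[of v' ?N v] v' c by simp
  have "u' * h * transpose_mat v' = (u' * u) * g * (transpose_mat v * transpose_mat v')"
    unfolding h_def using c by (simp add: mat_assoc[of _ ?N] mult_carrier_mat[of _ ?N ?N])
  then have "g = u' * h * transpose_mat v'" unfolding u' vv using gc by simp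
  then show ?thesis
    using u' t transpose_lower_from_U_plus[OF v'(1)] unfolding U_minus_eq by blast
qed

section \<open>Regular functions and the principal minor\<close>

lemma entry_polys_sum:
  "finite S \<Longrightarrow> (\<And>s. s \<in> S \<Longrightarrow> f s \<in> entry_polys N) \<Longrightarrow> (\<lambda>g. \<Sum>s\<in>S. f s g) \<in> entry_polys N"
  by (induction S rule: finite_induct) (auto intro: entry_polys.intros)

lemma entry_polys_prod:
  "finite S \<Longrightarrow> (\<And>s. s \<in> S \<Longrightarrow> f s \<in> entry_polys N) \<Longrightarrow> (\<lambda>g. \<Prod>s\<in>S. f s g) \<in> entry_polys N"
  by (induction S rule: finite_induct) (auto intro: entry_polys.intros)

lemma lminor_entry_polys:
  assumes "k \<le> N"
  shows "lminor k \<in> entry_polys N"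
proof -
  have "lminor k = (\<lambda>g. \<Sum>p\<in>{p. p permutes {0..<k}}. signof p * (\<Prod>i\<in>{0..<k}. g $$ (i, p i)))"
    unfolding lminor_def by (rule ext, subst det_def'[of _ k])
      (auto intro!: sum.cong prod.cong simp: permutes_in_image)
  also have "\<dots> \<in> entry_polys N"
  proof (intro entry_polys_sum entry_polys.mult entry_polys.const entry_polys_prod)
    fix p i assume "p \<in> {p. p permutes {0..<k}}" "i \<in> {0..<k}"
    then have "p i < k" "i < k" using permutes_in_image[of p "{0..<k}" i] by auto
    then show "(\<lambda>g. g $$ (i, p i)) \<in> entry_polys N"
      using assms by (intro entry_polys.entry) auto
  qed (auto intro: finite_permutations)
  finally show ?thesis .
qed

text \<open>The leading minor satisfies the defining condition, hence so does the function picked by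
  \<open>SOME\<close>; this gives regularity and its values on U^- T U^+.\<close>

lemma principal_minor_spec:
  assumes "k \<in> {1..n}"
  shows "regular_on_Sp n (principal_minor n k)"
    and "u \<in> U_minus n \<Longrightarrow> t \<in> max_torus n \<Longrightarrow> v \<in> U_plus n \<Longrightarrow>
      principal_minor n k (u * t * v) = lminor k (u * t * v)"
proof -
  let ?P = "\<lambda>f. regular_on_Sp n f \<and>
        (\<forall>u \<in> U_minus n. \<forall>t \<in> max_torus n. \<forall>v \<in> U_plus n. f (u * t * v) = fund_weight n k t)"
  have "?P (lminor k)"
    using lminor_gauss[OF _ _ _ assms] lminor_entry_polys[of k "2 * n"] assms
    by (auto simp: regular_on_Sp_def)
  then have P: "?P (principal_minor n k)" unfolding principal_minor_def by (rule someI[of ?P])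
  then show "regular_on_Sp n (principal_minor n k)" by blast
  show "u \<in> U_minus n \<Longrightarrow> t \<in> max_torus n \<Longrightarrow> v \<in> U_plus n \<Longrightarrow>
      principal_minor n k (u * t * v) = lminor k (u * t * v)"
    using P lminor_gauss[OF _ _ _ assms] by metis
qed

lemma entry_polys_isCont:
  assumes "p \<in> entry_polys N" "\<And>a b. a < N \<Longrightarrow> b < N \<Longrightarrow> isCont (\<lambda>z. G z $$ (a, b)) x"
  shows "isCont (\<lambda>z :: complex. p (G z)) x"
  using assms(1) by induction (auto intro!: continuous_intros assms(2))

text \<open>A curve that lies in \<open>U\<^sup>- T U\<^sup>+\<close> near, but not necessarily at, the point 0 determines the
  value of a regular function there.\<close>

lemma principal_minor_limit:
  assumes k: "k \<in> {1..n}" and Sp: "\<And>z. G z \<in> carrier (Sp n)"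
    and cont: "\<And>a b. a < 2 * n \<Longrightarrow> b < 2 * n \<Longrightarrow> isCont (\<lambda>z. G z $$ (a, b)) 0"
    and nz: "\<forall>\<^sub>F z in at 0. \<forall>j\<in>{1..n}. lminor j (G z) \<noteq> 0"
  shows "principal_minor n k (G 0) = lminor k (G (0 :: complex))"
proof -
  obtain p where p: "p \<in> entry_polys (2 * n)" "\<And>g. g \<in> carrier (Sp n) \<Longrightarrow> principal_minor n k g = p g"
    using principal_minor_spec(1)[OF k] by (auto simp: regular_on_Sp_def)
  have lim_p: "((\<lambda>z. p (G z)) \<longlongrightarrow> p (G 0)) (at 0)"
    using entry_polys_isCont[OF p(1) cont] by (simp add: isCont_def)
  have lim_m: "((\<lambda>z. lminor k (G z)) \<longlongrightarrow> lminor k (G 0)) (at 0)"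
    using entry_polys_isCont[OF lminor_entry_polys[of k "2 * n"] cont] k by (simp add: isCont_def)
  have "\<forall>\<^sub>F z in at 0. p (G z) = lminor k (G z)"
    using nz
  proof eventually_elim
    case (elim z)
    obtain u t v where "u \<in> U_minus n" "t \<in> max_torus n" "v \<in> U_plus n" "G z = u * t * v"
      using gauss_decomposition[OF Sp, of z] elim by blast
    then show ?case using principal_minor_spec(2)[OF k] p(2)[OF Sp] by metis
  qed
  then have "((\<lambda>z. p (G z)) \<longlongrightarrow> lminor k (G 0)) (at 0)"
    using lim_m by (simp add: tendsto_cong)
  then show ?thesis using LIM_unique[OF lim_p] p(2)[OF Sp] by simp
qed

section \<open>Lifts of Weyl group elements and the rows of the product\<close>

lemma s_bar_carrier [simp]: "i \<in> {1..n} \<Longrightarrow> s_bar n i \<in> carrier_mat (2 * n) (2 * n)"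
  by (simp add: s_bar_def mult_carrier_mat[of _ "2 * n" "2 * n"])

lemma s_bar_Sp: "i \<in> {1..n} \<Longrightarrow> s_bar n i \<in> carrier (Sp n)"
  unfolding s_bar_def by (intro Sp_mult x_sub_Sp y_sub_Sp)

text \<open>On each swapped pair of positions, x(-1) y(1) x(-1) is the 2 x 2 matrix with rows (0,
  -1) and (1, 0).\<close>

lemma s_bar_mult_index:
  assumes i: "i \<in> {1..n}" and g: "g \<in> carrier_mat (2 * n) (2 * n)" and ab: "a < 2 * n" "b < 2 * n"
  shows "(s_bar n i * g) $$ (a, b) =
    (if Suc a = i \<or> Suc a = 2 * n - i then - 1 else 1) * g $$ (sigma n i a, b)"
proof -
  let ?N = "2 * n"
  have x: "x_sub n i t \<in> carrier_mat ?N ?N" and y: "y_sub n i t \<in> carrier_mat ?N ?N" for t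
    using i by auto
  define X where "X = x_sub n i (- 1) * g"
  define Y where "Y = y_sub n i 1 * X"
  have Xc: "X \<in> carrier_mat ?N ?N" and Yc: "Y \<in> carrier_mat ?N ?N"
    unfolding Y_def X_def using x y g by (auto intro!: mult_carrier_mat[of _ ?N ?N])
  have "s_bar n i * g = x_sub n i (- 1) * Y"
    unfolding s_bar_def Y_def X_def using x y g by (simp add: mat_assoc[of _ ?N] mult_carrier_mat[of _ ?N ?N])
  then have Z: "(s_bar n i * g) $$ (a, b) =
      Y $$ (a, b) - (if Suc a = i \<or> Suc a = ?N - i then Y $$ (Suc a, b) else 0)"
    using x_sub_mult_index[OF i Yc ab, of "- 1"] by simp
  have X: "X $$ (a, b) = g $$ (a, b) - (if Suc a = i \<or> Suc a = ?N - i then g $$ (Suc a, b) else 0)"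
    if "a < ?N" for a using x_sub_mult_index[OF i g that ab(2), of "- 1"] by (simp add: X_def)
  have Y: "Y $$ (a, b) = X $$ (a, b) + (if a = i \<or> a = ?N - i then X $$ (a - 1, b) else 0)"
    if "a < ?N" for a using y_sub_mult_index[OF i Xc that ab(2), of 1] by (simp add: Y_def)
  consider (P) "Suc a = i \<or> Suc a = ?N - i" | (Q) "a = i \<or> a = ?N - i"
    | (O) "\<not> (Suc a = i \<or> Suc a = ?N - i)" "\<not> (a = i \<or> a = ?N - i)" by blast
  then show ?thesis
  proof cases
    case P
    have "\<not> (a = i \<or> a = ?N - i)"
    proof (cases a)
      case (Suc a')
      then show ?thesis using P not_consecutive[OF i, of a'] by auto
    qed (use i in auto)
    moreover have "\<not> (Suc (Suc a) = i \<or> Suc (Suc a) = ?N - i)" using P not_consecutive[OF i, of a] by auto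
    moreover have "Suc a < ?N" using P i by auto
    moreover have "sigma n i a = Suc a" by (rule sigma_up[OF i P])
    ultimately show ?thesis using Z X[of a] X[of "Suc a"] Y[of a] Y[of "Suc a"] P ab by simp
  next
    case Q
    then obtain a' where a': "a = Suc a'" using i ab by (cases a) auto
    have "\<not> (Suc a = i \<or> Suc a = ?N - i)" using Q not_consecutive[OF i, of a'] a' by auto
    moreover have "sigma n i a = a'" using sigma_down[OF i Q] a' by simp
    ultimately show ?thesis using Z X[of a] X[of a'] Y[of a] Q ab a' by simp
  next
    case O
    have "sigma n i a = a" using O i by (auto simp: sigma_def)
    then show ?thesis using Z X[of a] Y[of a] O ab by simp
  qed
qed

lemma sigma_less_sigma:
  assumes "i \<in> {1..n}"
  shows "sigma n i x < sigma n i y \<longleftrightarrow>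
    (x < y \<and> \<not> (y = Suc x \<and> (Suc x = i \<or> Suc x = 2 * n - i))) \<or>
    (x = Suc y \<and> (Suc y = i \<or> Suc y = 2 * n - i))"
proof -
  obtain j k where jk: "i = Suc j" "n = Suc (j + k)" using assms by (rule rank_cases)
  have e: "2 * Suc (j + k) - Suc j = Suc (j + 2 * k)" by simp
  show ?thesis unfolding jk sigma_Suc e by auto
qed

lemma sigma_lower_position:
  assumes "i \<in> {1..n}"
  shows "Suc (sigma n i x) = i \<or> Suc (sigma n i x) = 2 * n - i \<longleftrightarrow> x = i \<or> x = 2 * n - i"
proof -
  obtain j k where jk: "i = Suc j" "n = Suc (j + k)" using assms by (rule rank_cases)
  have e: "2 * Suc (j + k) - Suc j = Suc (j + 2 * k)" by simp
  show ?thesis unfolding jk sigma_Suc e by auto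
qed

text \<open>The sign in column a counts the inversions of p that end at a. This is a closed form of
  the lift that refers to no word.\<close>

definition signed_perm_mat :: "nat \<Rightarrow> (nat \<Rightarrow> nat) \<Rightarrow> complex mat" where
  "signed_perm_mat n p = mat (2 * n) (2 * n)
     (\<lambda>(b, a). if b = p a then (- 1) ^ card {a'. a' < a \<and> p a < p a'} else 0)"

lemma signed_perm_mat_carrier [simp]: "signed_perm_mat n p \<in> carrier_mat (2 * n) (2 * n)"
  by (simp add: signed_perm_mat_def)

text \<open>At an ascent, s_i creates one new inversion ending at a if p a is the larger member of a
  swapped pair, and none otherwise. This matches the row sign of \<open>s_bar\<close>.\<close>

lemma inversions_sigma:
  fixes p :: "nat \<Rightarrow> nat"
  assumes i: "i \<in> {1..n}" and bij: "bij p"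
    and asc: "\<And>v. Suc v = i \<or> Suc v = 2 * n - i \<Longrightarrow> inv_into UNIV p v < inv_into UNIV p (Suc v)"
  shows "(- 1) ^ card {a'. a' < a \<and> sigma n i (p a) < sigma n i (p a')} =
    (if p a = i \<or> p a = 2 * n - i then - 1 else 1) * ((- 1) ^ card {a'. a' < a \<and> p a < p a'} :: complex)"
proof -
  let ?P = "\<lambda>v. Suc v = i \<or> Suc v = 2 * n - i"
  let ?q = "inv_into UNIV p"
  let ?S = "{a'. a' < a \<and> p a < p a'}"
  have q: "?q (p x) = x" "p (?q x) = x" for x
    using bij by (auto simp: bij_is_inj bij_is_surj surj_f_inv_f)
  have "\<not> (p a' = Suc (p a) \<and> ?P (p a))" if "a' < a" for a'
    using asc[of "p a"] q(1)[of a] q(1)[of a'] that by force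
  then have S: "{a'. a' < a \<and> sigma n i (p a) < sigma n i (p a')} =
      ?S \<union> {a'. a' < a \<and> p a = Suc (p a') \<and> ?P (p a')}"
    unfolding sigma_less_sigma[OF i] by blast
  show ?thesis
  proof (cases "p a = i \<or> p a = 2 * n - i")
    case True
    then obtain v where v: "p a = Suc v" using i by (cases "p a") auto
    have "?q v < a" using asc[of v] True v q(1)[of a] by auto
    then have "{a'. a' < a \<and> p a = Suc (p a') \<and> ?P (p a')} = {?q v}"
      using v True q by auto
    moreover have "?q v \<notin> ?S" using v q by auto
    ultimately show ?thesis using True unfolding S by simp
  next
    case False
    then have Z: "{a'. a' < a \<and> p a = Suc (p a') \<and> ?P (p a')} = {}" by auto
    show ?thesis using False unfolding S Z by simp
  qed
qed

text \<open>The first letter is an ascent by \<open>reduced_word_Cons\<close>, and the symmetry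
  \<open>opp\<close> carries this over to the mirrored pair, as \<open>inversions_sigma\<close>
  requires.\<close>

lemma lift_reduced_word:
  "reduced_word n w is \<Longrightarrow> mprod n (map (s_bar n) is) = signed_perm_mat n (word_perm n is)"
proof (induction "is" arbitrary: w)
  case Nil
  have e: "{a'. a' < a \<and> a < a'} = {}" for a :: nat by auto
  show ?case by (intro eq_matI) (auto simp: signed_perm_mat_def e)
next
  case (Cons i "is")
  let ?p = "word_perm n is" and ?N = "2 * n"
  let ?q = "inv_into UNIV ?p"
  note red = reduced_word_Cons[OF Cons.prems]
  have is': "is \<in> lists {1..n}" using red(2) by (simp add: reduced_word_def)
  note bij = bij_word_perm[OF is']
  have q_less: "?q a < ?N \<longleftrightarrow> a < ?N" for a
    using word_perm_less_iff[OF is', of "?q a"] bij by (simp add: bij_is_surj surj_f_inv_f)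
  have q_opp: "?q (opp n a) = opp n (?q a)" for a
    using word_perm_opp[OF is', of "?q a"] bij by (metis bij_inv_eq_iff)
  have asc: "?q v < ?q (Suc v)" if v: "Suc v = i \<or> Suc v = ?N - i" for v
  proof (cases "Suc v = i")
    case True
    then show ?thesis using red(3) by auto
  next
    case False
    then have "v = opp n i" "Suc v = opp n (i - 1)" using v red(1) by (auto simp: opp_def)
    then have "?q v = opp n (?q i)" "?q (Suc v) = opp n (?q (i - 1))" using q_opp by metis+
    moreover have "?q i < ?N" "?q (i - 1) < ?N" unfolding q_less using red(1) False v by auto
    ultimately show ?thesis using red(3) by (auto simp: opp_def)
  qed
  have "mprod n (map (s_bar n) (i # is)) = s_bar n i * signed_perm_mat n ?p"
    using Cons.IH[OF red(2)] by simp
  also have "\<dots> = signed_perm_mat n (sigma n i \<circ> ?p)"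
  proof (rule eq_matI)
    fix b a assume "b < dim_row (signed_perm_mat n (sigma n i \<circ> ?p))" "a < dim_col (signed_perm_mat n (sigma n i \<circ> ?p))"
    then have ab: "b < ?N" "a < ?N" by (auto simp: signed_perm_mat_def)
    have iff: "sigma n i b = ?p a \<longleftrightarrow> b = sigma n i (?p a)"
      using sigma_involution[OF red(1)] by metis
    have sb: "sigma n i b < ?N" using ab sigma_less_iff[OF red(1)] by simp
    have "(s_bar n i * signed_perm_mat n ?p) $$ (b, a) =
        (if Suc b = i \<or> Suc b = ?N - i then - 1 else 1) * signed_perm_mat n ?p $$ (sigma n i b, a)"
      by (rule s_bar_mult_index[OF red(1) _ ab]) simp
    also have "\<dots> = (if b = sigma n i (?p a) then (if ?p a = i \<or> ?p a = ?N - i then - 1 else 1) *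
        (- 1) ^ card {a'. a' < a \<and> ?p a < ?p a'} else 0)"
      using ab sb iff sigma_lower_position[OF red(1), of "?p a"] by (auto simp: signed_perm_mat_def)
    also have "\<dots> = signed_perm_mat n (sigma n i \<circ> ?p) $$ (b, a)"
      using ab inversions_sigma[OF red(1) bij asc, of a] by (simp add: signed_perm_mat_def)
    finally show "(s_bar n i * signed_perm_mat n ?p) $$ (b, a) = signed_perm_mat n (sigma n i \<circ> ?p) $$ (b, a)" .
  qed (use s_bar_carrier[OF red(1)] in \<open>auto simp: signed_perm_mat_def\<close>)
  finally show ?case by (simp add: comp_def)
qed

lemma weyl_lift_id: "weyl_lift n id = 1\<^sub>m (2 * n)"
proof -
  have "weyl_length n id = 0" using weyl_length_le[of "[]" n] by simp
  moreover have "\<exists>is. reduced_word n id is" using reduced_word_exists[of "[]" n] by simp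
  then have "reduced_word n id (SOME is. reduced_word n id is)" by (rule someI_ex)
  ultimately have "(SOME is. reduced_word n id is) = []" by (simp add: reduced_word_def)
  then show ?thesis by (simp add: weyl_lift_def)
qed

lemma weyl_lift_longest_simple_refl:
  assumes "k \<in> {1..n}"
  shows "weyl_lift n (longest_elt n \<circ> simple_refl n k) = signed_perm_mat n (opp n \<circ> sigma n k)"
    and "weyl_lift n (longest_elt n \<circ> simple_refl n k) \<in> carrier (Sp n)"
proof -
  let ?w = "longest_elt n \<circ> simple_refl n k"
  define js where "js = (SOME is. reduced_word n ?w is)"
  have js: "reduced_word n ?w js"
    unfolding js_def using longest_simple_refl_word(1)[OF assms] by (rule someI_ex)
  have eq: "weyl_lift n ?w = mprod n (map (s_bar n) js)" by (simp add: weyl_lift_def js_def)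
  then show "weyl_lift n ?w = signed_perm_mat n (opp n \<circ> sigma n k)"
    using lift_reduced_word[OF js] longest_simple_refl_word(2)[OF assms js] by simp
  have "js \<in> lists {1..n}" using js by (simp add: reduced_word_def)
  then show "weyl_lift n ?w \<in> carrier (Sp n)" unfolding eq by (intro mprod_Sp) (auto intro!: s_bar_Sp)
qed

lemma signed_perm_mat_orthogonal:
  assumes "inj p" "\<And>a. a < 2 * n \<Longrightarrow> p a < 2 * n"
  shows "transpose_mat (signed_perm_mat n p) * signed_perm_mat n p = 1\<^sub>m (2 * n)"
proof (rule eq_matI)
  let ?N = "2 * n" and ?M = "signed_perm_mat n p"
  fix a b assume "a < dim_row (1\<^sub>m ?N :: complex mat)" "b < dim_col (1\<^sub>m ?N :: complex mat)"
  then have ab: "a < ?N" "b < ?N" by auto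
  let ?e = "\<lambda>a. (- 1) ^ card {a'. a' < a \<and> p a < p a'} :: complex"
  have "(transpose_mat ?M * ?M) $$ (a, b) = (\<Sum>l<?N. transpose_mat ?M $$ (a, l) * ?M $$ (l, b))"
    using ab by (intro mult_index) auto
  also have "\<dots> = (\<Sum>l<?N. if l = p a then (if a = b then ?e a * ?e a else 0) else 0)"
    using ab injD[OF assms(1), of a b] by (intro sum.cong) (auto simp: signed_perm_mat_def)
  also have "\<dots> = (if a = b then ?e a * ?e a else 0)" using assms(2)[OF ab(1)] by simp
  also have "?e a * ?e a = 1" by (simp add: power_mult_distrib[symmetric])
  finally show "(transpose_mat ?M * ?M) $$ (a, b) = 1\<^sub>m ?N $$ (a, b)" using ab by simp
qed (auto simp: signed_perm_mat_def)

text \<open>The form matrix is also the lift of the longest element.\<close>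

lemma transpose_lift_eq:
  assumes k: "k \<in> {1..n}"
  shows "transpose_mat (signed_perm_mat n (opp n \<circ> sigma n k)) = s_bar n k * sympl_form n"
proof (rule eq_matI)
  let ?N = "2 * n"
  fix a b assume "a < dim_row (s_bar n k * sympl_form n)" "b < dim_col (s_bar n k * sympl_form n)"
  then have ab: "a < ?N" "b < ?N" using s_bar_carrier[OF k] by auto
  let ?s = "sigma n k"
  have sl: "?s x < ?N \<longleftrightarrow> x < ?N" for x by (rule sigma_less_iff[OF k])
  have "opp n (?s a) < opp n (?s a') \<longleftrightarrow> ?s a' < ?s a" if "a' < a" for a'
  proof -
    have "?s a < ?N" "?s a' < ?N" using ab that sl by auto
    then show ?thesis unfolding opp_def by auto
  qed
  then have "{a'. a' < a \<and> opp n (?s a) < opp n (?s a')} = {a'. a' < a \<and> ?s a' < ?s a}"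
    by blast
  \<comment> \<open>Of the positions before a, only a neighbour swapped with a fails to stay below
    it.\<close>
  also have "\<dots> = {..<a} - {v. a = Suc v \<and> (a = k \<or> a = ?N - k)}"
    unfolding sigma_less_sigma[OF k] by auto
  finally have card: "card {a'. a' < a \<and> opp n (?s a) < opp n (?s a')} = (if a = k \<or> a = ?N - k then a - 1 else a)"
    using k ab by (cases a) auto
  have "transpose_mat (signed_perm_mat n (opp n \<circ> ?s)) $$ (a, b) =
     (if b = opp n (?s a) then (- 1) ^ (if a = k \<or> a = ?N - k then a - 1 else a) else 0)"
    using ab card by (simp add: signed_perm_mat_def)
  also have "\<dots> = (if Suc a = k \<or> Suc a = ?N - k then - 1 else 1) * sympl_form n $$ (?s a, b)"
  proof -
    have b: "b = opp n (?s a) \<longleftrightarrow> ?s a + b + 1 = ?N" using ab sl[of a] by (auto simp: opp_def)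
    have nc: "\<not> ((a = k \<or> a = ?N - k) \<and> (Suc a = k \<or> Suc a = ?N - k))"
      using not_consecutive[OF k, of "a - 1"] k by (cases a) auto
    consider "Suc a = k \<or> Suc a = ?N - k" | "a = k \<or> a = ?N - k"
      | "\<not> (Suc a = k \<or> Suc a = ?N - k)" "\<not> (a = k \<or> a = ?N - k)" by blast
    then have "(- 1) ^ (if a = k \<or> a = ?N - k then a - 1 else a) =
      (if Suc a = k \<or> Suc a = ?N - k then - 1 else 1) * (- 1 :: complex) ^ ?s a"
    proof cases
      case 1
      then have "?s a = Suc a" by (rule sigma_up[OF k])
      then show ?thesis using 1 nc by simp
    next
      case 2
      have "?s a = a - 1" by (rule sigma_down[OF k 2])
      then show ?thesis using 2 nc by simp
    next
      case 3
      then have "?s a = a" using k by (auto simp: sigma_def)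
      then show ?thesis using 3 by simp
    qed
    then show ?thesis unfolding b using ab sl[of a] by (simp add: sympl_form_def)
  qed
  also have "\<dots> = (s_bar n k * sympl_form n) $$ (a, b)"
    by (rule s_bar_mult_index[OF k _ ab, symmetric]) simp
  finally show "transpose_mat (signed_perm_mat n (opp n \<circ> ?s)) $$ (a, b) = (s_bar n k * sympl_form n) $$ (a, b)" .
qed (use s_bar_carrier[OF k] in \<open>auto simp: signed_perm_mat_def\<close>)

text \<open>The lift is a signed permutation matrix, so its inverse is its transpose.\<close>

lemma inv_weyl_lift:
  assumes k: "k \<in> {1..n}"
  shows "inv\<^bsub>Sp n\<^esub> (weyl_lift n (longest_elt n \<circ> simple_refl n k)) = s_bar n k * sympl_form n"
proof -
  let ?M = "signed_perm_mat n (opp n \<circ> sigma n k)"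
  have M: "?M \<in> carrier (Sp n)" using weyl_lift_longest_simple_refl[OF k] by simp
  have "inj (opp n \<circ> sigma n k)"
  proof (rule injI)
    fix x y assume "(opp n \<circ> sigma n k) x = (opp n \<circ> sigma n k) y"
    then have "sigma n k x = sigma n k y" by (metis comp_apply opp_opp)
    then show "x = y" using sigma_involution[OF k] by metis
  qed
  moreover have "(opp n \<circ> sigma n k) a < 2 * n" if "a < 2 * n" for a
    using that sigma_less_iff[OF k, of a] by (auto simp: opp_def)
  ultimately have "inv\<^bsub>Sp n\<^esub> ?M = transpose_mat ?M"
    using M by (intro Sp_inv_eqI Sp_transpose signed_perm_mat_orthogonal)
  then show ?thesis
    unfolding weyl_lift_longest_simple_refl(1)[OF k] by (simp add: transpose_lift_eq[OF k])
qed

section \<open>Row action of the factors of Theta\<close>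

lemma bold_y_Sp: "i \<in> {1..n} \<Longrightarrow> x \<noteq> 0 \<Longrightarrow> bold_y n i x \<in> carrier (Sp n)"
  unfolding bold_y_def by (intro Sp_mult y_sub_Sp coroot_Sp) auto

lemma bold_y_mult_index:
  assumes i: "i \<in> {1..n}" and x: "x \<noteq> 0" and g: "g \<in> carrier_mat (2 * n) (2 * n)"
    and ab: "a < 2 * n" "b < 2 * n"
  shows "(bold_y n i x * g) $$ (a, b) =
    (if Suc a = i \<or> Suc a = 2 * n - i then g $$ (a, b) / x
     else if a = i \<or> a = 2 * n - i then x * g $$ (a, b) + g $$ (a - 1, b) else g $$ (a, b))"
proof -
  let ?N = "2 * n" and ?c = "coroot n i (inverse x)"
  have cg: "(?c * g) $$ (a, b) = ?c $$ (a, a) * g $$ (a, b)" if "a < ?N" for a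
  proof -
    have "(?c * g) $$ (a, b) = (\<Sum>l<?N. ?c $$ (a, l) * g $$ (l, b))"
      using that ab g by (intro mult_index) auto
    also have "\<dots> = (\<Sum>l<?N. if l = a then ?c $$ (a, a) * g $$ (a, b) else 0)"
      using that by (intro sum.cong) (auto simp: coroot_index)
    finally show ?thesis using that by simp
  qed
  have cgc: "?c * g \<in> carrier_mat ?N ?N" using g by (intro mult_carrier_mat[of _ ?N ?N]) auto
  have "bold_y n i x * g = y_sub n i x * (?c * g)"
    unfolding bold_y_def using i g by (intro mat_assoc[of _ ?N]) auto
  then have eq: "(bold_y n i x * g) $$ (a, b) = ?c $$ (a, a) * g $$ (a, b) +
      (if a = i \<or> a = ?N - i then x * (?c $$ (a - 1, a - 1) * g $$ (a - 1, b)) else 0)"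
    using y_sub_mult_index[OF i cgc ab, of x] cg ab by (simp del: index_mult_mat(1))
  have c: "?c $$ (a, a) = (if Suc a = i \<or> Suc a = ?N - i then inverse x
      else if a = i \<or> a = ?N - i then x else 1)" if "a < ?N" for a
    using that i by (auto simp: coroot_index)
  show ?thesis
  proof (cases "a = i \<or> a = ?N - i")
    case True
    then obtain a' where a': "a = Suc a'" using i ab by (cases a) auto
    then have "\<not> (Suc a = i \<or> Suc a = ?N - i)" using not_consecutive[OF i, of a'] True by auto
    then show ?thesis using eq c[of a] c[of a'] True a' ab x by simp
  next
    case False
    then show ?thesis using eq c[of a] ab by (simp add: field_simps)
  qed
qed

definition theta_factor :: "nat \<Rightarrow> (nat \<Rightarrow> complex) \<Rightarrow> nat \<Rightarrow> complex mat" where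
  "theta_factor n x s = mprod n (map (\<lambda>i. bold_y n i (x i)) [s..<n + 1])"

lemma theta_factor_Sp:
  assumes "\<And>i. i \<in> {1..n} \<Longrightarrow> x i \<noteq> 0" "1 \<le> s"
  shows "theta_factor n x s \<in> carrier (Sp n)"
  unfolding theta_factor_def using assms by (intro mprod_Sp) (auto intro!: bold_y_Sp)

text \<open>Letters act from n down to s. In the upper half a letter adds a row that no earlier
  letter has touched, so two terms suffice. In the lower half, letter i adds to the row of v_i' the
  row above it, which is already updated; hence the running sum \<open>t\<close>, starting with the
  row of v_n.\<close>

lemma theta_factor_rows:
  assumes x: "\<And>i. i \<in> {1..n} \<Longrightarrow> x i \<noteq> 0" and X: "X \<in> carrier_mat (2 * n) (2 * n)"
    and b: "b < 2 * n" and n: "1 \<le> n" and s: "1 \<le> s" "s \<le> n + 1" and i: "i \<in> {1..n}"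
  defines "t \<equiv> \<lambda>i. X $$ (n - 1, b) + (\<Sum>l = i..n. x l * X $$ (2 * n - l, b))"
  shows "(theta_factor n x s * X) $$ (i - 1, b) =
      (if i < s then X $$ (i - 1, b) else if i = s then X $$ (i - 1, b) / x i
       else X $$ (i - 2, b) + x (i - 1) / x i * X $$ (i - 1, b))"
    and "(theta_factor n x s * X) $$ (2 * n - i, b) =
      (if i < s then X $$ (2 * n - i, b) else if i = s then t i else t i / x (i - 1))"
proof -
  let ?N = "2 * n"
  let ?Y = "\<lambda>s. theta_factor n x s * X"
  let ?U = "\<lambda>s i. ?Y s $$ (i - 1, b) =
      (if i < s then X $$ (i - 1, b) else if i = s then X $$ (i - 1, b) / x i
       else X $$ (i - 2, b) + x (i - 1) / x i * X $$ (i - 1, b))"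
  let ?L = "\<lambda>s i. ?Y s $$ (?N - i, b) =
      (if i < s then X $$ (?N - i, b) else if i = s then t i else t i / x (i - 1))"
  have "\<forall>i\<in>{1..n}. ?U s i \<and> ?L s i"
    using s(2) s(1)
  proof (induction s rule: inc_induct)
    case base
    have "?Y (n + 1) = X" using X by (simp add: theta_factor_def)
    then show ?case by simp
  next
    case (step s)
    have sn: "s \<in> {1..n}" using step by auto
    note IH = step.IH
    have U': "?U (Suc s) i" and L': "?L (Suc s) i" if "i \<in> {1..n}" for i
      using IH that sn by auto
    have Yc: "?Y (Suc s) \<in> carrier_mat ?N ?N"
      using theta_factor_Sp[of n x "Suc s"] x X by (auto dest!: Sp_carrier_mat)
    have "[s..<n + 1] = s # [Suc s..<n + 1]" using sn by (simp add: upt_rec)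
    then have "theta_factor n x s = bold_y n s (x s) * theta_factor n x (Suc s)"
      by (simp add: theta_factor_def)
    then have Y: "?Y s = bold_y n s (x s) * ?Y (Suc s)"
      using bold_y_Sp[OF sn x[OF sn]] theta_factor_Sp[of n x "Suc s"] x X
      by (auto dest!: Sp_carrier_mat simp: mat_assoc[of _ ?N])
    have row: "?Y s $$ (a, b) =
      (if Suc a = s \<or> Suc a = ?N - s then ?Y (Suc s) $$ (a, b) / x s
       else if a = s \<or> a = ?N - s then x s * ?Y (Suc s) $$ (a, b) + ?Y (Suc s) $$ (a - 1, b)
       else ?Y (Suc s) $$ (a, b))" if "a < ?N" for a
      unfolding Y by (rule bold_y_mult_index[OF sn x[OF sn] Yc that b])
    have row_P: "?Y s $$ (a, b) = ?Y (Suc s) $$ (a, b) / x s"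
      if "a < ?N" "Suc a = s \<or> Suc a = ?N - s" for a
      using row[OF that(1)] that(2) by (simp only: if_True)
    have row_Q: "?Y s $$ (a, b) = x s * ?Y (Suc s) $$ (a, b) + ?Y (Suc s) $$ (a - 1, b)"
      if "a < ?N" "a = s \<or> a = ?N - s" "\<not> (Suc a = s \<or> Suc a = ?N - s)" for a
      using row[OF that(1)] that(2,3) by (simp only: if_True if_False)
    have row_O: "?Y s $$ (a, b) = ?Y (Suc s) $$ (a, b)"
      if "a < ?N" "\<not> (a = s \<or> a = ?N - s)" "\<not> (Suc a = s \<or> Suc a = ?N - s)" for a
      using row[OF that(1)] that(2,3) by (simp only: if_False)
    have t_next: "?Y (Suc s) $$ (?N - s - 1, b) = t (Suc s)"
    proof (cases "s = n")
      case True
      have "?Y (Suc n) $$ (n - 1, b) = X $$ (n - 1, b)" using U'[of n] n True by simp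
      then show ?thesis using True by (simp add: t_def)
    next
      case False
      then show ?thesis using L'[of "Suc s"] sn by simp
    qed
    have t_rec: "t s = x s * X $$ (?N - s, b) + t (Suc s)"
      using sn unfolding t_def by (simp add: sum.atLeast_Suc_atMost)
    show ?case
    proof (intro ballI conjI)
      fix i assume i: "i \<in> {1..n}"
      have cases: "i < s \<or> i = s \<or> i = Suc s \<or> Suc s < i" by linarith
      then consider "i < s" | "i = s" | "i = Suc s" | "Suc s < i" by blast
      then show "?U s i"
      proof cases
        case 1
        have "?Y s $$ (i - 1, b) = ?Y (Suc s) $$ (i - 1, b)"
          by (rule row_O) (use 1 i sn in auto)
        then show ?thesis using U'[OF i] 1 by simp
      next
        case 2
        have "?Y s $$ (i - 1, b) = ?Y (Suc s) $$ (i - 1, b) / x s"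
          by (rule row_P) (use 2 i sn in auto)
        then show ?thesis using U'[OF i] 2 by simp
      next
        case 3
        then have "s < n" using i by auto
        have "?Y s $$ (s, b) = x s * ?Y (Suc s) $$ (s, b) + ?Y (Suc s) $$ (s - 1, b)"
          by (rule row_Q) (use \<open>s < n\<close> sn in auto)
        then show ?thesis using U'[OF i] U'[OF sn] 3 by simp
      next
        case 4
        have "?Y s $$ (i - 1, b) = ?Y (Suc s) $$ (i - 1, b)"
          by (rule row_O) (use 4 i sn in auto)
        then show ?thesis using U'[OF i] 4 by simp
      qed
      from cases consider "i < s" | "i = s" | "i = Suc s" | "Suc s < i" by blast
      then show "?L s i"
      proof cases
        case 1
        have "?Y s $$ (?N - i, b) = ?Y (Suc s) $$ (?N - i, b)"
          by (rule row_O) (use 1 i sn in auto)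
        then show ?thesis using L'[OF i] 1 by simp
      next
        case 2
        have "?Y s $$ (?N - s, b) = x s * ?Y (Suc s) $$ (?N - s, b) + ?Y (Suc s) $$ (?N - s - 1, b)"
          by (rule row_Q) (use sn in auto)
        then show ?thesis using L'[OF sn] 2 t_rec t_next by simp
      next
        case 3
        have "?Y s $$ (?N - i, b) = ?Y (Suc s) $$ (?N - i, b) / x s"
          by (rule row_P) (use 3 i sn in auto)
        moreover have "?N - i = ?N - s - 1" using 3 by simp
        ultimately show ?thesis using 3 t_next by simp
      next
        case 4
        have "?Y s $$ (?N - i, b) = ?Y (Suc s) $$ (?N - i, b)"
          by (rule row_O) (use 4 i sn in auto)
        then show ?thesis using L'[OF i] 4 by simp
      qed
    qed
  qed
  then show "?U s i" "?L s i" using i by auto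
qed

definition theta_tail :: "nat \<Rightarrow> (nat \<Rightarrow> nat \<Rightarrow> complex) \<Rightarrow> nat \<Rightarrow> complex mat" where
  "theta_tail n c m =
     mprod n (concat (map (\<lambda>m. map (\<lambda>i. bold_y n i (c m i)) [1..<n + 1]) [m..<n + 1]))"

lemma Theta_minus_eq: "Theta_minus n c = theta_tail n c 1"
  by (simp add: Theta_minus_def theta_tail_def)

lemma theta_tail_Sp:
  assumes "\<And>m i. m \<in> {1..n} \<Longrightarrow> i \<in> {1..n} \<Longrightarrow> c m i \<noteq> 0" "1 \<le> m"
  shows "theta_tail n c m \<in> carrier (Sp n)"
  unfolding theta_tail_def using assms by (intro mprod_Sp) (auto intro!: bold_y_Sp)

lemma theta_tail_rec:
  assumes "\<And>m i. m \<in> {1..n} \<Longrightarrow> i \<in> {1..n} \<Longrightarrow> c m i \<noteq> 0" "m \<in> {1..n}"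
  shows "theta_tail n c m = theta_factor n (c m) 1 * theta_tail n c (Suc m)"
proof -
  have "[m..<n + 1] = m # [Suc m..<n + 1]" using assms by (simp add: upt_rec)
  then show ?thesis
    unfolding theta_tail_def theta_factor_def using assms
    by (simp del: upt_Suc, subst mprod_append) (auto intro!: bold_y_Sp)
qed

text \<open>Consecutive running sums differ by one term, so eliminating them between
  \<open>w m j\<close> and \<open>w m (Suc j)\<close> gives \<open>w_rec\<close>. At
  \<open>Suc n\<close> the sum is empty and only the row of v_n of the next product is left.\<close>

lemma theta_rows_theta_tail:
  assumes n: "n \<ge> 1" and c: "\<And>m i. m \<in> {1..n} \<Longrightarrow> i \<in> {1..n} \<Longrightarrow> c m i \<noteq> 0"
    and c0: "\<And>m. m \<in> {1..n} \<Longrightarrow> c m 0 = 1"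
  defines "p \<equiv> \<lambda>m i b. if i = 0 then 0 else theta_tail n c m $$ (i - 1, b)"
  defines "w \<equiv> \<lambda>m j b. if j = Suc n then p (Suc m) n b / c m n else theta_tail n c m $$ (2 * n - j, b)"
  shows "theta_rows n c p w"
proof
  have end_eq: "theta_tail n c (Suc n) = 1\<^sub>m (2 * n)" by (simp add: theta_tail_def)
  have tail_c: "theta_tail n c m \<in> carrier_mat (2 * n) (2 * n)" if "1 \<le> m" for m
    using theta_tail_Sp[OF c that] by (rule Sp_carrier_mat) 
  show "n \<ge> 1" by fact
  show "c m i \<noteq> 0" if "m \<in> {1..n}" "i \<in> {1..n}" for m i by (rule c[OF that])
  show "c m 0 = 1" if "m \<in> {1..n}" for m by (rule c0[OF that])
  show "p m 0 b = 0" for m b by (simp add: p_def)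
  show "p (Suc n) i b = (if b = i - 1 then 1 else 0)" if "i \<in> {1..n}" "b < n" for i b
    using that by (auto simp: p_def end_eq)
  show "w (Suc n) j b = 0" if "j \<in> {1..n}" "b < n" for j b
    using that by (auto simp: w_def end_eq)
  show "w m (Suc n) b = p (Suc m) n b / c m n" for m b by (simp add: w_def)
  fix m b assume m: "m \<in> {1..n}" and b: "b < n"
  let ?X = "theta_tail n c (Suc m)"
  let ?t = "\<lambda>i. ?X $$ (n - 1, b) + (\<Sum>l = i..n. c m l * ?X $$ (2 * n - l, b))"
  have rec: "theta_tail n c m = theta_factor n (c m) 1 * ?X"
    by (rule theta_tail_rec) (use c m in auto)
  have rows: "theta_tail n c m $$ (i - 1, b) =
      (if i = 1 then ?X $$ (i - 1, b) / c m i
       else ?X $$ (i - 2, b) + c m (i - 1) / c m i * ?X $$ (i - 1, b))"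
    "theta_tail n c m $$ (2 * n - i, b) = (if i = 1 then ?t i else ?t i / c m (i - 1))"
    if "i \<in> {1..n}" for i
    using theta_factor_rows[of n "c m" ?X b 1 i] c m b n that tail_c[of "Suc m"]
    unfolding rec by (auto simp del: index_mult_mat(1))
  show "p m i b = p (Suc m) (i - 1) b + c m (i - 1) / c m i * p (Suc m) i b" if "i \<in> {1..n}" for i
    using rows(1)[OF that] that c0[OF m] by (auto simp: p_def numeral_2_eq_2)
  have w_t: "w m j b = ?t j / c m (j - 1)" if "j \<in> {1..Suc n}" for j
  proof (cases "j = Suc n")
    case True
    then show ?thesis using n by (simp add: w_def p_def)
  next
    case False
    then show ?thesis using rows(2)[of j] that c0[OF m] by (auto simp: w_def)
  qed
  show "w m (Suc j) b = c m (j - 1) / c m j * w m j b - w (Suc m) j b" if j: "j \<in> {1..n}" for j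
  proof -
    have nz: "c m j \<noteq> 0" by (rule c[OF m j])
    have nz': "c m (j - 1) \<noteq> 0"
    proof (cases "j = 1")
      case False
      then have "j - 1 \<in> {1..n}" using j by auto
      then show ?thesis by (rule c[OF m])
    qed (use c0[OF m] in simp)
    define t where "t i = ?t i" for i
    have t_rec: "t j = c m j * ?X $$ (2 * n - j, b) + t (Suc j)"
      using j unfolding t_def by (simp add: sum.atLeast_Suc_atMost)
    have "w m j b = t j / c m (j - 1)" "w m (Suc j) b = t (Suc j) / c m j"
      using w_t[of j] w_t[of "Suc j"] j unfolding t_def by simp_all
    moreover have "w (Suc m) j b = ?X $$ (2 * n - j, b)" using j by (simp add: w_def)
    moreover have "t (Suc j) / c m j = c m (j - 1) / c m j * (t j / c m (j - 1)) - ?X $$ (2 * n - j, b)"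
      unfolding t_rec using nz nz' by (simp add: field_simps)
    ultimately show ?thesis by simp
  qed
qed

section \<open>Evaluation of the generalized minors\<close>

lemma lminor_y_sub_mult:
  assumes "i \<in> {1..n}" "M \<in> carrier_mat (2 * n) (2 * n)" "j \<le> n"
  shows "lminor j (y_sub n i t * M) = lminor j M"
proof -
  have y: "y_sub n i t \<in> lower_from n 0" using assms(1) by (intro y_sub_lower_from) auto
  have "lminor j (y_sub n i t * M) = lminor j (y_sub n i t) * lminor j M"
    using assms y by (intro lminor_mult_left[of _ "2 * n"]) (auto simp: lower_from_triangular)
  then show ?thesis using lower_from_lminor[OF y, of j] assms(3) by simp
qed

text \<open>Among the first n rows, \<open>x_sub n k t\<close> only adds a multiple of row k to row
  k - 1; this crosses the boundary of the leading j-block only for j = k.\<close>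

lemma lminor_x_sub_mult:
  assumes k: "k \<in> {1..n}" and M: "M \<in> carrier_mat (2 * n) (2 * n)" and j: "j \<le> n" "j \<noteq> k"
  shows "lminor j (x_sub n k t * M) = lminor j M"
proof -
  have y: "y_sub n k t \<in> lower_from n 0" using k by (intro y_sub_lower_from) auto
  have "lminor j (x_sub n k t * M) = lminor j (x_sub n k t) * lminor j M"
  proof (rule lminor_mult_left[of _ "2 * n"])
    fix a b assume ab: "a < j" "j \<le> b" "b < 2 * n"
    then have "\<not> (b = a + 1 \<and> (b = k \<or> b = 2 * n - k))" using j k by auto
    then show "x_sub n k t $$ (a, b) = 0"
      using k ab by (auto simp: x_sub_eq y_sub_index)
  qed (use k M j in auto)
  also have "lminor j (x_sub n k t) = 1"
    using lower_from_lminor[OF y, of j] k j by (simp add: x_sub_eq lminor_transpose[of _ "2 * n"])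
  finally show ?thesis by simp
qed

text \<open>The row moved into position k - 1 is a separate hypothesis because it is the lower row
  of v_(k+1)' for k < n but the upper row of v_n for k = n. Along the curve \<open>G\<close> only
  the minor of size k varies, as \<open>e (k - 1) + z\<close>; it may vanish at z = 0, which is why
  a curve is used.\<close>

lemma gen_minor_eq_coeff:
  assumes k: "k \<in> {1..n}" and \<Theta>: "\<Theta> \<in> carrier (Sp n)"
    and B: "\<And>p b. p < n \<Longrightarrow> b < p \<Longrightarrow> B p b = 0" "\<And>p. p < n \<Longrightarrow> B p p = 1"
    and rows: "\<And>a b. a < n \<Longrightarrow> b < n \<Longrightarrow>
      (- 1) ^ a * \<Theta> $$ (2 * n - 1 - a, b) = (\<Sum>p<n. t a p * B p b)"
    and t: "\<And>a. a < n \<Longrightarrow> t a a = 1" "\<And>a p. a < p \<Longrightarrow> p < n \<Longrightarrow> t a p = 0"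
    and row_k: "\<And>b. b < k \<Longrightarrow> - ((- 1) ^ k * \<Theta> $$ (2 * n - 1 - k, b)) = (\<Sum>p<k. e p * B p b)"
  shows "gen_minor n k (longest_elt n \<circ> simple_refl n k) id \<Theta> = e (k - 1)"
proof -
  let ?N = "2 * n"
  define h where "h = sympl_form n * \<Theta>"
  define g where "g = s_bar n k * h"
  define G where "G z = x_sub n k z * g" for z
  have \<Theta>c: "\<Theta> \<in> carrier_mat ?N ?N" using \<Theta> by (rule Sp_carrier_mat)
  have hc: "h \<in> carrier_mat ?N ?N" unfolding h_def using \<Theta>c by (intro mult_carrier_mat[of _ ?N ?N]) auto
  have g: "g = inv\<^bsub>Sp n\<^esub> (weyl_lift n (longest_elt n \<circ> simple_refl n k)) * \<Theta>"
    unfolding g_def h_def inv_weyl_lift[OF k] using k \<Theta>c by (intro mat_assoc[of _ ?N, symmetric]) auto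
  have "inv\<^bsub>Sp n\<^esub> (weyl_lift n (longest_elt n \<circ> simple_refl n k)) \<in> carrier (Sp n)"
    using group.inv_closed[OF group_Sp] weyl_lift_longest_simple_refl(2)[OF k] by blast
  then have gSp: "g \<in> carrier (Sp n)" unfolding g using \<Theta> by (rule Sp_mult)
  then have gc: "g \<in> carrier_mat ?N ?N" by (rule Sp_carrier_mat)
  have h_rows: "h $$ (a, b) = (\<Sum>p<n. t a p * B p b)" if "a < n" "b < n" for a b
    using that rows[OF that] sympl_form_mult_index[OF \<Theta>c, of a b] by (simp add: h_def)
  have minor_h: "lminor j h = 1" if "j \<le> n" for j
  proof -
    have "lminor j h = (\<Prod>a<j. t a a)"
      using that by (intro lminor_eq_prod_coeffs[where n = n and t = t and B = B] h_rows t(2) B) auto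
    also have "\<dots> = 1" using that t(1) by (intro prod.neutral) auto
    finally show ?thesis .
  qed
  \<comment> \<open>\<open>s_bar\<close> is a product of x_k and y_k factors, none of which changes
    a leading minor of size j \<noteq> k.\<close>
  have minor_G: "lminor j (G z) = 1" if "j \<le> n" "j \<noteq> k" for j z
  proof -
    have c: "x_sub n k (- 1) * h \<in> carrier_mat ?N ?N"
      "y_sub n k 1 * (x_sub n k (- 1) * h) \<in> carrier_mat ?N ?N"
      using k hc by (auto intro!: mult_carrier_mat[of _ ?N ?N])
    have "g = x_sub n k (- 1) * (y_sub n k 1 * (x_sub n k (- 1) * h))"
      unfolding g_def s_bar_def using k hc c by (simp add: mat_assoc[of _ ?N] mult_carrier_mat[of _ ?N ?N])
    then have "lminor j g = 1"
      using k hc c that minor_h by (simp add: lminor_x_sub_mult lminor_y_sub_mult)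
    then show ?thesis unfolding G_def using lminor_x_sub_mult[OF k gc that] by simp
  qed
  have trunc: "(\<Sum>p<n. t a p * B p b) = (\<Sum>p<k. t a p * B p b)" if "b < k" for a b
    by (rule sum.mono_neutral_right) (use k that B(1) in auto)
  have minor_G_k: "lminor k (G z) = e (k - 1) + z" for z
  proof -
    \<comment> \<open>Row k - 1 of \<open>G z\<close> is minus row k of h plus z times row k - 1 of
      h: \<open>s_bar\<close> swaps the two rows with one sign, and \<open>x_sub\<close> adds the
      lower one to the upper.\<close>
    define t' where "t' a p = (if a = k - 1 then e p + z * t a p else t a p)" for a p
    have "lminor k (G z) = (\<Prod>a<k. t' a a)"
    proof (rule lminor_eq_prod_coeffs[where n = k and t = t' and B = B])
      fix a b assume ab: "a < k" "b < k"
      then have aN: "a < ?N" "b < ?N" "b < n" using k by auto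
      have G: "G z $$ (a, b) = g $$ (a, b) +
          (if Suc a = k \<or> Suc a = ?N - k then z * g $$ (Suc a, b) else 0)"
        unfolding G_def by (rule x_sub_mult_index[OF k gc aN(1,2)])
      have gi: "g $$ (a, b) = (if Suc a = k \<or> Suc a = ?N - k then - 1 else 1) * h $$ (sigma n k a, b)"
        if "a < ?N" for a
        unfolding g_def by (rule s_bar_mult_index[OF k hc that aN(2)])
      show "G z $$ (a, b) = (\<Sum>p<k. t' a p * B p b)"
      proof (cases "a = k - 1")
        case True
        then have a: "Suc a = k" "k < ?N" using k ab by auto
        have "\<not> (Suc k = k \<or> Suc k = ?N - k)" using not_consecutive[OF k, of a] a by auto
        then have "g $$ (k, b) = h $$ (a, b)"
          using gi[OF a(2)] sigma_down[OF k, of k] a by auto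
        moreover have "g $$ (a, b) = - h $$ (k, b)"
          using gi[OF aN(1)] sigma_up[OF k, of a] a by auto
        moreover have "h $$ (a, b) = (\<Sum>p<k. t a p * B p b)"
          using h_rows[of a b] trunc[OF ab(2), of a] aN a k by simp
        moreover have "- h $$ (k, b) = (\<Sum>p<k. e p * B p b)"
          using row_k[OF ab(2)] sympl_form_mult_index[OF \<Theta>c a(2) aN(2)] by (simp add: h_def)
        ultimately have "G z $$ (a, b) = (\<Sum>p<k. e p * B p b) + z * (\<Sum>p<k. t a p * B p b)"
          using G a by simp
        then show ?thesis
          using True by (simp add: t'_def sum_distrib_left sum.distrib[symmetric] algebra_simps)
      next
        case False
        then have a: "\<not> (Suc a = k \<or> Suc a = ?N - k)" "sigma n k a = a"
          using ab k by (auto simp: sigma_def)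
        then have "G z $$ (a, b) = h $$ (a, b)" using G gi[OF aN(1)] by simp
        also have "\<dots> = (\<Sum>p<k. t a p * B p b)"
          using h_rows[of a b] trunc[OF ab(2), of a] aN ab k by simp
        finally show ?thesis using False by (simp add: t'_def)
      qed
    qed (use k t B in \<open>auto simp: t'_def\<close>)
    also have "\<dots> = (\<Prod>a<k. if a = k - 1 then e (k - 1) + z else 1)"
      using k t(1) by (intro prod.cong) (auto simp: t'_def)
    also have "\<dots> = e (k - 1) + z" using k by simp
    finally show ?thesis .
  qed
  have "principal_minor n k (G 0) = lminor k (G 0)"
  proof (rule principal_minor_limit[OF k])
    show "G z \<in> carrier (Sp n)" for z
      unfolding G_def by (intro Sp_mult x_sub_Sp k gSp)
    show "isCont (\<lambda>z. G z $$ (a, b)) 0" if "a < ?N" "b < ?N" for a b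
      unfolding G_def x_sub_mult_index[OF k gc that] by (cases "Suc a = k \<or> Suc a = ?N - k") auto
    have "\<forall>\<^sub>F z in at 0. z \<noteq> - e (k - 1)" by (rule eventually_neq_at_within)
    then show "\<forall>\<^sub>F z in at 0. \<forall>j\<in>{1..n}. lminor j (G z) \<noteq> 0"
    proof eventually_elim
      case (elim z)
      then have "e (k - 1) + z \<noteq> 0" by (metis add.commute eq_neg_iff_add_eq_0)
      then show ?case using minor_G minor_G_k by (metis atLeastAtMost_iff zero_neq_one)
    qed
  qed
  moreover have "G 0 = g"
    unfolding G_def using gc k carrier_matD(1)[OF x_sub_carrier[OF k, of 0]]
    by (intro eq_matI) (auto simp: x_sub_mult_index simp del: index_mult_mat(1))
  moreover have "gen_minor n k (longest_elt n \<circ> simple_refl n k) id \<Theta> = principal_minor n k g"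
    using gc by (simp add: gen_minor_def weyl_lift_id g[symmetric])
  ultimately show ?thesis using minor_G_k[of 0] by simp
qed

theorem theorem7p2:
  fixes n :: nat and c :: "nat \<Rightarrow> nat \<Rightarrow> complex"
  assumes "n \<ge> 2"
    and "\<And>m i. m \<in> {1..n} \<Longrightarrow> i \<in> {1..n} \<Longrightarrow> c m i \<noteq> 0"
    and "\<And>m. m \<in> {1..n} \<Longrightarrow> c m 0 = 1"
  shows "(\<forall>k \<in> {1..n - 1}.
            gen_minor n k (longest_elt n \<circ> simple_refl n k) id (Theta_minus n c)
            = 1 / c k 1 + (\<Sum>j = 1..k - 1. c j (k - j) / c j (k - j + 1)))
       \<and> gen_minor n n (longest_elt n \<circ> simple_refl n n) id (Theta_minus n c)
         = (\<Sum>(k, m) \<in> {(k, m). k + m = n \<and> m < n}.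
              \<Sum>l \<in> incr_seqs n k. \<Sum>u \<in> incr_seqs n m.
                (\<Prod>j = 1..m. C_frac n c j (u ! (j - 1))) *
                (\<Prod>i = 1..k. C_bar n c (l ! (i - 1) - i) (l ! (i - 1))))"
proof -
  define p where "p m i b = (if i = 0 then 0 else theta_tail n c m $$ (i - 1, b))" for m i b
  define w where "w m j b = (if j = Suc n then p (Suc m) n b / c m n else theta_tail n c m $$ (2 * n - j, b))" for m j b
  have n: "n \<ge> 1" using assms(1) by simp
  interpret theta_rows n c p w
    unfolding w_def[abs_def] p_def[abs_def] by (rule theta_rows_theta_tail[of n c]) (use n assms in auto)
  let ?\<Theta> = "Theta_minus n c"
  define B where "B q b = w (Suc q) 1 b" for q b
  define t where "t a q = (- 1) ^ a * elim_coeff d 1 a (Suc q)" for a q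
  have \<Theta>: "?\<Theta> \<in> carrier (Sp n)" unfolding Theta_minus_eq by (rule theta_tail_Sp[OF assms(2)]) auto
  have B: "B q b = 0" if "q < n" "b < q" for q b
    unfolding B_def by (rule w1_below) (use that in auto)
  have B1: "B q q = 1" if "q < n" for q
    using w1_diag[of "Suc q"] that by (simp add: B_def)
  have expand: "w 1 (Suc j) b = (\<Sum>q<n. elim_coeff d 1 j (Suc q) * B q b)" if "j \<le> n" "b < n" for j b
    using w_expand[OF that(2), of 1 j] that n by (simp add: B_def sum.atLeast1_atMost_eq)
  have low: "?\<Theta> $$ (2 * n - 1 - a, b) = w 1 (Suc a) b" if "a < n" for a b
    using that by (simp add: w_def Theta_minus_eq)
  have rows: "(- 1) ^ a * ?\<Theta> $$ (2 * n - 1 - a, b) = (\<Sum>q<n. t a q * B q b)" if "a < n" "b < n" for a b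
    using expand[of a b] that unfolding low[OF that(1)] t_def by (simp add: sum_distrib_left mult.assoc)
  have t: "t a a = 1" "a < q \<Longrightarrow> t a q = 0" for a q
    using elim_coeff_top[of d 1 a] by (simp_all add: t_def elim_coeff_above power_mult_distrib[symmetric])
  have part1: "gen_minor n k (longest_elt n \<circ> simple_refl n k) id ?\<Theta>
      = 1 / c k 1 + (\<Sum>j = 1..k - 1. c j (k - j) / c j (k - j + 1))" if k: "k \<in> {1..n - 1}" for k
  proof -
    obtain k' where k': "k = Suc k'" using k by (cases k) auto
    define e where "e q = - ((- 1) ^ k * elim_coeff d 1 k (Suc q))" for q
    have "gen_minor n k (longest_elt n \<circ> simple_refl n k) id ?\<Theta> = e (k - 1)"
    proof (rule gen_minor_eq_coeff[OF _ \<Theta> B B1 rows t])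
      fix b assume b: "b < k"
      have "- ((- 1) ^ k * ?\<Theta> $$ (2 * n - 1 - k, b)) = - ((- 1) ^ k * w 1 (Suc k) b)"
        using k by (subst low) auto
      also have "\<dots> = (\<Sum>q<n. e q * B q b)"
        using expand[of k b] k b by (simp add: e_def sum_distrib_left mult.assoc sum_negf)
      also have "\<dots> = (\<Sum>q<k. e q * B q b)"
        by (rule sum.mono_neutral_right) (use k b B in auto)
      finally show "- ((- 1) ^ k * ?\<Theta> $$ (2 * n - 1 - k, b)) = (\<Sum>q<k. e q * B q b)" .
    qed (use k in auto)
    \<comment> \<open>The sign in \<open>e\<close> cancels that of \<open>elim_coeff_subtop\<close>.
      The last summand is \<open>d k 1\<close>, which c_0 = 1 turns into 1 / c k 1.\<close>
    also have "e (k - 1) = (\<Sum>i\<le>k'. d (1 + i) (Suc k' - i))"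
      using elim_coeff_subtop[of d 1 k'] by (simp add: e_def k' power_mult_distrib[symmetric] mult.assoc[symmetric])
    also have "\<dots> = d k 1 + (\<Sum>i<k'. d (Suc i) (Suc k' - i))"
      by (simp add: k' lessThan_Suc_atMost[symmetric])
    also have "d k 1 = 1 / c k 1"
    proof -
      have "k \<in> {1..n}" using k by auto
      then show ?thesis using assms(3) by (simp add: d_def)
    qed
    also have "(\<Sum>i<k'. d (Suc i) (Suc k' - i)) = (\<Sum>j = 1..k - 1. c j (k - j) / c j (k - j + 1))"
      unfolding k' diff_Suc_1 One_nat_def sum.atLeast1_atMost_eq
      by (intro sum.cong refl) (auto simp: d_def Suc_diff_Suc Suc_diff_le)
    finally show ?thesis .
  qed
  have part2: "gen_minor n n (longest_elt n \<circ> simple_refl n n) id ?\<Theta> = (\<Sum>k = 1..n. c k n * Q k ^ 2)"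
  proof -
    define f where "f q = (\<Sum>k = 1..n. (- 1) ^ (k - 1) * Q k * c k n * elim_coeff d k n q)" for q
    define e where "e q = - ((- 1) ^ n * f (Suc q))" for q
    have "gen_minor n n (longest_elt n \<circ> simple_refl n n) id ?\<Theta> = e (n - 1)"
    proof (rule gen_minor_eq_coeff[OF _ \<Theta> B B1 rows t])
      fix b assume b: "b < n"
      \<comment> \<open>The index 2n - 1 - n is n - 1, the row of v_n.\<close>
      have "?\<Theta> $$ (2 * n - 1 - n, b) = p 1 n b" using n by (simp add: p_def Theta_minus_eq)
      also have "\<dots> = (\<Sum>q<n. f (Suc q) * B q b)"
        using p_1_n_expand[OF b] by (simp add: f_def B_def sum.atLeast1_atMost_eq)
      finally show "- ((- 1) ^ n * ?\<Theta> $$ (2 * n - 1 - n, b)) = (\<Sum>q<n. e q * B q b)"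
        by (simp add: e_def sum_distrib_left mult.assoc sum_negf)
    qed (use n in auto)
    also have "e (n - 1) = - ((- 1) ^ n * ((- 1) ^ (n - 1) * (\<Sum>k = 1..n. c k n * Q k ^ 2)))"
      unfolding e_def f_def using p_1_n_coeff n by simp
    also have "\<dots> = (\<Sum>k = 1..n. c k n * Q k ^ 2)"
      using n by (cases n) (simp_all add: power_mult_distrib[symmetric] mult.assoc[symmetric])
    finally show ?thesis .
  qed
  show ?thesis unfolding minor_sum using part1 part2 by blast
qed

end
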